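(* Let $n\ge 3$. The characteristic cohomology classes associated with admissible trees in $T_n$, $$\{\,[T^*]\in\widetilde H^{n-3}(T_n)\mid T\text{ admissible in }T_n\,\},$$ form a basis for the (reduced) cohomology of the complex of trees $T_n$.
   Context: **Trees.** A tree is a cycle-free (connected) graph; vertices of degree $1$ are its leaves. A rooted tree has one vertex of degree $>1$ marked as root. Internal vertices are the vertices other than the leaves and the root; they are assumed to have degree at least $3$. Equivalently, all non-leaves have outdegree at least $2$, where the outdegree of a vertex is the number of adjacent edges not lying on the path between the vertex and the root. A rooted tree is binary if all non-leaves have outdegree exactly $2$. An internal edge is an edge not adjacent to a leaf; a rooted binary tree on $n$ leaves has exactly $n-2$ internal edges and $n-1$ non-leaves (including the root). The combinatorial type of a rooted tree with labelled leaves is its equivalence class under label- and root-preserving homeomorphisms of trees as $1$-dimensional cell complexes. **Complex of trees.** For $n\ge 3$, $T_n$ is the abstract simplicial complex whose maximal simplices are the combinatorial types of binary rooted trees with $n$ leaves labelled $1,\dots,n$, and whose lower dimensional simplices are obtained by contracting at most $n-3$ internal edges. Thus vertices are the types of rooted trees with leaves labelled $1,\dots,n$ having exactly one internal edge, and a tree with $m\ge1$ internal edges is the $(m-1)$-simplex whose vertices are the $m$ trees obtained from it by contracting all but one of its internal edges; faces correspond to contracting internal edges. (The tree without internal edges corresponds to the empty simplex.) $T_n$ is pure of dimension $n-3$, and it is known to be homotopy equivalent to a wedge of spheres of dimension $n-3$, so its reduced cohomology is concentrated in degree $n-3$. **Admissible trees.** A binary rooted tree $T$ with $n$ leaves labelled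 $1,\dots,n$ is admissible if, when recording the second smallest label on the set of leaves below each of the $n-1$ non-leaves of $T$ (a leaf is below a non-leaf $t$ if the path from the leaf to the root passes through $t$), one finds each of the labels $2,\dots,n$ exactly once. **Characteristic classes.** For a maximal simplex $T$ of $T_n$ (with a chosen orientation), $[T^*]$ is the cohomology class of the cochain that evaluates to $1$ on $T$ and to $0$ on every other top dimensional simplex. Cohomology is reduced simplicial cohomology with integer coefficients. *)

theory Defs
  imports
    "HOL-Algebra.Coset"
    "HOL-Algebra.Elementary_Groups"
    "HOL-Algebra.FiniteProduct"
    "HOL-Combinatorics.Permutations"
begin

section \<open>Rooted trees with labelled leaves\<close>

text \<open>
  Vertices are natural numbers: every finite tree has a copy of this kind, so no combinatorial
  type is lost. Edges are two-element sets of vertices. \<open>leaf_of T i\<close> is the leaf carrying the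
  label \<open>i\<close>; its value matters only for labels in \<open>{1..n}\<close>.
\<close>

datatype ltree =
  LTree (verts: "nat set") (edges: "nat set set") (troot: nat) (leaf_of: "nat \<Rightarrow> nat")

definition is_path :: "ltree \<Rightarrow> nat list \<Rightarrow> bool" where
  "is_path T xs \<longleftrightarrow> xs \<noteq> [] \<and> distinct xs \<and> set xs \<subseteq> verts T \<and>
     successively (\<lambda>u v. {u, v} \<in> edges T) xs"

definition path_between :: "ltree \<Rightarrow> nat \<Rightarrow> nat \<Rightarrow> nat list \<Rightarrow> bool" where
  "path_between T u v xs \<longleftrightarrow> is_path T xs \<and> hd xs = u \<and> last xs = v"

definition edge_on_path :: "nat set \<Rightarrow> nat list \<Rightarrow> bool" where
  "edge_on_path e xs \<longleftrightarrow> (\<exists>i. Suc i < length xs \<and> e = {xs ! i, xs ! Suc i})"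

definition is_tree :: "ltree \<Rightarrow> bool" where
  "is_tree T \<longleftrightarrow>
     finite (verts T) \<and>
     edges T \<subseteq> {{u, v} | u v. u \<in> verts T \<and> v \<in> verts T \<and> u \<noteq> v} \<and>
     (\<forall>u\<in>verts T. \<forall>v\<in>verts T. \<exists>xs. path_between T u v xs) \<and>
     (\<nexists>xs. is_path T xs \<and> length xs \<ge> 3 \<and> {last xs, hd xs} \<in> edges T)"

definition vdegree :: "ltree \<Rightarrow> nat \<Rightarrow> nat" where
  "vdegree T v = card {e \<in> edges T. v \<in> e}"

definition leaves :: "ltree \<Rightarrow> nat set" where
  "leaves T = {v \<in> verts T. vdegree T v = 1}"

definition nonleaves :: "ltree \<Rightarrow> nat set" where
  "nonleaves T = verts T - leaves T"

definition rooted_tree :: "ltree \<Rightarrow> bool" where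
  "rooted_tree T \<longleftrightarrow> is_tree T \<and> troot T \<in> verts T \<and> vdegree T (troot T) > 1 \<and>
     (\<forall>v \<in> verts T - leaves T - {troot T}. vdegree T v \<ge> 3)"

definition labelled_tree :: "nat \<Rightarrow> ltree \<Rightarrow> bool" where
  "labelled_tree n T \<longleftrightarrow> rooted_tree T \<and> bij_betw (leaf_of T) {1..n} (leaves T)"

definition outdegree :: "ltree \<Rightarrow> nat \<Rightarrow> nat" where
  "outdegree T v =
     card {e \<in> edges T. v \<in> e \<and> \<not> (\<exists>xs. path_between T v (troot T) xs \<and> edge_on_path e xs)}"

definition binary_tree :: "nat \<Rightarrow> ltree \<Rightarrow> bool" where
  "binary_tree n T \<longleftrightarrow> labelled_tree n T \<and> (\<forall>v\<in>nonleaves T. outdegree T v = 2)"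

definition internal_edges :: "ltree \<Rightarrow> nat set set" where
  "internal_edges T = {e \<in> edges T. e \<inter> leaves T = {}}"

text \<open>
  Since no vertex other than the root has degree 2, a label- and root-preserving homeomorphism
  maps vertices to vertices, and the combinatorial type is the class of the tree under label-
  and root-preserving graph isomorphism.
\<close>

definition tree_iso :: "nat \<Rightarrow> ltree \<Rightarrow> ltree \<Rightarrow> bool" where
  "tree_iso n T T' \<longleftrightarrow> (\<exists>\<phi>.
     bij_betw \<phi> (verts T) (verts T') \<and>
     edges T' = (\<lambda>e. \<phi> ` e) ` edges T \<and>
     troot T' = \<phi> (troot T) \<and>
     (\<forall>i\<in>{1..n}. leaf_of T' i = \<phi> (leaf_of T i)))"

definition comb_type :: "nat \<Rightarrow> ltree \<Rightarrow> ltree set" where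
  "comb_type n T = {T'. labelled_tree n T' \<and> tree_iso n T T'}"

text \<open>
  \<open>contracts n T F T'\<close>: \<open>T'\<close> is a copy of the quotient graph \<open>T / F\<close>. The vertex map \<open>\<phi>\<close>
  identifies two vertices iff they are joined by a walk using only edges in \<open>F\<close>.
\<close>

definition contracts :: "nat \<Rightarrow> ltree \<Rightarrow> nat set set \<Rightarrow> ltree \<Rightarrow> bool" where
  "contracts n T F T' \<longleftrightarrow> (\<exists>\<phi>.
     verts T' = \<phi> ` verts T \<and>
     (\<forall>u\<in>verts T. \<forall>v\<in>verts T. \<phi> u = \<phi> v \<longleftrightarrow> (u, v) \<in> {(a, b). {a, b} \<in> F}\<^sup>*) \<and>
     edges T' = (\<lambda>e. \<phi> ` e) ` (edges T - F) \<and>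
     troot T' = \<phi> (troot T) \<and>
     (\<forall>i\<in>{1..n}. leaf_of T' i = \<phi> (leaf_of T i)))"


section \<open>The complex of trees\<close>

definition tree_simplex :: "nat \<Rightarrow> ltree \<Rightarrow> ltree set set" where
  "tree_simplex n T =
     {comb_type n T' | T' e. e \<in> internal_edges T \<and> contracts n T (internal_edges T - {e}) T'}"

text \<open>
  Contracting all internal edges of a binary tree is allowed; it yields the empty simplex, which
  belongs to the complex because its cohomology is to be reduced.
\<close>

definition tree_complex :: "nat \<Rightarrow> ltree set set set" where
  "tree_complex n =
     {tree_simplex n T' | T T' F. binary_tree n T \<and> F \<subseteq> internal_edges T \<and> contracts n T F T'}"


section \<open>Admissible trees\<close>

definition below :: "ltree \<Rightarrow> nat \<Rightarrow> nat \<Rightarrow> bool" where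
  "below T t x \<longleftrightarrow> (\<exists>xs. path_between T x (troot T) xs \<and> t \<in> set xs)"

definition labels_below :: "nat \<Rightarrow> ltree \<Rightarrow> nat \<Rightarrow> nat set" where
  "labels_below n T t = {i \<in> {1..n}. below T t (leaf_of T i)}"

definition second_smallest :: "nat set \<Rightarrow> nat" where
  "second_smallest A = Min (A - {Min A})"

definition admissible :: "nat \<Rightarrow> ltree \<Rightarrow> bool" where
  "admissible n T \<longleftrightarrow> binary_tree n T \<and>
     bij_betw (\<lambda>t. second_smallest (labels_below n T t)) (nonleaves T) {2..n}"

definition admissible_simplices :: "nat \<Rightarrow> ltree set set set" where
  "admissible_simplices n = {tree_simplex n T | T. admissible n T}"


section \<open>Reduced simplicial cohomology with integer coefficients\<close>

text \<open>
  \<open>K\<close> is an abstract simplicial complex containing the empty simplex. A \<open>p\<close>-cochain is an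
  alternating integer function on the ordered \<open>p\<close>-simplices \<open>[v\<^sub>0, \<dots>, v\<^sub>p]\<close>, extended by zero to
  all other lists. The degree \<open>p\<close> is an integer, so that degree \<open>-1\<close> (functions of the empty
  list) is included; the cochain groups in degrees below \<open>-1\<close> are zero.
\<close>

definition ordered_simplices :: "'v set set \<Rightarrow> int \<Rightarrow> 'v list set" where
  "ordered_simplices K p = {xs. distinct xs \<and> set xs \<in> K \<and> int (length xs) = p + 1}"

definition cochains :: "'v set set \<Rightarrow> int \<Rightarrow> ('v list \<Rightarrow> int) set" where
  "cochains K p = {f.
     (\<forall>xs. xs \<notin> ordered_simplices K p \<longrightarrow> f xs = 0) \<and>
     (\<forall>xs \<pi>. \<pi> permutes {..<length xs} \<longrightarrow> f (permute_list \<pi> xs) = sign \<pi> * f xs)}"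

definition cochain_group :: "'v set set \<Rightarrow> int \<Rightarrow> ('v list \<Rightarrow> int) monoid" where
  "cochain_group K p =
     \<lparr>carrier = cochains K p, monoid.mult = (\<lambda>f g xs. f xs + g xs), one = (\<lambda>xs. 0)\<rparr>"

definition coboundary :: "'v set set \<Rightarrow> int \<Rightarrow> ('v list \<Rightarrow> int) \<Rightarrow> 'v list \<Rightarrow> int" where
  "coboundary K p f xs =
     (if xs \<in> ordered_simplices K (p + 1)
      then \<Sum>i<length xs. (-1) ^ i * f (take i xs @ drop (Suc i) xs) else 0)"

definition cocycle_group :: "'v set set \<Rightarrow> int \<Rightarrow> ('v list \<Rightarrow> int) monoid" where
  "cocycle_group K p = (cochain_group K p)
     \<lparr>carrier := kernel (cochain_group K p) (cochain_group K (p + 1)) (coboundary K p)\<rparr>"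

definition coboundaries :: "'v set set \<Rightarrow> int \<Rightarrow> ('v list \<Rightarrow> int) set" where
  "coboundaries K p = coboundary K (p - 1) ` cochains K (p - 1)"

definition reduced_cohomology :: "'v set set \<Rightarrow> int \<Rightarrow> ('v list \<Rightarrow> int) set monoid" where
  "reduced_cohomology K p = cocycle_group K p Mod coboundaries K p"

definition cohomology_class ::
    "'v set set \<Rightarrow> int \<Rightarrow> ('v list \<Rightarrow> int) \<Rightarrow> ('v list \<Rightarrow> int) set" where
  "cohomology_class K p f = coboundaries K p #>\<^bsub>cocycle_group K p\<^esub> f"

text \<open>
  The cochain with value 1 on the oriented simplex \<open>xs\<close> and 0 on all other simplices. When \<open>xs\<close>
  is distinct, the sum has at most one term: the sign of the permutation taking \<open>xs\<close> to \<open>ys\<close>.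
\<close>

definition characteristic_cochain :: "'v list \<Rightarrow> 'v list \<Rightarrow> int" where
  "characteristic_cochain xs ys =
     (\<Sum>\<pi> | \<pi> permutes {..<length xs} \<and> permute_list \<pi> xs = ys. sign \<pi>)"


section \<open>Bases of abelian groups\<close>

text \<open>
  The family \<open>b\<close> indexed by \<open>I\<close> is a \<open>\<int>\<close>-basis of the abelian group \<open>G\<close> (written
  multiplicatively): every element is a finite integral combination of the \<open>b i\<close> with uniquely
  determined coefficients. In particular \<open>b\<close> is then injective on \<open>I\<close>.
\<close>

definition is_Z_basis :: "('g, 'm) monoid_scheme \<Rightarrow> 'i set \<Rightarrow> ('i \<Rightarrow> 'g) \<Rightarrow> bool" where
  "is_Z_basis G I b \<longleftrightarrow> comm_group G \<and> b \<in> I \<rightarrow> carrier G \<and>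
     (\<forall>x\<in>carrier G. \<exists>!c :: 'i \<Rightarrow> int.
        finite {i. c i \<noteq> 0} \<and> {i. c i \<noteq> 0} \<subseteq> I \<and>
        x = finprod G (\<lambda>i. b i [^]\<^bsub>G\<^esub> c i) {i. c i \<noteq> 0})"

end

theory Submission
  imports Defs
begin

text \<open>
  Cutting a rooted tree above its internal vertices turns it into a family of \<^emph>\<open>clusters\<close>, the sets
  of labels below these vertices. Contracting an internal edge deletes one cluster. The complex of
  trees thus becomes the complex of all families that extend to the clusters of a binary tree
  (\<open>tree_complex_eq\<close>), and a vertex of the complex is a single cluster (\<open>cluster_vertex\<close>).

  In a binary tree, an internal vertex with cluster \<open>Z\<close>, whose two children have clusters \<open>Z\<^sub>1\<close> and
  \<open>Z\<^sub>2\<close> and whose sibling has cluster \<open>S\<close>, witnesses one of the three ways to join \<open>Z\<^sub>1\<close>, \<open>Z\<^sub>2\<close> and \<open>S\<close>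
  in two steps. Call \<open>Z\<close> \<^emph>\<open>bad\<close> if it joins first the two blocks with the smallest minima. The
  combinatorial core is that every family \<open>F\<close> has exactly one binary refinement all of whose new
  clusters are bad: every branching is resolved by joining its blocks in the order of their minima
  (\<open>heaviest_canonical\<close>, \<open>canonical_sub\<close>). Consequently the families are partitioned into Boolean intervals, one for each
  binary tree, consisting of the families obtained by deleting some of its bad clusters. Adding or
  deleting one fixed bad cluster pairs off the members of an interval unless the tree has no bad
  cluster at all. Trees without bad clusters are precisely the admissible ones, because a bad
  cluster has the same second smallest label as its parent, whereas in the absence of bad clusters
  the second smallest label below a non-leaf is the larger of the minima below its two children
  (\<open>second_smallest_bij_iff\<close>).

  The pairing is acyclic: giving each cluster a weight dominated by its smallest label, the canonical
  refinement of \<open>F\<close> is the heaviest of all binary refinements of \<open>F\<close>, and a smaller family has more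
  refinements (\<open>matched_cluster_complex\<close>). For an acyclic pairing whose unpaired cells all have the
  top dimension, the equations for cocycles and coboundaries form triangular systems. Solving them
  shows that every cocycle is cohomologous to one that is supported on unpaired cells, and that no
  nonzero cochain of this kind is a coboundary (\<open>cocycle_cohomologous_to_critical\<close>,
  \<open>critical_coboundary_eq_0\<close>). This is the asserted basis, and the vanishing in the other degrees.
\<close>
section \<open>Alternating functions on lists\<close>

definition alternating :: "('v list \<Rightarrow> int) \<Rightarrow> bool" where
  "alternating f \<longleftrightarrow>
     (\<forall>xs \<pi>. \<pi> permutes {..<length xs} \<longrightarrow> f (permute_list \<pi> xs) = sign \<pi> * f xs)"

lemma permute_list_transpose_append:
  "permute_list (Transposition.transpose (length us) (Suc (length us + length ws))) (us @ [a] @ ws @ [b] @ vs)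
     = us @ [b] @ ws @ [a] @ vs" (is "permute_list ?t ?xs = ?ys")
proof (rule nth_equalityI)
  have perm: "?t permutes {..<length ?xs}"
    by (rule permutes_swap_id) auto
  show "length (permute_list ?t ?xs) = length ?ys" by simp
  fix i assume "i < length (permute_list ?t ?xs)"
  then have i: "i < length ?xs" by simp
  have "permute_list ?t ?xs ! i = ?xs ! (?t i)"
    by (rule permute_list_nth[OF perm i])
  also have "\<dots> = ?ys ! i"
    using i by (auto simp: Transposition.transpose_def nth_append nth_Cons split: nat.splits)
  finally show "permute_list ?t ?xs ! i = ?ys ! i" .
qed

text \<open>
  Adjacent transpositions generate the symmetric group, so signs need to be checked only for them;
  this form of the condition is the one that can be verified by recursion on lists.
\<close>

lemma alternating_iff_adjacent_swap:
  "alternating f \<longleftrightarrow> (\<forall>us a b vs. f (us @ [b, a] @ vs) = - f (us @ [a, b] @ vs))"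
proof
  assume alt: "alternating f"
  show "\<forall>us a b vs. f (us @ [b, a] @ vs) = - f (us @ [a, b] @ vs)"
  proof (intro allI)
    fix us :: "'a list" and a b vs
    let ?t = "Transposition.transpose (length us) (Suc (length us))"
    have "?t permutes {..<length (us @ [a, b] @ vs)}"
      by (rule permutes_swap_id) auto
    then have "f (permute_list ?t (us @ [a, b] @ vs)) = sign ?t * f (us @ [a, b] @ vs)"
      using alt unfolding alternating_def by blast
    then show "f (us @ [b, a] @ vs) = - f (us @ [a, b] @ vs)"
      using permute_list_transpose_append[of us "[]" a b vs] by (simp add: sign_swap_id)
  qed
next
  assume adj: "\<forall>us a b vs. f (us @ [b, a] @ vs) = - f (us @ [a, b] @ vs)"
  have swap: "f (us @ [b] @ ws @ [a] @ vs) = - f (us @ [a] @ ws @ [b] @ vs)" for us a b ws vs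
  proof (induction ws arbitrary: us)
    case Nil
    show ?case using adj[rule_format, of us b a vs] by simp
  next
    case (Cons w ws)
    have "f (us @ [b] @ (w # ws) @ [a] @ vs) = - f ((us @ [w]) @ [b] @ ws @ [a] @ vs)"
      using adj[rule_format, of us b w "ws @ [a] @ vs"] by simp
    also have "\<dots> = f (us @ [w, a] @ ws @ [b] @ vs)"
      using Cons.IH[of "us @ [w]"] by simp
    also have "\<dots> = - f (us @ [a] @ (w # ws) @ [b] @ vs)"
      using adj[rule_format, of us w a "ws @ [b] @ vs"] by simp
    finally show ?case .
  qed
  have transp: "f (permute_list (Transposition.transpose i j) xs) = - f xs"
    if "i < j" "j < length xs" for i j and xs :: "'a list"
  proof -
    define us where "us = take i xs"
    define ws where "ws = take (j - Suc i) (drop (Suc i) xs)"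
    define vs where "vs = drop (Suc j) xs"
    have "xs = us @ xs ! i # drop (Suc i) xs"
      using that unfolding us_def by (simp add: id_take_nth_drop)
    moreover have "drop (Suc i) xs = ws @ xs ! j # vs"
    proof -
      have "drop (Suc i) xs ! (j - Suc i) = xs ! j" using that by simp
      moreover have "drop (Suc (j - Suc i)) (drop (Suc i) xs) = vs" using that by (simp add: vs_def)
      moreover have "j - Suc i < length (drop (Suc i) xs)" using that by auto
      ultimately show ?thesis
        unfolding ws_def using id_take_nth_drop[of "j - Suc i" "drop (Suc i) xs"] by simp
    qed
    ultimately have "xs = us @ [xs ! i] @ ws @ [xs ! j] @ vs"
      by (metis append_Cons append_Nil)
    then obtain a b where xs: "xs = us @ [a] @ ws @ [b] @ vs" by blast
    have li: "length us = i" using that by (simp add: us_def)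
    have lj: "Suc (length us + length ws) = j" using that by (simp add: li ws_def)
    have "permute_list (Transposition.transpose i j) xs = us @ [b] @ ws @ [a] @ vs"
      using permute_list_transpose_append[of us ws a b vs]
      by (simp only: xs lj[symmetric] li[symmetric])
    then show ?thesis
      using swap[of us b ws a vs] by (simp only: xs)
  qed
  show "alternating f"
    unfolding alternating_def
  proof (intro allI impI)
    fix xs :: "'a list" and \<pi> assume perm: "\<pi> permutes {..<length xs}"
    define m where "m = length xs"
    have "\<pi> permutes {..<m}" "finite {..<m}" using perm by (auto simp: m_def)
    then have "\<forall>xs :: 'a list. length xs = m \<longrightarrow> f (permute_list \<pi> xs) = sign \<pi> * f xs"
    proof (induction rule: permutes_induct)
      case id
      then show ?case by simp
    next
      case (swap a b p)
      let ?t = "Transposition.transpose a b"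
      show ?case
      proof (intro allI impI)
        fix xs :: "'a list" assume len: "length xs = m"
        have t: "f (permute_list ?t xs) = - f xs"
          using transp[of a b xs] transp[of b a xs] swap.hyps(1-3) len
          by (cases "a < b") (auto simp: transpose_commute)
        have "f (permute_list (?t \<circ> p) xs) = f (permute_list p (permute_list ?t xs))"
          using swap.hyps(4) len by (subst permute_list_compose) auto
        also have "\<dots> = sign p * - f xs"
          using swap.IH len t by simp
        also have "\<dots> = sign (?t \<circ> p) * f xs"
        proof -
          have "permutation p" using swap.hyps(4) by (meson finite_lessThan permutation_permutes)
          then show ?thesis
            using swap.hyps(3) by (simp add: sign_compose permutation_swap_id sign_swap_id)
        qed
        finally show "f (permute_list (?t \<circ> p) xs) = sign (?t \<circ> p) * f xs" .
      qed
    qed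
    then show "f (permute_list \<pi> xs) = sign \<pi> * f xs" by (simp add: m_def)
  qed
qed

lemma alternating_adjacent_swap:
  "alternating f \<Longrightarrow> f (us @ [b, a] @ vs) = - f (us @ [a, b] @ vs)"
  unfolding alternating_iff_adjacent_swap by (elim allE) assumption

lemma alternating_eq_0_reorder:
  assumes "alternating f" "f xs = 0" "distinct xs" "distinct ys" "set xs = set ys"
  shows "f ys = 0"
proof -
  have "mset xs = mset ys" using assms set_eq_iff_mset_eq_distinct by blast
  then obtain \<pi> where "\<pi> permutes {..<length xs}" "permute_list \<pi> xs = ys"
    by (metis mset_eq_permutation)
  then show ?thesis using assms(1,2) unfolding alternating_def by fastforce
qed

section \<open>The alternating sum over deleted entries\<close>

definition alt_sum :: "('v list \<Rightarrow> int) \<Rightarrow> 'v list \<Rightarrow> int" where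
  "alt_sum f xs = (\<Sum>i<length xs. (-1) ^ i * f (take i xs @ drop (Suc i) xs))"

lemma alt_sum_Nil [simp]: "alt_sum f [] = 0"
  by (simp add: alt_sum_def)

lemma alt_sum_Cons: "alt_sum f (x # xs) = f xs - alt_sum (\<lambda>ys. f (x # ys)) xs"
  unfolding alt_sum_def length_Cons
  by (subst sum.lessThan_Suc_shift) (simp add: sum_negf)

lemma alt_sum_diff: "alt_sum (\<lambda>xs. f xs - g xs) xs = alt_sum f xs - alt_sum g xs"
  by (simp add: alt_sum_def right_diff_distrib sum_subtractf)

lemma alt_sum_minus: "alt_sum (\<lambda>xs. - f xs) xs = - alt_sum f xs"
  by (simp add: alt_sum_def sum_negf)

lemma alt_sum_eq_0:
  assumes "\<And>i. i < length xs \<Longrightarrow> f (take i xs @ drop (Suc i) xs) = 0"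
  shows "alt_sum f xs = 0"
  unfolding alt_sum_def using assms by (intro sum.neutral) auto

lemma alt_sum_cong:
  assumes "\<And>i. i < length xs \<Longrightarrow> f (take i xs @ drop (Suc i) xs) = g (take i xs @ drop (Suc i) xs)"
  shows "alt_sum f xs = alt_sum g xs"
  unfolding alt_sum_def using assms by (intro sum.cong) auto

text \<open>
  With the recursion on the first entry, the two defining properties of a coboundary operator are
  inductions on the list, for all functions simultaneously.
\<close>

lemma alt_sum_alt_sum: "alt_sum (alt_sum f) xs = 0"
proof (induction xs arbitrary: f)
  case Nil
  then show ?case by simp
next
  case (Cons x xs)
  then show ?case by (simp add: alt_sum_Cons alt_sum_diff)
qed

lemma alternating_alt_sum:
  assumes "alternating f"
  shows "alternating (alt_sum f)"
proof -
  have "alt_sum f (us @ [b, a] @ vs) = - alt_sum f (us @ [a, b] @ vs)"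
    if "\<forall>us a b vs. f (us @ [b, a] @ vs) = - f (us @ [a, b] @ vs)" for us a b vs and f :: "'a list \<Rightarrow> int"
    using that
  proof (induction us arbitrary: f)
    case Nil
    have "f (b # a # ws) = - f (a # b # ws)" for ws
      using Nil[rule_format, of "[]" b a ws] by simp
    then show ?case by (simp add: alt_sum_Cons alt_sum_minus)
  next
    case (Cons u us)
    have "\<forall>us a b vs. f (u # (us @ [b, a] @ vs)) = - f (u # (us @ [a, b] @ vs))"
      using Cons.prems by (metis append_Cons)
    from Cons.IH[OF this] have "alt_sum (\<lambda>ys. f (u # ys)) (us @ [b, a] @ vs)
        = - alt_sum (\<lambda>ys. f (u # ys)) (us @ [a, b] @ vs)" .
    moreover have "f (us @ [b, a] @ vs) = - f (us @ [a, b] @ vs)"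
      using Cons.prems by blast
    ultimately show ?case
      by (simp add: alt_sum_Cons)
  qed
  then show ?thesis using assms unfolding alternating_iff_adjacent_swap by blast
qed

section \<open>Cochains and the coboundary\<close>

lemma set_take_drop_Suc:
  assumes "distinct xs" "i < length xs"
  shows "set (take i xs @ drop (Suc i) xs) = set xs - {xs ! i}"
    and "distinct (take i xs @ drop (Suc i) xs)"
    and "length (take i xs @ drop (Suc i) xs) = length xs - 1"
proof -
  have xs: "xs = take i xs @ xs ! i # drop (Suc i) xs"
    using assms(2) by (rule id_take_nth_drop)
  then have d: "distinct (take i xs @ xs ! i # drop (Suc i) xs)" using assms(1) by simp
  show "set (take i xs @ drop (Suc i) xs) = set xs - {xs ! i}"
    using d arg_cong[OF xs, of set] by auto
  show "distinct (take i xs @ drop (Suc i) xs)" using d by auto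
  show "length (take i xs @ drop (Suc i) xs) = length xs - 1" using assms(2) by auto
qed

lemma cochains_iff:
  "f \<in> cochains K p \<longleftrightarrow> (\<forall>xs. xs \<notin> ordered_simplices K p \<longrightarrow> f xs = 0) \<and> alternating f"
  by (simp add: cochains_def alternating_def)

lemma cochains_zero: "(\<lambda>xs. 0) \<in> cochains K p"
  by (simp add: cochains_def)

lemma cochains_diff: "f \<in> cochains K p \<Longrightarrow> g \<in> cochains K p \<Longrightarrow> (\<lambda>xs. f xs - g xs) \<in> cochains K p"
  by (simp add: cochains_def right_diff_distrib)

lemma cochains_add: "f \<in> cochains K p \<Longrightarrow> g \<in> cochains K p \<Longrightarrow> (\<lambda>xs. f xs + g xs) \<in> cochains K p"
  by (simp add: cochains_def distrib_left)

lemma cochains_mult: "f \<in> cochains K p \<Longrightarrow> (\<lambda>xs. c * f xs) \<in> cochains K p"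
  by (simp add: cochains_def algebra_simps)

lemma cochains_sum:
  assumes "\<And>i. i \<in> I \<Longrightarrow> f i \<in> cochains K p"
  shows "(\<lambda>xs. \<Sum>i\<in>I. f i xs) \<in> cochains K p"
  using assms
proof (induction I rule: infinite_finite_induct)
  case (insert i I)
  then show ?case using cochains_add by fastforce
qed (simp_all add: cochains_zero)

lemma coboundary_diff:
  "coboundary K p (\<lambda>xs. f xs - g xs) xs = coboundary K p f xs - coboundary K p g xs"
  by (simp add: coboundary_def right_diff_distrib sum_subtractf)

lemma coboundary_add:
  "coboundary K p (\<lambda>xs. f xs + g xs) xs = coboundary K p f xs + coboundary K p g xs"
  by (simp add: coboundary_def distrib_left sum.distrib)

lemma coboundary_eq_alt_sum:
  "xs \<in> ordered_simplices K (p + 1) \<Longrightarrow> coboundary K p f xs = alt_sum f xs"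
  by (simp add: coboundary_def alt_sum_def)

lemma ordered_simplices_swap:
  "us @ [b, a] @ vs \<in> ordered_simplices K p \<longleftrightarrow> us @ [a, b] @ vs \<in> ordered_simplices K p"
proof -
  have "set (us @ [b, a] @ vs) = set (us @ [a, b] @ vs)" by auto
  moreover have "distinct (us @ [b, a] @ vs) = distinct (us @ [a, b] @ vs)" by auto
  ultimately show ?thesis by (simp add: ordered_simplices_def del: set_append distinct_append)
qed

lemma coboundary_in_cochains:
  assumes "f \<in> cochains K p"
  shows "coboundary K p f \<in> cochains K (p + 1)"
  unfolding cochains_iff
proof
  show "\<forall>xs. xs \<notin> ordered_simplices K (p + 1) \<longrightarrow> coboundary K p f xs = 0"
    by (simp add: coboundary_def)
  have "alternating (alt_sum f)" using assms cochains_iff alternating_alt_sum by blast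
  then have *: "alt_sum f (us @ [b, a] @ vs) = - alt_sum f (us @ [a, b] @ vs)" for us a b vs
    by (rule alternating_adjacent_swap)
  show "alternating (coboundary K p f)"
    unfolding alternating_iff_adjacent_swap
  proof (intro allI)
    fix us :: "'a list" and a b vs
    show "coboundary K p f (us @ [b, a] @ vs) = - coboundary K p f (us @ [a, b] @ vs)"
    proof (cases "us @ [a, b] @ vs \<in> ordered_simplices K (p + 1)")
      case True
      moreover from this have "us @ [b, a] @ vs \<in> ordered_simplices K (p + 1)"
        by (simp only: ordered_simplices_swap[of us b a vs K "p + 1"] not_False_eq_True)
      ultimately show ?thesis using *[of us b a vs] by (simp only: coboundary_eq_alt_sum)
    next
      case False
      moreover from this have "us @ [b, a] @ vs \<notin> ordered_simplices K (p + 1)"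
        by (simp only: ordered_simplices_swap[of us b a vs K "p + 1"] not_False_eq_True)
      ultimately show ?thesis by (simp only: coboundary_def if_False)
    qed
  qed
qed

lemma coboundary_coboundary:
  assumes "\<forall>F\<in>K. Pow F \<subseteq> K"
  shows "coboundary K (p + 1) (coboundary K p f) xs = 0"
proof (cases "xs \<in> ordered_simplices K (p + 1 + 1)")
  case True
  have "alt_sum (coboundary K p f) xs = alt_sum (alt_sum f) xs"
  proof (rule alt_sum_cong)
    fix i assume i: "i < length xs"
    have xs: "distinct xs" "set xs \<in> K" "int (length xs) = p + 3"
      using True by (auto simp: ordered_simplices_def)
    have "take i xs @ drop (Suc i) xs \<in> ordered_simplices K (p + 1)"
      unfolding ordered_simplices_def mem_Collect_eq set_take_drop_Suc(1)[OF xs(1) i]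
        set_take_drop_Suc(3)[OF xs(1) i]
      using set_take_drop_Suc(2)[OF xs(1) i] xs i assms by auto
    then show "coboundary K p f (take i xs @ drop (Suc i) xs) = alt_sum f (take i xs @ drop (Suc i) xs)"
      by (rule coboundary_eq_alt_sum)
  qed
  then show ?thesis using True alt_sum_alt_sum by (simp add: coboundary_eq_alt_sum)
qed (simp add: coboundary_def)

section \<open>Characteristic cochains\<close>

text \<open>Reindexing the defining sum by \<open>\<pi> \<mapsto> \<pi> \<circ> \<sigma>\<close> produces the sign of \<open>\<sigma>\<close>.\<close>

lemma alternating_characteristic_cochain: "alternating (characteristic_cochain xs)"
  unfolding alternating_def
proof (intro allI impI)
  fix ys :: "'a list" and \<sigma> assume \<sigma>: "\<sigma> permutes {..<length ys}"
  let ?A = "\<lambda>zs. {\<pi>. \<pi> permutes {..<length xs} \<and> permute_list \<pi> xs = zs}"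
  show "characteristic_cochain xs (permute_list \<sigma> ys) = sign \<sigma> * characteristic_cochain xs ys"
  proof (cases "length ys = length xs")
    case False
    then have "?A ys = {}" "?A (permute_list \<sigma> ys) = {}"
      by (auto dest: arg_cong[of _ _ length])
    then show ?thesis by (simp only: characteristic_cochain_def sum.empty mult_zero_right)
  next
    case True
    then have s: "\<sigma> permutes {..<length xs}" using \<sigma> by simp
    let ?\<tau> = "inv_into UNIV \<sigma>"
    have inv: "permute_list ?\<tau> (permute_list \<sigma> zs) = zs" if "length zs = length xs" for zs :: "'a list"
      using that s permutes_inv[OF s] permutes_inv_o(1)[OF s] permute_list_compose[of "?\<tau>" zs \<sigma>]
      by simp
    have "(\<Sum>\<pi>\<in>?A (permute_list \<sigma> ys). sign \<pi>) = (\<Sum>\<pi>\<in>?A ys. sign (\<pi> \<circ> \<sigma>))"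
    proof (rule sum.reindex_bij_witness[of _ "\<lambda>\<pi>. \<pi> \<circ> \<sigma>" "\<lambda>\<pi>. \<pi> \<circ> ?\<tau>"])
      fix \<pi> assume "\<pi> \<in> ?A (permute_list \<sigma> ys)"
      then have p: "\<pi> permutes {..<length xs}" "permute_list \<pi> xs = permute_list \<sigma> ys" by auto
      show "\<pi> \<circ> ?\<tau> \<circ> \<sigma> = \<pi>" by (simp add: comp_assoc permutes_inv_o(2)[OF s])
      have "permute_list (\<pi> \<circ> ?\<tau>) xs = permute_list ?\<tau> (permute_list \<sigma> ys)"
        using permute_list_compose[OF permutes_inv[OF s], of \<pi>] p(2) by simp
      then show "\<pi> \<circ> ?\<tau> \<in> ?A ys"
        using inv[OF True] p(1) permutes_compose[OF permutes_inv[OF s]] by simp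
      show "sign (\<pi> \<circ> ?\<tau> \<circ> \<sigma>) = sign \<pi>" by (simp add: comp_assoc permutes_inv_o(2)[OF s])
    next
      fix \<pi> assume "\<pi> \<in> ?A ys"
      then have p: "\<pi> permutes {..<length xs}" "permute_list \<pi> xs = ys" by auto
      show "\<pi> \<circ> \<sigma> \<circ> ?\<tau> = \<pi>" by (simp add: comp_assoc permutes_inv_o(1)[OF s])
      show "\<pi> \<circ> \<sigma> \<in> ?A (permute_list \<sigma> ys)"
        using permutes_compose[OF s p(1)] permute_list_compose[OF s, of \<pi>] p(2) by simp
    qed
    also have "\<dots> = (\<Sum>\<pi>\<in>?A ys. sign \<sigma> * sign \<pi>)"
    proof (rule sum.cong[OF refl])
      fix \<pi> assume "\<pi> \<in> ?A ys"
      then have "permutation \<pi>" "permutation \<sigma>"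
        using s by (auto simp: permutation_permutes intro: exI[of _ "{..<length xs}"])
      then show "sign (\<pi> \<circ> \<sigma>) = sign \<sigma> * sign \<pi>" by (simp add: sign_compose)
    qed
    finally show ?thesis by (simp add: characteristic_cochain_def sum_distrib_left)
  qed
qed

lemma characteristic_cochain_nonzeroD:
  assumes "characteristic_cochain xs ys \<noteq> 0"
  shows "mset ys = mset xs"
proof -
  have "{\<pi>. \<pi> permutes {..<length xs} \<and> permute_list \<pi> xs = ys} \<noteq> {}"
    using assms unfolding characteristic_cochain_def by (metis sum.empty)
  then show ?thesis by auto
qed

lemma characteristic_cochain_eq_0:
  assumes "set ys \<noteq> set xs"
  shows "characteristic_cochain xs ys = 0"
  using characteristic_cochain_nonzeroD[of xs ys] assms by (metis set_mset_mset)

lemma characteristic_cochain_self: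
  assumes "distinct xs"
  shows "characteristic_cochain xs xs = 1"
proof -
  have "\<pi> = id" if "\<pi> permutes {..<length xs}" "permute_list \<pi> xs = xs" for \<pi>
  proof
    fix i show "\<pi> i = id i"
    proof (cases "i < length xs")
      case True
      then have "xs ! \<pi> i = xs ! i" using permute_list_nth[OF that(1) True] that(2) by simp
      moreover have "\<pi> i < length xs" using permutes_in_image[OF that(1)] True by simp
      ultimately show ?thesis using assms True by (simp add: nth_eq_iff_index_eq)
    next
      case False
      then show ?thesis using that(1) by (simp add: permutes_not_in)
    qed
  qed
  then have "{\<pi>. \<pi> permutes {..<length xs} \<and> permute_list \<pi> xs = xs} = {id}"
    by (auto simp: permutes_id)
  then show ?thesis by (simp add: characteristic_cochain_def)
qed

lemma characteristic_cochain_in_cochains: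
  assumes "distinct xs" "set xs \<in> K" "int (length xs) = p + 1"
  shows "characteristic_cochain xs \<in> cochains K p"
  unfolding cochains_iff
proof (intro conjI allI impI alternating_characteristic_cochain)
  fix ys assume ys: "ys \<notin> ordered_simplices K p"
  show "characteristic_cochain xs ys = 0"
  proof (rule ccontr)
    assume "characteristic_cochain xs ys \<noteq> 0"
    then have m: "mset ys = mset xs" by (rule characteristic_cochain_nonzeroD)
    then have "set ys = set xs" "distinct ys" "length ys = length xs"
      using assms(1) by (metis set_mset_mset, metis mset_eq_imp_distinct_iff, metis size_mset)
    then show False using ys assms by (simp add: ordered_simplices_def)
  qed
qed

section \<open>Acyclic matchings with critical cells in the top dimension\<close>

text \<open>
  Every noncritical face \<open>F\<close> is paired with the face obtained by toggling the vertex \<open>e F\<close>. The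
  function \<open>\<rho>\<close> makes the pairing acyclic: nested faces with equal \<open>\<rho>\<close> toggle the same vertex, so a
  path that leaves its pair for another one must decrease \<open>\<rho>\<close>. All critical faces have the maximal
  number \<open>d\<close> of vertices.
\<close>

locale matched_complex =
  fixes K crit :: "'v set set" and e :: "'v set \<Rightarrow> 'v" and \<rho> :: "'v set \<Rightarrow> nat" and d :: nat
  assumes finite_K: "finite K"
    and finite_face: "F \<in> K \<Longrightarrow> finite F"
    and card_face: "F \<in> K \<Longrightarrow> card F \<le> d"
    and face_closed: "F \<in> K \<Longrightarrow> G \<subseteq> F \<Longrightarrow> G \<in> K"
    and crit_face: "F \<in> crit \<Longrightarrow> F \<in> K"
    and card_crit: "F \<in> crit \<Longrightarrow> card F = d"
    and insert_e: "F \<in> K - crit \<Longrightarrow> insert (e F) F \<in> K - crit"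
    and e_insert: "F \<in> K - crit \<Longrightarrow> e (insert (e F) F) = e F"
    and \<rho>_insert: "F \<in> K - crit \<Longrightarrow> \<rho> (insert (e F) F) = \<rho> F"
    and remove_e: "F \<in> K - crit \<Longrightarrow> F - {e F} \<notin> crit"
    and e_remove: "F \<in> K - crit \<Longrightarrow> e (F - {e F}) = e F"
    and \<rho>_mono: "F \<in> K \<Longrightarrow> G \<subseteq> F \<Longrightarrow> \<rho> G \<le> \<rho> F"
    and e_eq: "F \<in> K - crit \<Longrightarrow> G \<subseteq> F \<Longrightarrow> G \<notin> crit \<Longrightarrow> \<rho> G = \<rho> F \<Longrightarrow> e G = e F"
begin

lemma Pow_face: "\<forall>F\<in>K. Pow F \<subseteq> K"
  using face_closed by blast

definition upper :: "'v set set" where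
  "upper = {F \<in> K - crit. e F \<in> F}"

definition lower :: "'v set set" where
  "lower = {F \<in> K - crit. e F \<notin> F}"

definition vanishes_on :: "('v list \<Rightarrow> int) \<Rightarrow> 'v set set \<Rightarrow> bool" where
  "vanishes_on f A \<longleftrightarrow> (\<forall>xs. distinct xs \<longrightarrow> set xs \<in> A \<longrightarrow> f xs = 0)"

lemma insert_e_upper: "L \<in> lower \<Longrightarrow> insert (e L) L \<in> upper"
  using insert_e e_insert by (auto simp: upper_def lower_def)

lemma remove_e_lower:
  assumes "U \<in> upper"
  shows "U - {e U} \<in> lower" "e (U - {e U}) = e U" "\<rho> (U - {e U}) = \<rho> U"
proof -
  have U: "U \<in> K - crit" "e U \<in> U" using assms by (auto simp: upper_def)
  show e: "e (U - {e U}) = e U" using e_remove U by blast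
  have L: "U - {e U} \<in> K - crit" using remove_e U face_closed by blast
  then show "U - {e U} \<in> lower" using e by (simp add: lower_def)
  show "\<rho> (U - {e U}) = \<rho> U" using \<rho>_insert[OF L] e U by (simp add: insert_absorb)
qed

text \<open>
  The facets of an upper cell \<open>U\<close> that still contain \<open>e U\<close> are harmless for an induction along
  \<open>\<rho>\<close>: they are upper themselves or have a smaller value of \<open>\<rho>\<close>.
\<close>

lemma facet_of_upper:
  assumes U: "U \<in> upper" and G: "G \<subset> U" "e U \<in> G" and card: "card U = Suc (card G)"
  shows "G \<in> K - crit" "G \<in> upper \<or> \<rho> G < \<rho> U"
proof -
  have UK: "U \<in> K - crit" using U by (simp add: upper_def)
  have "card G < d" using card card_face[of U] UK by simp
  then show G': "G \<in> K - crit" using face_closed[of U G] UK G card_crit by auto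
  have "\<rho> G \<le> \<rho> U" using \<rho>_mono UK G by blast
  moreover have "G \<in> upper" if "\<rho> G = \<rho> U"
    using e_eq[OF UK, of G] that G G' by (auto simp: upper_def)
  ultimately show "G \<in> upper \<or> \<rho> G < \<rho> U" by force
qed

text \<open>
  On the list \<open>e L # xs\<close> the alternating sum begins with the value on the lower cell \<open>L\<close> itself;
  everything else lives on facets as in the preceding lemma.
\<close>

lemma alt_sum_at_matched_pair:
  assumes L: "L \<in> lower" and xs: "distinct xs" "set xs = L"
    and zero: "\<And>ys. distinct ys \<Longrightarrow> set ys \<in> upper \<or> set ys \<in> K - crit \<and> \<rho> (set ys) < \<rho> L
        \<Longrightarrow> e L \<in> set ys \<Longrightarrow> f ys = 0"
  shows "alt_sum f (e L # xs) = f xs"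
proof -
  have eL: "e L \<notin> set xs" "e L \<notin> L" using L xs by (auto simp: lower_def)
  have U: "insert (e L) L \<in> upper" by (rule insert_e_upper[OF L])
  have eU: "e (insert (e L) L) = e L" "\<rho> (insert (e L) L) = \<rho> L"
    using L e_insert \<rho>_insert by (auto simp: lower_def)
  have fin: "finite L" using L finite_face by (auto simp: lower_def)
  have "alt_sum (\<lambda>ys. f (e L # ys)) xs = 0"
  proof (rule alt_sum_eq_0)
    fix i assume i: "i < length xs"
    let ?ys = "take i xs @ drop (Suc i) xs" and ?G = "insert (e L) (L - {xs ! i})"
    have set: "set (e L # ?ys) = ?G" using set_take_drop_Suc(1)[OF xs(1) i] xs(2) by simp
    have dist: "distinct (e L # ?ys)"
      using set_take_drop_Suc(1,2)[OF xs(1) i] eL by auto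
    have x: "xs ! i \<in> L" "xs ! i \<noteq> e L" using i xs(2) eL(2) nth_mem[OF i] by auto
    have G: "?G \<subset> insert (e L) L" "e (insert (e L) L) \<in> ?G" using x eU by auto
    have "card (insert (e L) L) = Suc (card ?G)"
      using fin x eL by (simp add: card_Suc_Diff1 del: card_Diff_insert)
    note facet_of_upper[OF U G this]
    then show "f (e L # ?ys) = 0"
      using zero[OF dist] set eU by auto
  qed
  then show ?thesis by (simp add: alt_sum_Cons)
qed

text \<open>
  A cochain that vanishes on upper cells together with its coboundary vanishes on lower cells: the
  equation \<open>(\<delta> z) (e L # xs) = 0\<close> expresses \<open>z\<close> on \<open>L\<close> by values on cells with smaller \<open>\<rho>\<close>.
\<close>

lemma vanishes_on_lower:
  assumes z: "z \<in> cochains K p" "vanishes_on z upper"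
    and dz: "vanishes_on (coboundary K p z) upper"
  shows "vanishes_on z lower"
proof -
  have "\<forall>xs. distinct xs \<longrightarrow> set xs = L \<longrightarrow> z xs = 0" if "L \<in> lower" for L
    using that
  proof (induction "\<rho> L" arbitrary: L rule: less_induct)
    case (less L)
    show ?case
    proof (intro allI impI)
      fix xs assume xs: "distinct xs" "set xs = L"
      show "z xs = 0"
      proof (cases "xs \<in> ordered_simplices K p")
        case False
        then show ?thesis using z(1) cochains_iff by blast
      next
        case True
        have U: "insert (e L) L \<in> upper" by (rule insert_e_upper[OF less.prems])
        have eL: "e L \<notin> L" using less.prems by (simp add: lower_def)
        have "alt_sum z (e L # xs) = z xs"
        proof (rule alt_sum_at_matched_pair[OF less.prems xs])
          fix ys assume ys: "distinct ys"
            "set ys \<in> upper \<or> set ys \<in> K - crit \<and> \<rho> (set ys) < \<rho> L"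
          then consider "set ys \<in> upper" | "set ys \<in> lower" "\<rho> (set ys) < \<rho> L"
            by (auto simp: upper_def lower_def)
          then show "z ys = 0"
            using z(2) less.hyps ys(1) by cases (auto simp: vanishes_on_def)
        qed
        moreover have "e L # xs \<in> ordered_simplices K (p + 1)"
          using True U eL xs by (simp add: ordered_simplices_def upper_def)
        moreover have "coboundary K p z (e L # xs) = 0"
          using dz U eL xs by (simp add: vanishes_on_def)
        ultimately show ?thesis by (simp add: coboundary_eq_alt_sum)
      qed
    qed
  qed
  then show ?thesis by (auto simp: vanishes_on_def)
qed

text \<open>
  The same triangular system can be solved: the values on lower cells of a correcting cochain are
  chosen one level of \<open>\<rho>\<close> after the other, and a choice on one level does not disturb the levels
  below.
\<close>

lemma clear_upper:
  assumes z: "z \<in> cochains K p"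
  shows "\<exists>y \<in> cochains K (p - 1). vanishes_on (\<lambda>xs. z xs - coboundary K (p - 1) y xs) upper"
proof -
  have step: "\<exists>y \<in> cochains K (p - 1).
      vanishes_on (\<lambda>xs. z xs - coboundary K (p - 1) y xs) {U \<in> upper. \<rho> U < k}" for k
  proof (induction k)
    case 0
    then show ?case using cochains_zero by (auto simp: vanishes_on_def)
  next
    case (Suc k)
    then obtain y where y: "y \<in> cochains K (p - 1)"
      and y0: "vanishes_on (\<lambda>xs. z xs - coboundary K (p - 1) y xs) {U \<in> upper. \<rho> U < k}" by blast
    define z' where "z' = (\<lambda>xs. z xs - coboundary K (p - 1) y xs)"
    have z': "z' \<in> cochains K p"
      using cochains_diff[OF z coboundary_in_cochains[of _ K "p - 1", simplified, OF y]] by (simp add: z'_def)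
    have "\<forall>L. \<exists>xs. finite L \<longrightarrow> distinct xs \<and> set xs = L"
      using finite_distinct_list by blast
    then obtain ref where ref: "finite L \<Longrightarrow> distinct (ref L) \<and> set (ref L) = L" for L :: "'v set"
      by metis
    define S where "S = {L \<in> lower. \<rho> L = k \<and> int (card L) = p}"
    have finS: "finite S" using finite_K by (simp add: S_def lower_def)
    have S: "L \<in> S \<Longrightarrow> L \<in> K \<and> finite L" for L using finite_face by (auto simp: S_def lower_def)
    define w where "w = (\<lambda>xs. \<Sum>L\<in>S. z' (e L # ref L) * characteristic_cochain (ref L) xs)"
    have w: "w \<in> cochains K (p - 1)"
      unfolding w_def
    proof (intro cochains_sum cochains_mult characteristic_cochain_in_cochains)
      fix L assume "L \<in> S"
      then show "distinct (ref L)" "set (ref L) \<in> K" "int (length (ref L)) = p - 1 + 1"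
        using S[of L] ref[of L] distinct_card[of "ref L"] by (auto simp: S_def)
    qed
    have w_supp: "w xs = 0" if "set xs \<notin> S" for xs
      unfolding w_def
    proof (intro sum.neutral ballI)
      fix L assume "L \<in> S"
      then have "set (ref L) \<noteq> set xs" using that ref[of L] S[of L] by auto
      then show "z' (e L # ref L) * characteristic_cochain (ref L) xs = 0"
        by (simp add: characteristic_cochain_eq_0)
    qed
    have w_ref: "w (ref L) = z' (e L # ref L)" if L: "L \<in> S" for L
    proof -
      have "w (ref L) = (\<Sum>L'\<in>S. if L' = L then z' (e L # ref L) else 0)"
        unfolding w_def
      proof (intro sum.cong refl)
        fix L' assume L': "L' \<in> S"
        show "z' (e L' # ref L') * characteristic_cochain (ref L') (ref L)
            = (if L' = L then z' (e L # ref L) else 0)"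
          using ref[of L'] ref[of L] S[OF L] S[OF L']
          by (auto simp: characteristic_cochain_self characteristic_cochain_eq_0)
      qed
      then show ?thesis using finS L by simp
    qed
    define u where "u = (\<lambda>xs. z' xs - coboundary K (p - 1) w xs)"
    have u: "u \<in> cochains K p"
      using cochains_diff[OF z' coboundary_in_cochains[of _ K "p - 1", simplified, OF w]] by (simp add: u_def)
    have "u xs = 0" if xs: "distinct xs" "set xs = U" and U: "U \<in> upper" "\<rho> U < Suc k" for xs U
    proof (cases "int (card U) = p + 1")
      case False
      then have "xs \<notin> ordered_simplices K p"
        using xs distinct_card[of xs] by (auto simp: ordered_simplices_def)
      then show ?thesis using u cochains_iff by blast
    next
      case True
      define L where "L = U - {e U}"
      have L: "L \<in> lower" "e L = e U" "\<rho> L = \<rho> U"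
        using remove_e_lower[OF U(1)] by (auto simp: L_def)
      have UK: "U \<in> K" "e U \<in> U" "finite U" using U finite_face by (auto simp: upper_def)
      have finL: "finite L" using UK by (simp add: L_def)
      have cL: "int (card L) = p"
        using True card_Suc_Diff1[OF UK(3,2)] by (simp add: L_def)
      let ?us = "e L # ref L"
      have us: "distinct ?us" "set ?us = U"
        using ref[OF finL] UK L by (auto simp: L_def)
      have len: "int (length ?us) = p + 1"
        using us True distinct_card[of ?us] by simp
      have ord: "?us \<in> ordered_simplices K (p - 1 + 1)"
        using us len UK unfolding ordered_simplices_def by simp
      have "alt_sum w ?us = w (ref L)"
      proof (rule alt_sum_at_matched_pair[OF L(1)])
        fix ys assume "set ys \<in> upper \<or> set ys \<in> K - crit \<and> \<rho> (set ys) < \<rho> L"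
        then have "set ys \<notin> S"
          using L(3) U(2) by (auto simp: S_def upper_def lower_def)
        then show "w ys = 0" by (rule w_supp)
      qed (use ref[OF finL] in auto)
      then have dw: "coboundary K (p - 1) w ?us = w (ref L)"
        using ord by (simp add: coboundary_eq_alt_sum)
      have "u ?us = 0"
      proof (cases "\<rho> U = k")
        case True
        then have "L \<in> S" using L cL by (simp add: S_def)
        then show ?thesis using dw w_ref by (simp add: u_def)
      next
        case False
        then have "z' ?us = 0"
          using y0 U us by (simp add: vanishes_on_def z'_def)
        moreover have "w (ref L) = 0"
          using False L(3) ref[OF finL] by (intro w_supp) (simp add: S_def)
        ultimately show ?thesis using dw by (simp add: u_def)
      qed
      then show ?thesis
        using alternating_eq_0_reorder[of u ?us xs] u us xs by (simp add: cochains_iff)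
    qed
    then have "vanishes_on u {U \<in> upper. \<rho> U < Suc k}" by (simp add: vanishes_on_def)
    moreover have "u = (\<lambda>xs. z xs - coboundary K (p - 1) (\<lambda>xs. y xs + w xs) xs)"
      by (simp add: u_def z'_def coboundary_add diff_diff_eq)
    ultimately show ?case using cochains_add[OF y w] by auto
  qed
  define k where "k = Suc (Max (insert 0 (\<rho> ` upper)))"
  have "finite upper" using finite_K by (simp add: upper_def)
  then have "\<rho> U < k" if "U \<in> upper" for U
    using that by (simp add: k_def less_Suc_eq_le)
  then have "{U \<in> upper. \<rho> U < k} = upper" by blast
  then show ?thesis using step[of k] by simp
qed

text \<open>
  After clearing the upper cells of a cocycle, its values on lower cells vanish as well, which
  leaves the critical ones.
\<close>

theorem cocycle_cohomologous_to_critical: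
  assumes z: "z \<in> cochains K p" "coboundary K p z = (\<lambda>xs. 0)"
  shows "\<exists>y \<in> cochains K (p - 1). \<forall>xs. set xs \<notin> crit \<longrightarrow> z xs = coboundary K (p - 1) y xs"
proof -
  obtain y where y: "y \<in> cochains K (p - 1)"
    and up: "vanishes_on (\<lambda>xs. z xs - coboundary K (p - 1) y xs) upper"
    using clear_upper[OF z(1)] by blast
  define u where "u = (\<lambda>xs. z xs - coboundary K (p - 1) y xs)"
  have u: "u \<in> cochains K p"
    using cochains_diff[OF z(1) coboundary_in_cochains[of _ K "p - 1", simplified, OF y]] by (simp add: u_def)
  have "coboundary K p u xs = 0" for xs
    using z(2) coboundary_coboundary[OF Pow_face, of "p - 1" y xs]
    by (simp add: u_def coboundary_diff)
  then have low: "vanishes_on u lower"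
    using vanishes_on_lower[OF u] up by (simp add: u_def[symmetric] vanishes_on_def)
  have "u xs = 0" if "set xs \<notin> crit" for xs
  proof (cases "xs \<in> ordered_simplices K p")
    case True
    then have "distinct xs" "set xs \<in> upper \<union> lower"
      using that by (auto simp: ordered_simplices_def upper_def lower_def)
    then show ?thesis using low up by (auto simp: vanishes_on_def u_def)
  next
    case False
    then show ?thesis using u cochains_iff by blast
  qed
  then show ?thesis using y by (auto simp: u_def)
qed

text \<open>
  A primitive \<open>y\<close> of a critically supported cochain may be cleared on upper cells without changing
  its coboundary. It then vanishes on lower cells too, and there are no critical cells in its degree.
\<close>

theorem critical_coboundary_eq_0:
  assumes y: "y \<in> cochains K p" and p: "p + 1 \<noteq> int d"
    and supp: "\<And>xs. set xs \<notin> crit \<Longrightarrow> coboundary K p y xs = 0"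
  shows "coboundary K p y = (\<lambda>xs. 0)"
proof -
  obtain w where w: "w \<in> cochains K (p - 1)"
    and up: "vanishes_on (\<lambda>xs. y xs - coboundary K (p - 1) w xs) upper"
    using clear_upper[OF y] by blast
  define u where "u = (\<lambda>xs. y xs - coboundary K (p - 1) w xs)"
  have u: "u \<in> cochains K p"
    using cochains_diff[OF y coboundary_in_cochains[of _ K "p - 1", simplified, OF w]] by (simp add: u_def)
  have du: "coboundary K p u xs = coboundary K p y xs" for xs
    using coboundary_coboundary[OF Pow_face, of "p - 1" w xs]
    by (simp add: u_def coboundary_diff)
  have "vanishes_on (coboundary K p u) upper"
    using supp du by (auto simp: vanishes_on_def upper_def)
  then have low: "vanishes_on u lower"
    using vanishes_on_lower[OF u] up by (simp add: u_def[symmetric])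
  have "u xs = 0" for xs
  proof (cases "xs \<in> ordered_simplices K p")
    case True
    then have xs: "distinct xs" "set xs \<in> K" "int (length xs) = p + 1"
      by (auto simp: ordered_simplices_def)
    then have "set xs \<notin> crit" using p card_crit distinct_card by fastforce
    then have "set xs \<in> upper \<union> lower" using xs by (auto simp: upper_def lower_def)
    then show ?thesis using xs low up by (auto simp: vanishes_on_def u_def)
  next
    case False
    then show ?thesis using u cochains_iff by blast
  qed
  then have "u = (\<lambda>xs. 0)" by blast
  then have "coboundary K p u xs = 0" for xs by (simp add: coboundary_def)
  then show ?thesis using du by auto
qed

end

section \<open>Cohomology of a matched complex\<close>

lemma carrier_cocycle_group:
  "carrier (cocycle_group K p) = {f \<in> cochains K p. coboundary K p f = (\<lambda>xs. 0)}"
  by (simp add: cocycle_group_def cochain_group_def kernel_def)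

lemma mult_cocycle_group: "f \<otimes>\<^bsub>cocycle_group K p\<^esub> g = (\<lambda>xs. f xs + g xs)"
  by (simp add: cocycle_group_def cochain_group_def)

lemma one_cocycle_group: "\<one>\<^bsub>cocycle_group K p\<^esub> = (\<lambda>xs. 0)"
  by (simp add: cocycle_group_def cochain_group_def)

lemmas cocycle_group_simps = carrier_cocycle_group mult_cocycle_group one_cocycle_group

lemma coboundary_zero: "coboundary K p (\<lambda>xs. 0) = (\<lambda>xs. 0)"
  by (auto simp: coboundary_def)

lemma cocycles_minus:
  assumes "f \<in> carrier (cocycle_group K p)"
  shows "(\<lambda>xs. - f xs) \<in> carrier (cocycle_group K p)"
  using assms cochains_diff[OF cochains_zero, of f K p] coboundary_diff[of K p "\<lambda>xs. 0" f]
  by (simp add: carrier_cocycle_group coboundary_zero fun_eq_iff)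

lemma comm_group_cocycle_group: "comm_group (cocycle_group K p)"
proof (rule comm_groupI)
  fix f assume f: "f \<in> carrier (cocycle_group K p)"
  show "\<exists>g\<in>carrier (cocycle_group K p). g \<otimes>\<^bsub>cocycle_group K p\<^esub> f = \<one>\<^bsub>cocycle_group K p\<^esub>"
    using cocycles_minus[OF f] by (intro bexI[of _ "\<lambda>xs. - f xs"]) (simp_all add: cocycle_group_simps)
next
  show "\<one>\<^bsub>cocycle_group K p\<^esub> \<in> carrier (cocycle_group K p)"
    using cochains_zero by (simp add: cocycle_group_simps coboundary_zero)
qed (auto simp: cocycle_group_simps cochains_add coboundary_add algebra_simps)

lemma subgroup_coboundaries:
  assumes "\<forall>F\<in>K. Pow F \<subseteq> K"
  shows "subgroup (coboundaries K p) (cocycle_group K p)"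
proof -
  interpret comm_group "cocycle_group K p" by (rule comm_group_cocycle_group)
  have in_carrier: "coboundaries K p \<subseteq> carrier (cocycle_group K p)"
    using coboundary_in_cochains[of _ K "p - 1"] coboundary_coboundary[OF assms, of "p - 1"]
    by (auto simp: coboundaries_def cocycle_group_simps)
  have diff: "(\<lambda>xs. f xs - g xs) \<in> coboundaries K p" if "f \<in> coboundaries K p" "g \<in> coboundaries K p" for f g
  proof -
    obtain f' g' where "f' \<in> cochains K (p - 1)" "f = coboundary K (p - 1) f'"
      "g' \<in> cochains K (p - 1)" "g = coboundary K (p - 1) g'"
      using \<open>f \<in> _\<close> \<open>g \<in> _\<close> by (auto simp: coboundaries_def)
    then show ?thesis
      unfolding coboundaries_def
      by (intro image_eqI[of _ _ "\<lambda>xs. f' xs - g' xs"]) (auto simp: coboundary_diff cochains_diff)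
  qed
  have zero: "(\<lambda>xs. 0) \<in> coboundaries K p"
    unfolding coboundaries_def
    by (rule image_eqI[of _ _ "\<lambda>xs. 0"]) (auto simp: cochains_zero coboundary_def)
  have add: "(\<lambda>xs. f xs + g xs) \<in> coboundaries K p" if "f \<in> coboundaries K p" "g \<in> coboundaries K p" for f g
    using diff[OF that(1) diff[OF zero that(2)]] by simp
  show ?thesis
  proof (rule subgroupI)
    fix f assume f: "f \<in> coboundaries K p"
    have "inv\<^bsub>cocycle_group K p\<^esub> f = (\<lambda>xs. 0 - f xs)"
    proof (rule inv_equality)
      show "(\<lambda>xs. 0 - f xs) \<in> carrier (cocycle_group K p)" using diff[OF zero f] in_carrier by auto
    qed (use f in_carrier in \<open>auto simp: cocycle_group_simps\<close>)
    then show "inv\<^bsub>cocycle_group K p\<^esub> f \<in> coboundaries K p" using diff[OF zero f] by simp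
  qed (use in_carrier zero add in \<open>auto simp: mult_cocycle_group\<close>)
qed

lemma int_pow_cocycle_group:
  assumes f: "f \<in> carrier (cocycle_group K p)"
  shows "f [^]\<^bsub>cocycle_group K p\<^esub> (c :: int) = (\<lambda>xs. c * f xs)"
proof -
  interpret comm_group "cocycle_group K p" by (rule comm_group_cocycle_group)
  have nat: "f [^]\<^bsub>cocycle_group K p\<^esub> (m :: nat) = (\<lambda>xs. int m * f xs)" for m
    by (induction m) (auto simp: cocycle_group_simps algebra_simps)
  have inv: "inv\<^bsub>cocycle_group K p\<^esub> (\<lambda>xs. int m * f xs) = (\<lambda>xs. - int m * f xs)" for m
  proof (rule inv_equality)
    have closed: "(\<lambda>xs. int m * f xs) \<in> carrier (cocycle_group K p)"
      using nat_pow_closed[OF f, of m] by (simp add: nat)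
    then show "(\<lambda>xs. int m * f xs) \<in> carrier (cocycle_group K p)" .
    show "(\<lambda>xs. - int m * f xs) \<in> carrier (cocycle_group K p)"
      using cocycles_minus[OF closed] by simp
  qed (simp add: cocycle_group_simps)
  show ?thesis
  proof (cases c rule: int_cases2)
    case (nonneg m)
    then show ?thesis by (simp only: int_pow_int nat)
  next
    case (nonpos m)
    then show ?thesis by (simp only: int_pow_neg_int[OF f] nat inv)
  qed
qed

lemma cohomology_class_eq_iff:
  assumes K: "\<forall>F\<in>K. Pow F \<subseteq> K"
    and f: "f \<in> carrier (cocycle_group K p)" and g: "g \<in> carrier (cocycle_group K p)"
  shows "cohomology_class K p f = cohomology_class K p g \<longleftrightarrow>
    (\<exists>y \<in> cochains K (p - 1). \<forall>xs. f xs - g xs = coboundary K (p - 1) y xs)" (is "?L \<longleftrightarrow> ?R")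
proof
  interpret comm_group "cocycle_group K p" by (rule comm_group_cocycle_group)
  note sub = subgroup_coboundaries[OF K]
  {
    assume ?L
    then have "f \<in> cohomology_class K p g"
      using rcos_self[OF f sub] by (simp add: cohomology_class_def)
    then show ?R
      by (auto simp: cohomology_class_def r_coset_def mult_cocycle_group coboundaries_def)
  next
    assume ?R
    then obtain y where y: "y \<in> cochains K (p - 1)" "\<And>xs. f xs - g xs = coboundary K (p - 1) y xs"
      by blast
    have "f = coboundary K (p - 1) y \<otimes>\<^bsub>cocycle_group K p\<^esub> g"
      using y(2) by (auto simp: mult_cocycle_group fun_eq_iff algebra_simps)
    moreover have "coboundary K (p - 1) y \<in> coboundaries K p"
      using y(1) by (simp add: coboundaries_def)
    ultimately have "f \<in> coboundaries K p #>\<^bsub>cocycle_group K p\<^esub> g"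
      unfolding r_coset_def by blast
    then show ?L
      unfolding cohomology_class_def using repr_independence[OF _ g sub] by simp
  }
qed

lemma comm_group_reduced_cohomology:
  assumes "\<forall>F\<in>K. Pow F \<subseteq> K"
  shows "comm_group (reduced_cohomology K p)"
  unfolding reduced_cohomology_def
  using comm_group.abelian_FactGroup[OF comm_group_cocycle_group subgroup_coboundaries[OF assms]] .

lemma cohomology_class_hom:
  assumes "\<forall>F\<in>K. Pow F \<subseteq> K"
  shows "cohomology_class K p \<in> hom (cocycle_group K p) (reduced_cohomology K p)"
proof -
  interpret comm_group "cocycle_group K p" by (rule comm_group_cocycle_group)
  have "coboundaries K p \<lhd> cocycle_group K p"
    by (simp only: normal_iff_subgroup subgroup_coboundaries[OF assms])
  from normal.r_coset_hom_Mod[OF this] show ?thesis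
    by (simp add: reduced_cohomology_def cohomology_class_def[abs_def])
qed

lemma carrier_reduced_cohomology:
  "carrier (reduced_cohomology K p) = cohomology_class K p ` carrier (cocycle_group K p)"
  by (simp add: reduced_cohomology_def carrier_FactGroup cohomology_class_def[abs_def])

text \<open>Combinations in the multiplicatively written cohomology group are computed on cochains.\<close>

lemma finprod_cohomology_class:
  assumes K: "\<forall>F\<in>K. Pow F \<subseteq> K"
    and "finite S" "\<And>i. i \<in> S \<Longrightarrow> f i \<in> carrier (cocycle_group K p)"
  shows "(\<lambda>xs. \<Sum>i\<in>S. c i * f i xs) \<in> carrier (cocycle_group K p) \<and>
    finprod (reduced_cohomology K p) (\<lambda>i. cohomology_class K p (f i) [^]\<^bsub>reduced_cohomology K p\<^esub> (c i :: int)) S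
      = cohomology_class K p (\<lambda>xs. \<Sum>i\<in>S. c i * f i xs)"
  using assms(2,3)
proof (induction S)
  case empty
  interpret Z: comm_group "cocycle_group K p" by (rule comm_group_cocycle_group)
  interpret H: comm_group "reduced_cohomology K p" by (rule comm_group_reduced_cohomology[OF K])
  interpret group_hom "cocycle_group K p" "reduced_cohomology K p" "cohomology_class K p"
    using cohomology_class_hom[OF K] by unfold_locales
  show ?case
    using Z.one_closed hom_one by (simp add: one_cocycle_group)
next
  case (insert i S)
  interpret Z: comm_group "cocycle_group K p" by (rule comm_group_cocycle_group)
  interpret H: comm_group "reduced_cohomology K p" by (rule comm_group_reduced_cohomology[OF K])
  interpret group_hom "cocycle_group K p" "reduced_cohomology K p" "cohomology_class K p"
    using cohomology_class_hom[OF K] by unfold_locales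
  let ?s = "\<lambda>xs. \<Sum>i\<in>S. c i * f i xs"
  have s: "?s \<in> carrier (cocycle_group K p)" and
    IH: "finprod (reduced_cohomology K p) (\<lambda>i. cohomology_class K p (f i) [^]\<^bsub>reduced_cohomology K p\<^esub> c i) S
      = cohomology_class K p ?s"
    using insert by auto
  have fi: "f i \<in> carrier (cocycle_group K p)" using insert by simp
  have cfi: "(\<lambda>xs. c i * f i xs) \<in> carrier (cocycle_group K p)"
    using Z.int_pow_closed[OF fi, of "c i"] by (simp add: int_pow_cocycle_group[OF fi])
  have pow: "cohomology_class K p (f i) [^]\<^bsub>reduced_cohomology K p\<^esub> c i = cohomology_class K p (\<lambda>xs. c i * f i xs)"
    using hom_int_pow[OF fi, of "c i"] by (simp add: int_pow_cocycle_group[OF fi])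
  have eq: "(\<lambda>xs. \<Sum>i\<in>insert i S. c i * f i xs) = (\<lambda>xs. c i * f i xs) \<otimes>\<^bsub>cocycle_group K p\<^esub> ?s"
    using insert by (simp add: mult_cocycle_group)
  have "finprod (reduced_cohomology K p) (\<lambda>i. cohomology_class K p (f i) [^]\<^bsub>reduced_cohomology K p\<^esub> c i) (insert i S)
      = cohomology_class K p (\<lambda>xs. c i * f i xs) \<otimes>\<^bsub>reduced_cohomology K p\<^esub> cohomology_class K p ?s"
    using insert hom_closed[OF cfi] by (subst H.finprod_insert) (auto simp: IH pow)
  also have "\<dots> = cohomology_class K p (\<lambda>xs. \<Sum>i\<in>insert i S. c i * f i xs)"
    unfolding eq using cfi s by simp
  finally show ?case using cfi s unfolding eq by simp
qed

context matched_complex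
begin

text \<open>
  Up to a factor, the characteristic cochain is the only alternating function supported on one cell.
\<close>

lemma critical_cochain_expansion:
  assumes u: "u \<in> cochains K p" and supp: "\<And>xs. set xs \<notin> crit \<Longrightarrow> u xs = 0"
    and p: "p = int d - 1"
    and orient: "\<And>\<sigma>. \<sigma> \<in> crit \<Longrightarrow> distinct (orient \<sigma>) \<and> set (orient \<sigma>) = \<sigma>"
  shows "u xs = (\<Sum>\<sigma>\<in>crit. u (orient \<sigma>) * characteristic_cochain (orient \<sigma>) xs)"
proof -
  have fin: "finite crit" using finite_K crit_face by (meson finite_subset subsetI)
  have char: "characteristic_cochain (orient \<sigma>) \<in> cochains K p" if "\<sigma> \<in> crit" for \<sigma>
    using orient[OF that] crit_face[OF that] card_crit[OF that] p distinct_card[of "orient \<sigma>"]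
    by (intro characteristic_cochain_in_cochains) auto
  define v where "v = (\<lambda>xs. u xs - (\<Sum>\<sigma>\<in>crit. u (orient \<sigma>) * characteristic_cochain (orient \<sigma>) xs))"
  have v: "v \<in> cochains K p"
    unfolding v_def using u char by (intro cochains_diff cochains_sum cochains_mult)
  have char0: "characteristic_cochain (orient \<sigma>) xs = 0" if "\<sigma> \<in> crit" "set xs \<noteq> \<sigma>" for \<sigma> xs
    using orient[OF that(1)] that(2) by (simp add: characteristic_cochain_eq_0)
  have "v xs = 0"
  proof (cases "set xs \<in> crit \<and> distinct xs")
    case False
    show ?thesis
    proof (cases "set xs \<in> crit")
      case True
      then have "xs \<notin> ordered_simplices K p" using False by (simp add: ordered_simplices_def)
      then show ?thesis using v cochains_iff by blast
    next
      case False
      then have "(\<Sum>\<sigma>\<in>crit. u (orient \<sigma>) * characteristic_cochain (orient \<sigma>) xs) = 0"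
        using char0 by (intro sum.neutral ballI) (metis mult_zero_right)
      then show ?thesis using supp[OF False] by (simp add: v_def)
    qed
  next
    case True
    define \<sigma> where "\<sigma> = set xs"
    have \<sigma>: "\<sigma> \<in> crit" using True by (simp add: \<sigma>_def)
    have "(\<Sum>\<tau>\<in>crit. u (orient \<tau>) * characteristic_cochain (orient \<tau>) (orient \<sigma>))
        = (\<Sum>\<tau>\<in>crit. if \<tau> = \<sigma> then u (orient \<sigma>) else 0)"
      using char0[of _ "orient \<sigma>"] orient[OF \<sigma>]
      by (intro sum.cong refl) (auto simp: characteristic_cochain_self)
    then have "v (orient \<sigma>) = 0" using fin \<sigma> by (simp add: v_def)
    then show ?thesis
      using alternating_eq_0_reorder[of v "orient \<sigma>" xs] v orient[OF \<sigma>] True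
      by (simp add: cochains_iff \<sigma>_def)
  qed
  then show ?thesis by (simp add: v_def)
qed

text \<open>
  In the top degree every cochain is a cocycle. Coefficients are recovered by evaluating a critically
  supported representative on the chosen orientations, and this representative is unique because no
  other one differs from it by a coboundary.
\<close>

theorem critical_classes_basis:
  assumes orient: "\<And>\<sigma>. \<sigma> \<in> crit \<Longrightarrow> distinct (orient \<sigma>) \<and> set (orient \<sigma>) = \<sigma>"
  shows "is_Z_basis (reduced_cohomology K (int d - 1)) crit
           (\<lambda>\<sigma>. cohomology_class K (int d - 1) (characteristic_cochain (orient \<sigma>)))"
proof -
  define p where "p = int d - 1"
  let ?H = "reduced_cohomology K p" and ?cl = "cohomology_class K p"
  define \<chi> where "\<chi> = (\<lambda>\<sigma>. characteristic_cochain (orient \<sigma>))"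
  note closed = Pow_face
  have fin: "finite crit" using finite_K crit_face by (meson finite_subset subsetI)
  interpret Z: comm_group "cocycle_group K p" by (rule comm_group_cocycle_group)
  have top: "f \<in> carrier (cocycle_group K p)" if "f \<in> cochains K p" for f
  proof -
    have "xs \<notin> ordered_simplices K (p + 1)" for xs
      using card_face[of "set xs"] distinct_card[of xs] by (auto simp: ordered_simplices_def p_def)
    then show ?thesis using that by (auto simp: carrier_cocycle_group coboundary_def)
  qed
  have \<chi>: "\<chi> \<sigma> \<in> cochains K p" if "\<sigma> \<in> crit" for \<sigma>
    using orient[OF that] crit_face[OF that] card_crit[OF that] distinct_card[of "orient \<sigma>"]
    unfolding \<chi>_def p_def by (intro characteristic_cochain_in_cochains) auto
  have \<chi>_orient: "\<chi> \<tau> (orient \<sigma>) = (if \<tau> = \<sigma> then 1 else 0)" if "\<tau> \<in> crit" "\<sigma> \<in> crit" for \<tau> \<sigma>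
    using orient[OF that(1)] orient[OF that(2)]
    by (auto simp: \<chi>_def characteristic_cochain_self characteristic_cochain_eq_0)
  have \<chi>_supp: "\<chi> \<sigma> xs = 0" if "\<sigma> \<in> crit" "set xs \<noteq> \<sigma>" for \<sigma> xs
    using orient[OF that(1)] that(2) by (simp add: \<chi>_def characteristic_cochain_eq_0)
  have comb: "finprod ?H (\<lambda>\<sigma>. ?cl (\<chi> \<sigma>) [^]\<^bsub>?H\<^esub> c \<sigma>) {\<sigma>. c \<sigma> \<noteq> 0} = ?cl (\<lambda>xs. \<Sum>\<sigma>\<in>crit. c \<sigma> * \<chi> \<sigma> xs)"
    if "{\<sigma>. c \<sigma> \<noteq> 0} \<subseteq> crit" for c :: "_ \<Rightarrow> int"
  proof -
    have "(\<Sum>\<sigma>\<in>crit. c \<sigma> * \<chi> \<sigma> xs) = (\<Sum>\<sigma> | c \<sigma> \<noteq> 0. c \<sigma> * \<chi> \<sigma> xs)" for xs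
      using that fin by (intro sum.mono_neutral_right) auto
    moreover have "finite {\<sigma>. c \<sigma> \<noteq> 0}" using that fin finite_subset by blast
    ultimately show ?thesis
      using finprod_cohomology_class[OF closed, of "{\<sigma>. c \<sigma> \<noteq> 0}" \<chi> p c] that \<chi> top by (simp add: subset_iff)
  qed
  have sum_closed: "(\<lambda>xs. \<Sum>\<sigma>\<in>crit. c \<sigma> * \<chi> \<sigma> xs) \<in> cochains K p" for c
    using \<chi> by (intro cochains_sum cochains_mult)
  have "\<exists>!c :: _ \<Rightarrow> int. finite {\<sigma>. c \<sigma> \<noteq> 0} \<and> {\<sigma>. c \<sigma> \<noteq> 0} \<subseteq> crit \<and>
      x = finprod ?H (\<lambda>\<sigma>. ?cl (\<chi> \<sigma>) [^]\<^bsub>?H\<^esub> c \<sigma>) {\<sigma>. c \<sigma> \<noteq> 0}" if "x \<in> carrier ?H" for x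
  proof -
    obtain z where z: "z \<in> cochains K p" "coboundary K p z = (\<lambda>xs. 0)" and x: "x = ?cl z"
      using \<open>x \<in> _\<close> by (auto simp: carrier_reduced_cohomology carrier_cocycle_group)
    obtain y where y: "y \<in> cochains K (p - 1)"
      and zy: "\<And>xs. set xs \<notin> crit \<Longrightarrow> z xs = coboundary K (p - 1) y xs"
      using cocycle_cohomologous_to_critical[OF z] by blast
    define u where "u = (\<lambda>xs. z xs - coboundary K (p - 1) y xs)"
    have u: "u \<in> cochains K p"
      using cochains_diff[OF z(1)] coboundary_in_cochains[OF y] by (simp add: u_def)
    define c where "c = (\<lambda>\<sigma>. if \<sigma> \<in> crit then u (orient \<sigma>) else 0)"
    have c_supp: "{\<sigma>. c \<sigma> \<noteq> 0} \<subseteq> crit" by (auto simp: c_def)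
    have "u xs = (\<Sum>\<sigma>\<in>crit. c \<sigma> * \<chi> \<sigma> xs)" for xs
      using critical_cochain_expansion[OF u _ p_def orient, of xs] zy
      by (simp add: u_def c_def \<chi>_def)
    then have u_eq: "(\<lambda>xs. \<Sum>\<sigma>\<in>crit. c \<sigma> * \<chi> \<sigma> xs) = u" by auto
    have x_u: "x = ?cl u"
      unfolding x using cohomology_class_eq_iff[OF closed top[OF z(1)] top[OF u]] y
      by (auto simp: u_def)
    show ?thesis
    proof (rule ex1I[of _ c], intro conjI)
      show "finite {\<sigma>. c \<sigma> \<noteq> 0}" using c_supp fin finite_subset by blast
      show "x = finprod ?H (\<lambda>\<sigma>. ?cl (\<chi> \<sigma>) [^]\<^bsub>?H\<^esub> c \<sigma>) {\<sigma>. c \<sigma> \<noteq> 0}"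
        using comb[OF c_supp] u_eq x_u by simp
      fix c' :: "'v set \<Rightarrow> int"
      assume c': "finite {\<sigma>. c' \<sigma> \<noteq> 0} \<and> {\<sigma>. c' \<sigma> \<noteq> 0} \<subseteq> crit \<and>
        x = finprod ?H (\<lambda>\<sigma>. ?cl (\<chi> \<sigma>) [^]\<^bsub>?H\<^esub> c' \<sigma>) {\<sigma>. c' \<sigma> \<noteq> 0}"
      define s where "s = (\<lambda>xs. \<Sum>\<sigma>\<in>crit. c' \<sigma> * \<chi> \<sigma> xs)"
      have s: "s \<in> cochains K p" unfolding s_def by (rule sum_closed)
      have "?cl u = ?cl s" using comb[of c'] c' x_u by (simp add: s_def)
      then obtain w where w: "w \<in> cochains K (p - 1)" "\<And>xs. u xs - s xs = coboundary K (p - 1) w xs"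
        using cohomology_class_eq_iff[OF closed top[OF u] top[OF s]] by blast
      have "coboundary K (p - 1) w = (\<lambda>xs. 0)"
      proof (rule critical_coboundary_eq_0[OF w(1)])
        show "p - 1 + 1 \<noteq> int d" by (simp add: p_def)
        fix xs assume xs: "set xs \<notin> crit"
        then have "s xs = 0"
          using \<chi>_supp unfolding s_def by (intro sum.neutral ballI) (metis mult_zero_right)
        moreover have "u xs = 0" using zy[OF xs] by (simp add: u_def)
        ultimately show "coboundary K (p - 1) w xs = 0" using w(2)[of xs] by simp
      qed
      then have us: "u xs = s xs" for xs using w(2)[of xs] by (simp add: fun_eq_iff)
      show "c' = c"
      proof
        fix \<sigma> show "c' \<sigma> = c \<sigma>"
        proof (cases "\<sigma> \<in> crit")
          case True
          have "s (orient \<sigma>) = (\<Sum>\<tau>\<in>crit. if \<tau> = \<sigma> then c' \<sigma> else 0)"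
            unfolding s_def using \<chi>_orient True by (intro sum.cong) auto
          then show ?thesis using us[of "orient \<sigma>"] True fin by (simp add: c_def)
        next
          case False
          then show ?thesis using c' by (auto simp: c_def)
        qed
      qed
    qed (rule c_supp)
  qed
  moreover have "(\<lambda>\<sigma>. ?cl (\<chi> \<sigma>)) \<in> crit \<rightarrow> carrier ?H"
    using \<chi> top by (auto simp: carrier_reduced_cohomology)
  ultimately have "is_Z_basis ?H crit (\<lambda>\<sigma>. ?cl (\<chi> \<sigma>))"
    unfolding is_Z_basis_def
    by (intro conjI ballI comm_group_reduced_cohomology[OF closed])
  then show ?thesis by (simp add: \<chi>_def p_def)
qed

text \<open>Outside the top degree there are no critical cells that could support a cocycle.\<close>

theorem reduced_cohomology_trivial:
  assumes p: "p \<noteq> int d - 1"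
  shows "trivial_group (reduced_cohomology K p)"
proof -
  note closed = Pow_face
  interpret Z: comm_group "cocycle_group K p" by (rule comm_group_cocycle_group)
  interpret H: comm_group "reduced_cohomology K p"
    by (rule comm_group_reduced_cohomology[OF closed])
  have "x = \<one>\<^bsub>reduced_cohomology K p\<^esub>" if "x \<in> carrier (reduced_cohomology K p)" for x
  proof -
    interpret group_hom "cocycle_group K p" "reduced_cohomology K p" "cohomology_class K p"
      using cohomology_class_hom[OF closed] by unfold_locales
    obtain z where z: "z \<in> carrier (cocycle_group K p)" "x = cohomology_class K p z"
      using \<open>x \<in> _\<close> by (auto simp: carrier_reduced_cohomology)
    then have zc: "z \<in> cochains K p" "coboundary K p z = (\<lambda>xs. 0)"
      by (auto simp: carrier_cocycle_group)
    then obtain y where y: "y \<in> cochains K (p - 1)"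
      and zy: "\<And>xs. set xs \<notin> crit \<Longrightarrow> z xs = coboundary K (p - 1) y xs"
      using cocycle_cohomologous_to_critical by blast
    have dy: "coboundary K (p - 1) y \<in> cochains K p" using coboundary_in_cochains[OF y] by simp
    have "z xs = coboundary K (p - 1) y xs" for xs
    proof (cases "set xs \<in> crit")
      case True
      then have "xs \<notin> ordered_simplices K p"
        using card_crit p distinct_card[of xs] by (auto simp: ordered_simplices_def)
      then show ?thesis using zc(1) dy cochains_iff by metis
    qed (rule zy)
    then have "cohomology_class K p z = cohomology_class K p \<one>\<^bsub>cocycle_group K p\<^esub>"
      using cohomology_class_eq_iff[OF closed z(1) Z.one_closed] y
      unfolding one_cocycle_group by auto
    then show ?thesis using z by simp
  qed
  then show ?thesis unfolding trivial_group_def using H.one_closed H.is_group by auto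
qed

end

section \<open>Binary hierarchies of label sets\<close>

text \<open>
  A hierarchy contains the whole set and the singletons, so that it has one member for each vertex of
  a binary tree, and a binary branching is a decomposition inside the hierarchy. The two parts are
  distinguished by their minima; the part \<open>S\<close> without the smallest label is called the right one.
\<close>

definition splits :: "nat set set \<Rightarrow> nat set \<Rightarrow> nat set \<Rightarrow> nat set \<Rightarrow> bool" where
  "splits H P A S \<longleftrightarrow> A \<in> H \<and> S \<in> H \<and> P = A \<union> S \<and> A \<inter> S = {} \<and> Min A < Min S"

definition binary_hierarchy :: "nat set \<Rightarrow> nat set set \<Rightarrow> bool" where
  "binary_hierarchy X H \<longleftrightarrow> finite X \<and> X \<in> H \<and> (\<forall>x\<in>X. {x} \<in> H) \<and> (\<forall>A\<in>H. A \<subseteq> X \<and> A \<noteq> {}) \<and>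
     (\<forall>A\<in>H. \<forall>B\<in>H. A \<subseteq> B \<or> B \<subseteq> A \<or> A \<inter> B = {}) \<and>
     (\<forall>P\<in>H. card P \<noteq> 1 \<longrightarrow> (\<exists>A S. splits H P A S))"

definition trivial_clusters :: "nat set \<Rightarrow> nat set set" where
  "trivial_clusters X = insert X ((\<lambda>x. {x}) ` X)"

lemma Min_neq_of_disjoint:
  assumes "finite A" "finite B" "A \<noteq> {}" "B \<noteq> {}" "A \<inter> B = {}"
  shows "Min A \<noteq> Min (B :: nat set)"
  using Min_in[OF assms(1,3)] Min_in[OF assms(2,4)] assms(5) by (metis disjoint_iff)

lemma splits_existsI:
  assumes "A \<in> H" "S \<in> H" "P = A \<union> S" "A \<inter> S = {}" "finite A" "finite S" "A \<noteq> {}" "S \<noteq> {}"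
  shows "\<exists>A S. splits H P A S"
proof (cases "Min A < Min S")
  case True
  then show ?thesis using assms unfolding splits_def by blast
next
  case False
  then have "Min S < Min A" using Min_neq_of_disjoint[of A S] assms by linarith
  then show ?thesis using assms unfolding splits_def by blast
qed

locale hierarchy =
  fixes X H
  assumes binary: "binary_hierarchy X H"
begin

lemma finite_X: "finite X" and top_in: "X \<in> H" and singleton_in: "x \<in> X \<Longrightarrow> {x} \<in> H"
  and cluster_sub: "A \<in> H \<Longrightarrow> A \<subseteq> X" and cluster_nonempty: "A \<in> H \<Longrightarrow> A \<noteq> {}"
  and laminar: "A \<in> H \<Longrightarrow> B \<in> H \<Longrightarrow> A \<subseteq> B \<or> B \<subseteq> A \<or> A \<inter> B = {}"
  and split_exists: "P \<in> H \<Longrightarrow> card P \<noteq> 1 \<Longrightarrow> \<exists>A S. splits H P A S"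
  using binary unfolding binary_hierarchy_def by auto

lemma cluster_finite: "A \<in> H \<Longrightarrow> finite A"
  using cluster_sub finite_X finite_subset by blast

lemma finite_H: "finite H"
  using cluster_sub finite_X by (meson Pow_iff finite_Pow_iff finite_subset subsetI)

lemma trivial_sub: "trivial_clusters X \<subseteq> H"
  using top_in singleton_in by (auto simp: trivial_clusters_def)

lemma sub_part:
  assumes "A \<in> H" "S \<in> H" "A \<inter> S = {}" "W \<in> H" "W \<subset> A \<union> S"
  shows "W \<subseteq> A \<or> W \<subseteq> S"
  using laminar[OF assms(4,1)] laminar[OF assms(4,2)] assms(3,5) by blast

lemma sibling_unique:
  assumes "Z \<in> H" "B \<in> H" "B' \<in> H" "Z \<inter> B = {}" "Z \<inter> B' = {}" "Z \<union> B \<in> H" "Z \<union> B' \<in> H"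
  shows "B = B'"
proof -
  have *: "Z \<union> B \<subseteq> Z \<union> B'" if B: "B \<in> H" "B' \<in> H" "Z \<inter> B = {}" "Z \<inter> B' = {}" "Z \<union> B \<in> H" "Z \<union> B' \<in> H" for B B'
  proof (rule ccontr)
    assume "\<not> ?thesis"
    then have "Z \<union> B' \<subset> Z \<union> B"
      using laminar[OF B(5,6)] cluster_nonempty[OF assms(1)] by blast
    from sub_part[OF assms(1) B(1,3,6) this] show False
      using B cluster_nonempty[OF assms(1)] cluster_nonempty[OF B(2)] by blast
  qed
  show ?thesis using *[OF assms(2-7)] *[OF assms(3,2,5,4,7,6)] assms(4,5) by blast
qed

lemma splitsD:
  assumes "splits H P A S"
  shows "A \<in> H" "S \<in> H" "P = A \<union> S" "A \<inter> S = {}" "Min A < Min S" "A \<noteq> {}" "S \<noteq> {}" "A \<subset> P" "S \<subset> P"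
    "Min P = Min A" "card P \<noteq> 1" "finite A" "finite S"
proof -
  show a: "A \<in> H" "S \<in> H" "P = A \<union> S" "A \<inter> S = {}" "Min A < Min S"
    using assms by (auto simp: splits_def)
  show b: "A \<noteq> {}" "S \<noteq> {}" using a cluster_nonempty by auto
  show c: "A \<subset> P" "S \<subset> P" using a b by auto
  show f: "finite A" "finite S" using a cluster_finite by auto
  show "Min P = Min A" using a b f by (simp add: Min_Un)
  show "card P \<noteq> 1"
  proof
    assume "card P = 1"
    then obtain x where "P = {x}" by (auto simp: card_1_singleton_iff)
    then show False using b c by auto
  qed
qed

lemma split_unique:
  assumes "splits H P A S" "splits H P A' S'"
  shows "A = A'" "S = S'"
proof -
  note s = splitsD[OF assms(1)] and s' = splitsD[OF assms(2)]
  have "A' \<subseteq> A \<or> A' \<subseteq> S" "S' \<subseteq> A \<or> S' \<subseteq> S"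
    using sub_part[OF s(1,2,4)] s(3) s' by auto
  then have "A = A' \<and> S = S' \<or> A = S' \<and> S = A'" using s(3,4,6,7) s'(3,4,6,7) by blast
  then show "A = A'" "S = S'" using s(5) s'(5) by auto
qed

lemma parent_exists:
  assumes "Z \<in> H" "Z \<noteq> X"
  shows "\<exists>B \<in> H. Z \<inter> B = {} \<and> Z \<union> B \<in> H"
proof -
  define Q where "Q = {P \<in> H. Z \<subset> P}"
  have "X \<in> Q" using assms cluster_sub top_in by (auto simp: Q_def)
  then obtain P where P: "P \<in> Q" and min: "\<And>W. W \<in> Q \<Longrightarrow> card P \<le> card W"
    using exists_least_iff[of "\<lambda>k. \<exists>W\<in>Q. card W = k"] by (metis leI)
  have PH: "P \<in> H" "Z \<subset> P" using P by (auto simp: Q_def)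
  have "card P \<noteq> 1"
    using PH cluster_nonempty[OF assms(1)] by (auto simp: card_1_singleton_iff)
  then obtain A S where sp: "splits H P A S" using split_exists PH by blast
  note s = splitsD[OF sp]
  have "\<not> Z \<subset> A" "\<not> Z \<subset> S"
    using min[of A] min[of S] s psubset_card_mono[of P A] psubset_card_mono[of P S] cluster_finite[OF PH(1)]
    by (auto simp: Q_def)
  moreover have "Z \<subseteq> A \<or> Z \<subseteq> S" using sub_part[OF s(1,2,4) assms(1)] s(3) PH by blast
  ultimately have "Z = A \<or> Z = S" by blast
  then show ?thesis using s PH by (metis Un_commute inf_commute)
qed

end

section \<open>Bad clusters and the exchange step\<close>

text \<open>
  A cluster is bad if its parts \<open>Z1\<close>, \<open>Z2\<close> have the two smallest minima among \<open>Z1\<close>, \<open>Z2\<close> and its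
  sibling \<open>S\<close>; the conditions on the minima imply this because \<open>Min Z1 < Min Z2\<close>. Read as
  bracketings, the three ways to join three blocks are the terms of a Jacobi identity, and the bad
  way is the term to be eliminated.
\<close>

definition bad :: "nat set set \<Rightarrow> nat set \<Rightarrow> bool" where
  "bad H Z \<longleftrightarrow> (\<exists>Z1 Z2 S. splits H Z Z1 Z2 \<and> splits H (Z \<union> S) Z S \<and> Z \<union> S \<in> H \<and> Min Z2 < Min S)"

text \<open>Binary digits with the smallest label as the leading one: the smaller minimum makes a set heavier.\<close>

definition weight :: "nat \<Rightarrow> nat set \<Rightarrow> nat" where
  "weight N A = (\<Sum>x\<in>A. 2 ^ (N - x))"

lemma weight_less:
  assumes "finite A" "finite B" "A \<noteq> {}" "B \<noteq> {}" "Min A < Min B" "\<forall>x\<in>A \<union> B. x \<le> N"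
  shows "weight N B < weight N A"
proof -
  define m where "m = Min A"
  have m: "m \<in> A" "m \<le> N" using assms Min_in by (auto simp: m_def)
  have "B \<subseteq> {m <.. N}" using assms Min_le[of B] by (fastforce simp: m_def)
  then have "weight N B \<le> (\<Sum>x\<in>{m<..N}. 2 ^ (N - x))"
    unfolding weight_def by (intro sum_mono2) auto
  also have "\<dots> = (\<Sum>j<N - m. 2 ^ j)"
    by (rule sum.reindex_bij_witness[of _ "\<lambda>j. N - j" "\<lambda>x. N - x"]) (use m in auto)
  also have "\<dots> < 2 ^ (N - m)"
  proof -
    have "(\<Sum>j<k. 2 ^ j) < (2 ^ k :: nat)" for k by (induction k) auto
    then show ?thesis .
  qed
  also have "\<dots> \<le> weight N A"
    unfolding weight_def using m assms(1) by (intro member_le_sum) auto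
  finally show ?thesis .
qed

definition total_weight :: "nat set \<Rightarrow> nat set set \<Rightarrow> nat" where
  "total_weight X H = (\<Sum>A\<in>H. weight (Max X) A)"

context hierarchy
begin

text \<open>
  Three blocks \<open>Z1\<close>, \<open>Z2\<close>, \<open>B\<close> can be joined in another order without affecting the rest of the
  hierarchy: a cluster inside \<open>Z \<union> B\<close> other than \<open>Z\<close> lies in one of the blocks.
\<close>

lemma exchange:
  assumes Z: "splits H Z Z1 Z2" "Z \<in> H" and B: "B \<in> H" "Z \<inter> B = {}" "Z \<union> B \<in> H"
  defines "Y \<equiv> Z1 \<union> B"
  shows "binary_hierarchy X (insert Y (H - {Z}))" "Y \<notin> H" "Z \<notin> trivial_clusters X" "Y \<notin> trivial_clusters X"
proof -
  note z = splitsD[OF Z(1)]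
  have Bne: "B \<noteq> {}" using B cluster_nonempty by auto
  have disj: "Z1 \<inter> B = {}" "Z2 \<inter> B = {}" using z B(2) by auto
  have in_P: "W \<subseteq> Z1 \<or> W \<subseteq> Z2 \<or> W = Z \<or> W \<subseteq> B" if W: "W \<in> H" "W \<subset> Z \<union> B" for W
  proof -
    have "W \<subseteq> Z \<or> W \<subseteq> B" using sub_part[OF Z(2) B(1,2) W] .
    moreover have "W \<subseteq> Z1 \<or> W \<subseteq> Z2" if "W \<subset> Z" using sub_part[OF z(1,2,4) W(1)] that z(3) by blast
    ultimately show ?thesis by blast
  qed
  have YP: "Y \<subset> Z \<union> B" using z disj by (auto simp: Y_def)
  show YH: "Y \<notin> H"
  proof
    assume "Y \<in> H"
    from in_P[OF this YP] show False using z disj Bne by (auto simp: Y_def)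
  qed
  show "Z \<notin> trivial_clusters X"
    using z(11) B cluster_sub[OF B(1)] Bne by (auto simp: trivial_clusters_def)
  show "Y \<notin> trivial_clusters X" using YH trivial_sub by auto
  then have tr: "trivial_clusters X \<subseteq> insert Y (H - {Z})"
    using trivial_sub \<open>Z \<notin> trivial_clusters X\<close> by auto
  let ?H = "insert Y (H - {Z})"
  have lamY: "Y \<subseteq> W \<or> W \<subseteq> Y \<or> Y \<inter> W = {}" if W: "W \<in> H - {Z}" for W
  proof -
    consider "W \<subset> Z \<union> B" | "Z \<union> B \<subseteq> W" | "(Z \<union> B) \<inter> W = {}"
      using laminar[of W "Z \<union> B"] W B by blast
    then show ?thesis
    proof cases
      case 1
      from in_P[OF _ this] show ?thesis using W z(3,4) disj by (auto simp: Y_def)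
    qed (use z in \<open>auto simp: Y_def\<close>)
  qed
  have lam: "A \<subseteq> B \<or> B \<subseteq> A \<or> A \<inter> B = {}" if AB: "A \<in> ?H" "B \<in> ?H" for A B
  proof -
    consider "A = Y" "B = Y" | "A = Y" "B \<in> H - {Z}" | "B = Y" "A \<in> H - {Z}"
      | "A \<in> H" "B \<in> H" using AB by blast
    then show ?thesis
    proof cases
      case 2
      then show ?thesis using lamY[of B] by blast
    next
      case 3
      then show ?thesis using lamY[of A] by blast
    next
      case 4
      then show ?thesis by (rule laminar)
    qed simp
  qed
  have split: "\<exists>A S. splits ?H Q A S" if Q: "Q \<in> ?H" "card Q \<noteq> 1" for Q
  proof -
    consider "Q = Y" | "Q = Z \<union> B" | "Q \<in> H" "Q \<noteq> Z" "Q \<noteq> Z \<union> B" using Q by blast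
    then show ?thesis
    proof cases
      case 1
      have "Z1 \<in> ?H" "B \<in> ?H" using z B Bne by auto
      then show ?thesis
        using 1 disj z Bne cluster_finite[OF B(1)] by (intro splits_existsI[of Z1 _ B]) (auto simp: Y_def)
    next
      case 2
      have "Z2 \<in> ?H" "finite Y" using z cluster_finite[OF B(1)] by (auto simp: Y_def)
      then show ?thesis
        using 2 disj z Bne by (intro splits_existsI[of Y _ Z2]) (auto simp: Y_def)
    next
      case 3
      then obtain A S where sp: "splits H Q A S" using split_exists Q by blast
      note s = splitsD[OF sp]
      have "A \<noteq> Z" "S \<noteq> Z"
        using sibling_unique[OF Z(2) B(1), of S] sibling_unique[OF Z(2) B(1), of A] s B 3
        by (auto simp: Un_commute inf_commute)
      then show ?thesis using sp by (auto simp: splits_def)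
    qed
  qed
  have "Y \<subseteq> X" "Y \<noteq> {}" using YP cluster_sub[OF B(3)] z by (auto simp: Y_def)
  then show "binary_hierarchy X ?H"
    unfolding binary_hierarchy_def
  proof (intro conjI ballI impI)
    show "X \<in> ?H" using tr by (auto simp only: trivial_clusters_def)
    show "{x} \<in> ?H" if "x \<in> X" for x
      using tr that unfolding trivial_clusters_def by blast
    show "A \<subseteq> X" "A \<noteq> {}" if "A \<in> ?H" for A
      using that \<open>Y \<subseteq> X\<close> \<open>Y \<noteq> {}\<close> cluster_sub[of A] cluster_nonempty[of A] by blast+
  qed (rule finite_X, rule lam, assumption+, rule split)
qed

text \<open>
  If \<open>Z\<close> is not bad, its sibling \<open>B\<close> has a smaller minimum than the right part \<open>Z2\<close> of \<open>Z\<close>, so the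
  exchange of \<open>Z1 \<union> Z2\<close> for \<open>Z1 \<union> B\<close> increases the weight.
\<close>

lemma improve:
  assumes Z: "Z \<in> H" "Z \<notin> trivial_clusters X" "\<not> bad H Z"
  shows "\<exists>Y. binary_hierarchy X (insert Y (H - {Z})) \<and> total_weight X H < total_weight X (insert Y (H - {Z}))"
proof -
  have "card Z \<noteq> 1"
    using Z cluster_sub[OF Z(1)] by (auto simp: trivial_clusters_def card_1_singleton_iff)
  then obtain Z1 Z2 where sp: "splits H Z Z1 Z2" using split_exists Z by blast
  note z = splitsD[OF sp]
  obtain B where B: "B \<in> H" "Z \<inter> B = {}" "Z \<union> B \<in> H"
    using parent_exists[OF Z(1)] Z(2) by (auto simp: trivial_clusters_def)
  have fB: "finite B" "B \<noteq> {}" using B cluster_finite cluster_nonempty by auto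
  have "Min B < Min Z2"
  proof (rule ccontr)
    assume "\<not> ?thesis"
    moreover have "Min B \<noteq> Min Z2" using Min_neq_of_disjoint[of B Z2] fB z B(2) by blast
    ultimately have less: "Min Z2 < Min B" by simp
    then have "splits H (Z \<union> B) Z B"
      using z(5,10) B Z(1) unfolding splits_def by simp
    then show False using Z(3) sp less B by (auto simp: bad_def)
  qed
  define Y where "Y = Z1 \<union> B"
  note ex = exchange[OF sp Z(1) B, folded Y_def]
  have "\<forall>x\<in>X. x \<le> Max X" using finite_X by simp
  moreover have "B \<union> Z2 \<subseteq> X" using B(1) z(2) cluster_sub by blast
  ultimately have "weight (Max X) Z2 < weight (Max X) B"
    using \<open>Min B < Min Z2\<close> fB z by (intro weight_less) auto
  moreover have "weight (Max X) Z = weight (Max X) Z1 + weight (Max X) Z2"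
    "weight (Max X) Y = weight (Max X) Z1 + weight (Max X) B"
    using z fB B(2) unfolding weight_def Y_def by (auto intro!: sum.union_disjoint)
  moreover have "total_weight X H = weight (Max X) Z + total_weight X (H - {Z})"
    "total_weight X (insert Y (H - {Z})) = weight (Max X) Y + total_weight X (H - {Z})"
    using finite_H Z(1) ex(2) by (auto simp: total_weight_def sum.remove)
  ultimately have "total_weight X H < total_weight X (insert Y (H - {Z}))" by linarith
  then show ?thesis using ex(1) by blast
qed

end

section \<open>The canonical binary refinement\<close>

definition canonical :: "nat set \<Rightarrow> nat set set \<Rightarrow> nat set set \<Rightarrow> bool" where
  "canonical X F H \<longleftrightarrow> binary_hierarchy X H \<and> F \<subseteq> H \<and> (\<forall>Z \<in> H - F - trivial_clusters X. bad H Z)"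

text \<open>A cluster outside \<open>F\<close> that is not bad could be exchanged for a heavier one.\<close>

lemma heaviest_canonical:
  assumes "binary_hierarchy X H" "F \<subseteq> H"
    and max: "\<And>H'. binary_hierarchy X H' \<Longrightarrow> F \<subseteq> H' \<Longrightarrow> total_weight X H' \<le> total_weight X H"
  shows "canonical X F H"
proof -
  interpret hierarchy X H using assms(1) by unfold_locales
  have "bad H Z" if Z: "Z \<in> H - F - trivial_clusters X" for Z
  proof (rule ccontr)
    assume "\<not> bad H Z"
    then obtain Y where "binary_hierarchy X (insert Y (H - {Z}))"
        "total_weight X H < total_weight X (insert Y (H - {Z}))"
      using improve[of Z] Z by auto
    moreover have "F \<subseteq> insert Y (H - {Z})" using assms(2) Z by auto
    ultimately show False using max[of "insert Y (H - {Z})"] by simp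
  qed
  then show ?thesis using assms(1,2) by (auto simp: canonical_def)
qed

text \<open>
  The right part \<open>S\<close> of a split is never bad, since its sibling has a smaller minimum. So in a
  canonical refinement of \<open>F\<close> it belongs to \<open>F\<close> or is a singleton. A left part outside \<open>F\<close> is bad,
  and splitting it again and again produces all other maximal members \<open>W\<close> of \<open>F\<close> below \<open>P\<close>, in
  the order of decreasing minima. This characterises \<open>S\<close> by \<open>F\<close> and \<open>P\<close> alone, as the member of \<open>M P\<close> with the
  largest minimum.
\<close>

lemma canonical_split_determined:
  fixes X F H H'
  defines "M \<equiv> \<lambda>P. {W \<in> F \<union> trivial_clusters X. W \<subset> P \<and>
              (\<forall>V \<in> F \<union> trivial_clusters X. W \<subseteq> V \<longrightarrow> V \<subset> P \<longrightarrow> V = W)}"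
  assumes can: "canonical X F H" and sp: "splits H P A S" and P: "P \<in> H"
  shows "S \<in> M P" "W \<in> M P \<Longrightarrow> W = S \<or> Min W < Min S"
proof -
  let ?F = "F \<union> trivial_clusters X"
  interpret hierarchy X H using can by unfold_locales (simp add: canonical_def)
  have F: "?F \<subseteq> H" using can trivial_sub by (auto simp: canonical_def)
  have right: "S \<in> M P" if sp: "splits H P A S" and P: "P \<in> H" for P A S
  proof -
    note s = splitsD[OF sp]
    have "\<not> bad H S"
    proof
      assume "bad H S"
      then obtain B where B: "splits H (S \<union> B) S B" "S \<union> B \<in> H" by (auto simp: bad_def)
      note b = splitsD[OF B(1)]
      have "A = B" using sibling_unique[OF s(2,1) b(2)] s b P B(2) by (auto simp: Un_commute inf_commute)
      then show False using s(5) b(5) by simp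
    qed
    then have "S \<in> ?F" using can s by (auto simp: canonical_def)
    moreover have "V = S" if "V \<in> ?F" "S \<subseteq> V" "V \<subset> P" for V
      using sub_part[OF s(1,2,4), of V] that F s by blast
    ultimately show ?thesis using s(9) by (auto simp: M_def)
  qed
  show "S \<in> M P" using right sp P .
  show "W = S \<or> Min W < Min S" if "W \<in> M P"
    using that sp P
  proof (induction "card P" arbitrary: P A S rule: less_induct)
    case less
    note s = splitsD[OF less.prems(2)]
    have W: "W \<in> ?F" "W \<in> H" "W \<subset> P" using less.prems(1) F by (auto simp: M_def)
    have "W \<subseteq> A \<or> W \<subseteq> S" using sub_part[OF s(1,2,4) W(2)] W(3) s(3) by blast
    then consider "W \<subseteq> S" | "W \<subseteq> A" "A \<in> ?F" | "W \<subseteq> A" "A \<notin> ?F" by blast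
    then show ?case
    proof cases
      case 1
      have "S \<in> ?F" using right[OF less.prems(2,3)] by (simp add: M_def)
      then show ?thesis using 1 less.prems(1) s(9) by (auto simp: M_def)
    next
      case 2
      then have "A = W" using less.prems(1) s(8) by (auto simp: M_def)
      then show ?thesis using s(5) by simp
    next
      case 3
      then have "bad H A" using can s by (auto simp: canonical_def)
      then obtain A1 A2 B where A: "splits H A A1 A2" and B: "splits H (A \<union> B) A B" "A \<union> B \<in> H" "Min A2 < Min B"
        by (auto simp: bad_def)
      note b = splitsD[OF B(1)]
      have "S = B" using sibling_unique[OF s(1,2) b(2)] s b less.prems(3) B(2) by auto
      have "W \<in> M A" using less.prems(1) 3 W s(8) by (auto simp: M_def)
      moreover have "card A < card P"
        using s(8) cluster_finite[OF less.prems(3)] by (rule psubset_card_mono[rotated])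
      ultimately have "W = A2 \<or> Min W < Min A2" using less.hyps[of A A1 A2] A s(1) by blast
      then show ?thesis using B(3) \<open>S = B\<close> by auto
    qed
  qed
qed

text \<open>Descending from the whole set, two canonical refinements make the same splits.\<close>

lemma canonical_sub:
  assumes can: "canonical X F H" and can': "canonical X F H'"
  shows "H \<subseteq> H'"
proof
  interpret hierarchy X H using can by unfold_locales (simp add: canonical_def)
  interpret H': hierarchy X H' using can' by unfold_locales (simp add: canonical_def)
  fix W assume "W \<in> H"
  then show "W \<in> H'"
  proof (induction "card X - card W" arbitrary: W rule: less_induct)
    case less
    show ?case
    proof (cases "W = X")
      case True
      then show ?thesis using H'.top_in by simp
    next
      case False
      then obtain B where B: "B \<in> H" "W \<inter> B = {}" "W \<union> B \<in> H"
        using parent_exists less.prems by blast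
      let ?P = "W \<union> B"
      have "card W < card ?P"
        using B cluster_nonempty[OF B(1)] cluster_finite[OF B(3)] by (intro psubset_card_mono) auto
      moreover have "card ?P \<le> card X" using cluster_sub[OF B(3)] finite_X by (rule card_mono[rotated])
      ultimately have P': "?P \<in> H'" using less.hyps[of ?P] B(3) by simp
      obtain A S where sp: "splits H ?P A S" and WAS: "{A, S} = {W, B}"
      proof -
        have "splits H ?P W B \<or> splits H ?P B W"
          using B less.prems Min_neq_of_disjoint[OF cluster_finite cluster_finite cluster_nonempty cluster_nonempty, of W B]
          by (auto simp: splits_def)
        then show ?thesis using that by blast
      qed
      obtain A' S' where sp': "splits H' ?P A' S'"
        using H'.split_exists[OF P'] splitsD(11)[OF sp] by blast
      have "S = S'"
      proof (rule ccontr)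
        assume ne: "S \<noteq> S'"
        note c = canonical_split_determined[OF can sp B(3)]
          and c' = canonical_split_determined[OF can' sp' P']
        from ne have "Min S' < Min S" using c(2)[OF c'(1)] by simp
        moreover from ne have "Min S < Min S'" using c'(2)[OF c(1)] by simp
        ultimately show False by simp
      qed
      moreover have "A = A'"
        using splitsD(3,4)[OF sp] H'.splitsD(3,4)[OF sp'] \<open>S = S'\<close> by blast
      ultimately have "A \<in> H'" "S \<in> H'" using H'.splitsD(1,2)[OF sp'] by auto
      then show ?thesis using WAS by auto
    qed
  qed
qed

lemma canonical_unique: "canonical X F H \<Longrightarrow> canonical X F H' \<Longrightarrow> H = H'"
  using canonical_sub by blast

section \<open>Counting and the second smallest labels\<close>

context hierarchy
begin

definition branching :: "nat set set" where
  "branching = {P \<in> H. card P \<noteq> 1}"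

definition right_child :: "nat set \<Rightarrow> nat set" where
  "right_child P = (THE S. \<exists>A. splits H P A S)"

lemma right_child_eq: "splits H P A S \<Longrightarrow> right_child P = S"
  unfolding right_child_def using split_unique by (intro the_equality) blast+

lemma branching_split:
  assumes "P \<in> branching"
  obtains A where "splits H P A (right_child P)" "A \<union> right_child P = P"
proof -
  obtain A S where "splits H P A S" using assms split_exists unfolding branching_def by blast
  then show ?thesis using that right_child_eq splitsD(3) by metis
qed

text \<open>
  The smallest label of the right child names the branching: a label other than the overall minimum
  stops being minimal at exactly one branching on its way up.
\<close>

lemma bij_betw_Min_right_child: "bij_betw (\<lambda>P. Min (right_child P)) branching (X - {Min X})"
proof (rule bij_betw_imageI)
  show "inj_on (\<lambda>P. Min (right_child P)) branching"
  proof (rule inj_onI)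
    fix P Q assume PQ: "P \<in> branching" "Q \<in> branching" "Min (right_child P) = Min (right_child Q)"
    have no: False
      if PQ: "P \<in> branching" "Q \<in> branching" "Min (right_child P) = Min (right_child Q)" "P \<subset> Q" for P Q
    proof -
      obtain A where A: "splits H P A (right_child P)" using branching_split PQ(1) by blast
      obtain B where B: "splits H Q B (right_child Q)" using branching_split PQ(2) by blast
      note a = splitsD[OF A] and b = splitsD[OF B]
      have "Min (right_child P) \<in> P" using a(3) Min_in[OF a(13,7)] by blast
      moreover have "Min (right_child P) \<in> right_child Q" using PQ(3) Min_in[OF b(13,7)] by simp
      moreover have "P \<subseteq> B \<or> P \<subseteq> right_child Q"
        using sub_part[OF b(1,2,4), of P] PQ b(3) by (auto simp: branching_def)
      ultimately have "P \<subseteq> right_child Q" using b(4) by blast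
      then have "Min A \<in> right_child Q" using Min_in[OF a(12,6)] a(3) by blast
      then have "Min (right_child Q) \<le> Min A" using Min_le[OF b(13)] by blast
      then show False using a(5) PQ(3) by simp
    qed
    obtain A where "splits H P A (right_child P)" using branching_split PQ(1) by blast
    note a = splitsD[OF this]
    obtain B where "splits H Q B (right_child Q)" using branching_split PQ(2) by blast
    note b = splitsD[OF this]
    have "Min (right_child P) \<in> P" "Min (right_child P) \<in> Q"
      using a(3) b(3) Min_in[OF a(13,7)] Min_in[OF b(13,7)] PQ(3) by auto
    then have "P \<subseteq> Q \<or> Q \<subseteq> P" using laminar PQ by (auto simp: branching_def)
    then show "P = Q" using no PQ by (metis psubsetI)
  qed
  show "(\<lambda>P. Min (right_child P)) ` branching = X - {Min X}"
  proof (intro equalityI subsetI)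
    fix i assume "i \<in> (\<lambda>P. Min (right_child P)) ` branching"
    then obtain P where P: "P \<in> branching" "i = Min (right_child P)" by blast
    obtain A where "splits H P A (right_child P)" using branching_split P(1) by blast
    note a = splitsD[OF this]
    have "P \<subseteq> X" using P cluster_sub by (simp add: branching_def)
    then have "i \<in> X" "Min A \<in> X"
      using a(3) Min_in[OF a(12,6)] Min_in[OF a(13,7)] P(2) by auto
    moreover from this have "Min X \<le> Min A" using finite_X by simp
    ultimately show "i \<in> X - {Min X}" using a(5) P(2) by simp
  next
    fix i assume i: "i \<in> X - {Min X}"
    define Q where "Q = {P \<in> H. i \<in> P \<and> Min P < i}"
    have "Min X < i" using i finite_X by (metis DiffE Min_le insertI1 nat_less_le)
    then have "X \<in> Q" using i top_in by (simp add: Q_def)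
    then obtain P where P: "P \<in> Q" and min: "\<And>W. W \<in> Q \<Longrightarrow> card P \<le> card W"
      using exists_least_iff[of "\<lambda>k. \<exists>W\<in>Q. card W = k"] by (metis leI)
    have PH: "P \<in> H" "i \<in> P" "Min P < i" using P by (auto simp: Q_def)
    have "card P \<noteq> 1" using PH by (auto simp: card_1_singleton_iff)
    then have br: "P \<in> branching" using PH by (simp add: branching_def)
    obtain A where "splits H P A (right_child P)" using branching_split br by blast
    note a = splitsD[OF this]
    have "\<not> (A \<in> Q)" "\<not> (right_child P \<in> Q)"
      using min[of A] min[of "right_child P"] a(8,9) psubset_card_mono[OF cluster_finite[OF PH(1)]]
      by (meson leD)+
    moreover from this have "i \<notin> A" using a(1,10) PH(3) by (simp add: Q_def)
    moreover from this have "i \<in> right_child P" using a(3) PH(2) by blast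
    ultimately have "i \<in> right_child P" "\<not> Min (right_child P) < i" using a(2) by (auto simp: Q_def)
    then have "Min (right_child P) = i" using Min_le[OF a(13), of i] by simp
    then show "i \<in> (\<lambda>P. Min (right_child P)) ` branching" using br by blast
  qed
qed

lemma card_branching: "card branching = card X - 1"
proof -
  have "X \<noteq> {}" using top_in cluster_nonempty by blast
  then show ?thesis using bij_betw_same_card[OF bij_betw_Min_right_child] finite_X by simp
qed

lemma branching_eq: "2 \<le> card X \<Longrightarrow> branching = insert X (H - trivial_clusters X)"
  using top_in cluster_sub unfolding branching_def trivial_clusters_def
  by (auto simp: card_1_singleton_iff)

lemma card_nontrivial:
  assumes "2 \<le> card X"
  shows "card (H - trivial_clusters X) = card X - 2"
proof -
  have "X \<notin> H - trivial_clusters X" by (simp add: trivial_clusters_def)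
  then show ?thesis
    using card_branching branching_eq[OF assms] finite_H by simp
qed

lemma second_smallest_Un:
  assumes "splits H P A S"
  shows "second_smallest P = (if card A = 1 then Min S else min (Min S) (second_smallest A))"
proof -
  note s = splitsD[OF assms]
  have "Min A \<notin> S" using s Min_in by blast
  then have eq: "P - {Min P} = (A - {Min A}) \<union> S" using s(3,10) by auto
  show ?thesis
  proof (cases "card A = 1")
    case True
    then have "A - {Min A} = {}" by (auto simp: card_1_singleton_iff)
    then have "P - {Min P} = S" using eq by blast
    then show ?thesis using True by (simp add: second_smallest_def)
  next
    case False
    then have "A - {Min A} \<noteq> {}" using s(6,12) Min_in
      by (metis Diff_eq_empty_iff is_singletonI is_singleton_altdef subset_singletonD)
    then have "Min ((A - {Min A}) \<union> S) = min (Min (A - {Min A})) (Min S)"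
      using s(7,12,13) by (intro Min_Un) auto
    then show ?thesis using False by (simp only: second_smallest_def eq if_False min.commute)
  qed
qed

text \<open>
  If the left child \<open>A\<close> of a branching is not bad, then the minimum of the right child of \<open>A\<close> exceeds
  that of the right child of the branching. So, in the absence of bad clusters, the second smallest
  label of a branching is by induction the label that names it. A bad cluster, on the other hand, has
  the same second smallest label as its parent.
\<close>

lemma second_smallest_bij_iff:
  "bij_betw second_smallest branching (X - {Min X}) \<longleftrightarrow> (\<forall>Z\<in>H. \<not> bad H Z)" (is "?L \<longleftrightarrow> ?R")
proof
  assume L: ?L
  show ?R
  proof (intro ballI notI)
    fix Z assume Z: "Z \<in> H" "bad H Z"
    then obtain Z1 Z2 S where b: "splits H Z Z1 Z2" "splits H (Z \<union> S) Z S" "Z \<union> S \<in> H" "Min Z2 < Min S"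
      by (auto simp: bad_def)
    have "card Z \<noteq> 1" using splitsD(11)[OF b(1)] .
    have "second_smallest Z \<le> Min Z2" using second_smallest_Un[OF b(1)] by auto
    then have "second_smallest (Z \<union> S) = second_smallest Z"
      using second_smallest_Un[OF b(2)] \<open>card Z \<noteq> 1\<close> b(4) by simp
    moreover have "Z \<in> branching" "Z \<union> S \<in> branching"
      using Z b splitsD(11) by (auto simp: branching_def)
    ultimately have "Z \<union> S = Z" using L by (auto simp: bij_betw_def dest: inj_onD)
    then show False using splitsD(8)[OF b(2)] by blast
  qed
next
  assume R: ?R
  have "second_smallest P = Min (right_child P)" if "P \<in> branching" for P
    using that
  proof (induction "card P" arbitrary: P rule: less_induct)
    case less
    obtain A where A: "splits H P A (right_child P)" using branching_split less.prems by blast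
    note a = splitsD[OF A]
    show ?case
    proof (cases "card A = 1")
      case True
      then show ?thesis using second_smallest_Un[OF A] by simp
    next
      case False
      then have br: "A \<in> branching" using a by (simp add: branching_def)
      have PH: "P \<in> H" using less.prems by (simp add: branching_def)
      then have "card A < card P" using a(8) cluster_finite by (meson psubset_card_mono)
      then have IH: "second_smallest A = Min (right_child A)" using less.hyps br by blast
      obtain A1 where A1: "splits H A A1 (right_child A)" using branching_split br by blast
      have "\<not> Min (right_child A) < Min (right_child P)"
        using R a(1) A1 A PH a(3) unfolding bad_def by metis
      then show ?thesis using second_smallest_Un[OF A] False IH by simp
    qed
  qed
  then show ?L using bij_betw_Min_right_child by (simp cong: bij_betw_cong)
qed

end

section \<open>The matching on families of clusters\<close>

definition cluster_complex :: "nat set \<Rightarrow> nat set set set" where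
  "cluster_complex X = {F. \<exists>H. binary_hierarchy X H \<and> F \<subseteq> H - trivial_clusters X}"

definition admissible_families :: "nat set \<Rightarrow> nat set set set" where
  "admissible_families X = {H - trivial_clusters X | H. binary_hierarchy X H \<and> (\<forall>Z\<in>H. \<not> bad H Z)}"

definition refinement :: "nat set \<Rightarrow> nat set set \<Rightarrow> nat set set" where
  "refinement X F = (THE H. canonical X F H)"

definition chosen_bad :: "nat set \<Rightarrow> nat set set \<Rightarrow> nat set" where
  "chosen_bad X F = (SOME Z. Z \<in> refinement X F \<and> bad (refinement X F) Z)"

text \<open>
  The rank along which the matching is acyclic has to grow with the family, whereas the weight of the
  refinement shrinks; it is therefore subtracted from a common upper bound.
\<close>

definition lightness :: "nat set \<Rightarrow> nat set set \<Rightarrow> nat" where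
  "lightness X F = total_weight X (Pow X) - total_weight X (refinement X F)"

lemma finite_hierarchies:
  assumes "finite X"
  shows "finite {H. binary_hierarchy X H}"
proof (rule finite_subset)
  show "{H. binary_hierarchy X H} \<subseteq> Pow (Pow X)" by (auto simp: binary_hierarchy_def)
qed (use assms in simp)

lemma canonical_exists:
  assumes "finite X" "binary_hierarchy X H" "F \<subseteq> H"
  shows "\<exists>H. canonical X F H \<and> (\<forall>H'. binary_hierarchy X H' \<longrightarrow> F \<subseteq> H' \<longrightarrow> total_weight X H' \<le> total_weight X H)"
proof -
  let ?C = "{H. binary_hierarchy X H \<and> F \<subseteq> H}"
  have C: "finite ?C" "?C \<noteq> {}"
    using finite_hierarchies[OF assms(1)] assms(2,3) by auto
  have "Max (total_weight X ` ?C) \<in> total_weight X ` ?C" using C by (intro Max_in) auto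
  then obtain H where H: "H \<in> ?C" "total_weight X H = Max (total_weight X ` ?C)" by auto
  have "total_weight X H' \<le> total_weight X H" if "binary_hierarchy X H'" "F \<subseteq> H'" for H'
    using H(2) C that by (simp add: Max_ge)
  then show ?thesis using heaviest_canonical[of X H F] H by blast
qed

lemma refinement_eq: "canonical X F H \<Longrightarrow> refinement X F = H"
  unfolding refinement_def by (rule the_equality) (assumption, rule canonical_unique)

lemma refinement_canonical:
  assumes "finite X" "F \<in> cluster_complex X"
  shows "canonical X F (refinement X F)"
    and "binary_hierarchy X H' \<Longrightarrow> F \<subseteq> H' \<Longrightarrow> total_weight X H' \<le> total_weight X (refinement X F)"
proof -
  obtain H where "binary_hierarchy X H" "F \<subseteq> H" using assms(2) by (auto simp: cluster_complex_def)
  then obtain H1 where "canonical X F H1" "\<forall>H'. binary_hierarchy X H' \<longrightarrow> F \<subseteq> H' \<longrightarrow> total_weight X H' \<le> total_weight X H1"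
    using canonical_exists[OF assms(1)] by blast
  then show "canonical X F (refinement X F)"
    and "binary_hierarchy X H' \<Longrightarrow> F \<subseteq> H' \<Longrightarrow> total_weight X H' \<le> total_weight X (refinement X F)"
    using refinement_eq by auto
qed

lemma admissible_iff_no_bad:
  assumes "finite X" "F \<in> cluster_complex X"
  shows "F \<in> admissible_families X \<longleftrightarrow> (\<forall>Z \<in> refinement X F. \<not> bad (refinement X F) Z)"
proof
  assume "F \<in> admissible_families X"
  then obtain H where H: "binary_hierarchy X H" "\<forall>Z\<in>H. \<not> bad H Z" "F = H - trivial_clusters X"
    by (auto simp: admissible_families_def)
  then have "canonical X F H" by (auto simp: canonical_def)
  then show "\<forall>Z \<in> refinement X F. \<not> bad (refinement X F) Z" using refinement_eq H by simp
next
  let ?H = "refinement X F"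
  assume "\<forall>Z \<in> ?H. \<not> bad ?H Z"
  moreover have c: "canonical X F ?H" by (rule refinement_canonical(1)[OF assms])
  ultimately have "F = ?H - trivial_clusters X"
    using assms(2) by (auto simp: canonical_def cluster_complex_def)
  then show "F \<in> admissible_families X"
    using c \<open>\<forall>Z \<in> ?H. \<not> bad ?H Z\<close> by (auto simp: admissible_families_def canonical_def)
qed

lemma (in hierarchy) bad_nontrivial: "Z \<in> H \<Longrightarrow> bad H Z \<Longrightarrow> Z \<notin> trivial_clusters X"
proof -
  assume Z: "Z \<in> H" "bad H Z"
  then obtain Z1 Z2 S where b: "splits H Z Z1 Z2" "splits H (Z \<union> S) Z S" "Z \<union> S \<in> H"
    by (auto simp: bad_def)
  then show ?thesis
    using splitsD(11)[OF b(1)] splitsD(8)[OF b(2)] cluster_sub[OF b(3)]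
    by (auto simp: trivial_clusters_def)
qed

lemma chosen_bad_props:
  assumes "finite X" "F \<in> cluster_complex X" "F \<notin> admissible_families X"
  shows "chosen_bad X F \<in> refinement X F" "bad (refinement X F) (chosen_bad X F)"
  using someI_ex[of "\<lambda>Z. Z \<in> refinement X F \<and> bad (refinement X F) Z"] admissible_iff_no_bad[OF assms(1,2)] assms(3)
  unfolding chosen_bad_def by blast+

text \<open>
  Adding or removing the chosen bad cluster does not change the canonical refinement, which makes
  toggling it an involution. The weight of the refinement measures its progress: a subfamily has
  more refinements, hence a heavier heaviest one.
\<close>

lemma matched_cluster_complex:
  assumes X: "finite X" "2 \<le> card X"
  shows "matched_complex (cluster_complex X) (admissible_families X) (chosen_bad X) (lightness X) (card X - 2)"
proof -
  let ?K = "cluster_complex X" and ?C = "admissible_families X"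
  have H_bound: "total_weight X H \<le> total_weight X (Pow X)" if "binary_hierarchy X H" for H
    unfolding total_weight_def using that X by (intro sum_mono2) (auto simp: binary_hierarchy_def)
  have toggle: "G \<in> ?K - ?C \<and> refinement X G = refinement X F"
    if F: "F \<in> ?K - ?C" and G: "G = insert (chosen_bad X F) F \<or> G = F - {chosen_bad X F}" for F G
  proof -
    let ?H = "refinement X F" and ?Z = "chosen_bad X F"
    have can: "canonical X F ?H" using refinement_canonical(1) X F by blast
    have Z: "?Z \<in> ?H" "bad ?H ?Z" using chosen_bad_props X F by blast+
    interpret hierarchy X ?H using can by unfold_locales (simp add: canonical_def)
    have "?Z \<notin> trivial_clusters X" using bad_nontrivial Z by blast
    then have GK: "G \<in> ?K" using F G can Z by (auto simp: cluster_complex_def canonical_def)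
    have "canonical X G ?H" using can Z G by (auto simp: canonical_def)
    then have ref: "refinement X G = ?H" by (rule refinement_eq)
    moreover have "G \<notin> ?C" using admissible_iff_no_bad[OF X(1) GK] ref Z by auto
    ultimately show ?thesis using GK by simp
  qed
  have add: "insert (chosen_bad X F) F \<in> ?K - ?C" "refinement X (insert (chosen_bad X F) F) = refinement X F"
    and remove: "F - {chosen_bad X F} \<notin> ?C" "refinement X (F - {chosen_bad X F}) = refinement X F"
    if "F \<in> ?K - ?C" for F
    using toggle[OF that, of "insert (chosen_bad X F) F"] toggle[OF that, of "F - {chosen_bad X F}"] by simp_all
  show ?thesis
  proof
    show "insert (chosen_bad X F) F \<in> ?K - ?C" "lightness X (insert (chosen_bad X F) F) = lightness X F"
      "chosen_bad X (insert (chosen_bad X F) F) = chosen_bad X F" if "F \<in> ?K - ?C" for F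
      using add[OF that] by (simp_all only: lightness_def chosen_bad_def[of X "insert _ _"] chosen_bad_def[symmetric])
    show "F - {chosen_bad X F} \<notin> ?C" "chosen_bad X (F - {chosen_bad X F}) = chosen_bad X F"
      if "F \<in> ?K - ?C" for F
      using remove[OF that] by (simp_all only: chosen_bad_def[of X "_ - _"] chosen_bad_def[symmetric] not_False_eq_True)
    show "finite ?K"
    proof (rule finite_subset)
      show "?K \<subseteq> Pow (Pow X)" by (auto simp: cluster_complex_def binary_hierarchy_def)
    qed (use X in simp)
    show faces: "finite F" "card F \<le> card X - 2" if F: "F \<in> ?K" for F
    proof -
      obtain H where H: "binary_hierarchy X H" "F \<subseteq> H - trivial_clusters X"
        using F by (auto simp: cluster_complex_def)
      interpret hierarchy X H using H by unfold_locales
      have "finite (H - trivial_clusters X)" using finite_H by simp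
      then show "finite F" "card F \<le> card X - 2"
        using card_mono[OF _ H(2)] card_nontrivial[OF X(2)] H(2) finite_subset by auto
    qed
    show "G \<in> ?K" if "F \<in> ?K" "G \<subseteq> F" for F G
      using that by (auto simp: cluster_complex_def)
    show "F \<in> ?K" "card F = card X - 2" if F: "F \<in> ?C" for F
    proof -
      obtain H where H: "binary_hierarchy X H" "F = H - trivial_clusters X"
        using F by (auto simp: admissible_families_def)
      interpret hierarchy X H using H by unfold_locales
      show "card F = card X - 2" using card_nontrivial[OF X(2)] H by simp
      show "F \<in> ?K" using H by (auto simp: cluster_complex_def)
    qed
    show "\<rho>le": "lightness X G \<le> lightness X F" if "F \<in> ?K" "G \<subseteq> F" for F G
    proof -
      have "G \<in> ?K" using that by (auto simp: cluster_complex_def)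
      then have "total_weight X (refinement X F) \<le> total_weight X (refinement X G)"
        using refinement_canonical[OF X(1)] that by (meson canonical_def subset_trans)
      then show ?thesis by (simp add: lightness_def)
    qed
    show "chosen_bad X G = chosen_bad X F"
      if F: "F \<in> ?K - ?C" and G: "G \<subseteq> F" and eq: "lightness X G = lightness X F" for F G
    proof -
      have FK: "F \<in> ?K" and GK: "G \<in> ?K" using F G by (auto simp: cluster_complex_def)
      note rF = refinement_canonical[OF X(1) FK] and rG = refinement_canonical[OF X(1) GK]
      have "total_weight X (refinement X F) = total_weight X (refinement X G)"
        using eq H_bound[of "refinement X F"] H_bound[of "refinement X G"] rF(1) rG(1)
        by (auto simp: lightness_def canonical_def)
      then have "canonical X G (refinement X F)"
        using rF(1) rG(2) G by (intro heaviest_canonical) (auto simp: canonical_def)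
      then have "refinement X G = refinement X F" by (rule refinement_eq)
      then show ?thesis by (simp add: chosen_bad_def)
    qed
  qed
qed

section \<open>Rooted trees as parent functions\<close>

text \<open>
  Orienting all edges of a rooted tree towards the root turns it into a parent function together
  with the distance from the root. Paths to the root, ancestors and degrees become recursions along
  the parent function.
\<close>

locale parent_tree =
  fixes T :: ltree and par dep :: "nat \<Rightarrow> nat"
  assumes finite_verts: "finite (verts T)"
    and root_in: "troot T \<in> verts T"
    and dep_root: "dep (troot T) = 0"
    and par_in: "v \<in> verts T \<Longrightarrow> v \<noteq> troot T \<Longrightarrow> par v \<in> verts T"
    and dep_par: "v \<in> verts T \<Longrightarrow> v \<noteq> troot T \<Longrightarrow> dep v = Suc (dep (par v))"
    and edges_eq: "edges T = (\<lambda>v. {v, par v}) ` (verts T - {troot T})"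
begin

abbreviation V where "V \<equiv> verts T"
abbreviation r where "r \<equiv> troot T"

definition children :: "nat \<Rightarrow> nat set" where
  "children v = {c \<in> V - {r}. par c = v}"

definition chain :: "nat \<Rightarrow> nat list" where
  "chain v = map (\<lambda>k. (par ^^ k) v) [0..<Suc (dep v)]"

definition anc :: "nat \<Rightarrow> nat set" where
  "anc v = set (chain v)"

lemma edge_iff:
  "{u, v} \<in> edges T \<longleftrightarrow> (u \<in> V \<and> u \<noteq> r \<and> v = par u) \<or> (v \<in> V \<and> v \<noteq> r \<and> u = par v)"
  unfolding edges_eq by (auto simp: doubleton_eq_iff)

lemma par_neq: "v \<in> V \<Longrightarrow> v \<noteq> r \<Longrightarrow> par v \<noteq> v"
  using dep_par by fastforce

lemma chain_root: "chain r = [r]"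
  by (simp add: chain_def dep_root)

lemma chain_step: "v \<in> V \<Longrightarrow> v \<noteq> r \<Longrightarrow> chain v = v # chain (par v)"
  unfolding chain_def using dep_par[of v]
  by (simp add: upt_rec[of 0] map_Suc_upt[symmetric] funpow_swap1 del: upt_Suc)

lemma anc_root: "anc r = {r}"
  by (simp add: anc_def chain_root)

lemma anc_step: "v \<in> V \<Longrightarrow> v \<noteq> r \<Longrightarrow> anc v = insert v (anc (par v))"
  by (simp add: anc_def chain_step)

lemma parent_induct [consumes 1, case_names root step]:
  assumes "v \<in> V" "P r" "\<And>v. v \<in> V \<Longrightarrow> v \<noteq> r \<Longrightarrow> P (par v) \<Longrightarrow> P v"
  shows "P v"
  using assms(1)
proof (induction "dep v" arbitrary: v rule: less_induct)
  case less
  then show ?case using assms(2,3) par_in dep_par by (cases "v = r") auto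
qed

lemma children_induct [consumes 1, case_names vertex]:
  assumes "v \<in> V" "\<And>v. v \<in> V \<Longrightarrow> (\<And>c. c \<in> children v \<Longrightarrow> P c) \<Longrightarrow> P v"
  shows "P v"
  using assms(1)
proof (induction "Max (dep ` V) - dep v" arbitrary: v rule: less_induct)
  case less
  have "P c" if c: "c \<in> children v" for c
  proof (rule less.hyps)
    show cV: "c \<in> V" using c by (simp add: children_def)
    have "dep c = Suc (dep v)" using c dep_par by (auto simp: children_def)
    moreover have "dep c \<le> Max (dep ` V)" using cV finite_verts by simp
    ultimately show "Max (dep ` V) - dep c < Max (dep ` V) - dep v" by linarith
  qed
  then show ?case using assms(2) less.prems by blast
qed

lemma self_anc: "v \<in> anc v"
  by (simp add: anc_def chain_def upt_rec[of 0] del: upt_Suc)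

lemma anc_sub: "v \<in> V \<Longrightarrow> anc v \<subseteq> V"
  by (induction rule: parent_induct) (auto simp: anc_root anc_step root_in)

lemma root_anc: "v \<in> V \<Longrightarrow> r \<in> anc v"
  by (induction rule: parent_induct) (auto simp: anc_root anc_step)

lemma dep_anc: "v \<in> V \<Longrightarrow> u \<in> anc v \<Longrightarrow> dep u \<le> dep v \<and> (dep u = dep v \<longrightarrow> u = v)"
proof (induction arbitrary: u rule: parent_induct)
  case root
  then show ?case by (simp add: anc_root)
next
  case (step v)
  show ?case
  proof (cases "u = v")
    case False
    then have "u \<in> anc (par v)" using step by (simp add: anc_step)
    then show ?thesis using step.IH[of u] dep_par[OF step.hyps] by auto
  qed simp
qed

lemma anc_trans: "v \<in> V \<Longrightarrow> u \<in> anc v \<Longrightarrow> w \<in> anc u \<Longrightarrow> w \<in> anc v"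
  by (induction rule: parent_induct) (auto simp: anc_root anc_step)

lemma anc_linear: "v \<in> V \<Longrightarrow> u \<in> anc v \<Longrightarrow> w \<in> anc v \<Longrightarrow> u \<in> anc w \<or> w \<in> anc u"
proof (induction rule: parent_induct)
  case root
  then show ?case by (simp add: anc_root)
next
  case (step v)
  show ?case
  proof (cases "u = v \<or> w = v")
    case False
    then show ?thesis using step.IH step.prems anc_step[OF step.hyps] by simp
  qed (use step.prems in blast)
qed

lemma anc_via_child:
  "v \<in> V \<Longrightarrow> u \<in> anc v \<Longrightarrow> u \<noteq> v \<Longrightarrow> \<exists>c \<in> children u. c \<in> anc v"
proof (induction rule: parent_induct)
  case root
  then show ?case by (simp add: anc_root)
next
  case (step v)
  then have u: "u \<in> anc (par v)" by (simp add: anc_step)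
  show ?case
  proof (cases "u = par v")
    case True
    then show ?thesis using step self_anc by (auto simp: children_def)
  next
    case False
    then show ?thesis using step u by (auto simp: anc_step)
  qed
qed

lemma childD: "c \<in> children v \<Longrightarrow> c \<in> V \<and> c \<noteq> r \<and> par c = v \<and> v \<in> V \<and> dep c = Suc (dep v) \<and> v \<in> anc c"
  using par_in dep_par self_anc anc_step by (auto simp: children_def)

lemma child_anc_unique:
  assumes "v \<in> V" "c \<in> children u" "c' \<in> children u" "c \<in> anc v" "c' \<in> anc v"
  shows "c = c'"
  using anc_linear[OF assms(1,4,5)] childD[OF assms(2)] childD[OF assms(3)] dep_anc by metis

lemma leaf_anc: "v \<in> V \<Longrightarrow> u \<in> anc v \<Longrightarrow> children u = {} \<Longrightarrow> u = v"
  using anc_via_child by blast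

lemma finite_children: "finite (children v)"
  using finite_verts by (simp add: children_def)

lemma distinct_chain: "v \<in> V \<Longrightarrow> distinct (chain v)"
proof (induction rule: parent_induct)
  case root
  then show ?case by (simp add: chain_root)
next
  case (step v)
  have "v \<notin> anc (par v)"
    using dep_anc[OF par_in[OF step.hyps], of v] dep_par[OF step.hyps] by auto
  then show ?case using step by (simp add: chain_step anc_def)
qed

lemma successively_chain: "v \<in> V \<Longrightarrow> successively (\<lambda>u w. {u, w} \<in> edges T) (chain v)"
proof (induction rule: parent_induct)
  case root
  then show ?case by (simp add: chain_root)
next
  case (step v)
  have "hd (chain (par v)) = par v" "chain (par v) \<noteq> []"
    by (simp_all add: chain_def upt_rec[of 0] del: upt_Suc)
  then show ?case using step edge_iff[of v "par v"]
    by (simp add: chain_step successively_Cons)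
qed

lemma hd_chain: "hd (chain v) = v" and chain_nonempty: "chain v \<noteq> []"
  by (simp_all add: chain_def upt_rec[of 0] del: upt_Suc)

lemma last_chain: "v \<in> V \<Longrightarrow> last (chain v) = r"
  by (induction rule: parent_induct) (simp_all add: chain_root chain_step chain_nonempty)

lemma path_to_root_iff:
  assumes "v \<in> V"
  shows "path_between T v r xs \<longleftrightarrow> xs = chain v"
proof
  have "is_path T xs \<Longrightarrow> last xs = r \<Longrightarrow> xs = chain (hd xs)"
  proof (induction xs)
    case Nil
    then show ?case by (simp add: is_path_def)
  next
    case (Cons x xs)
    show ?case
    proof (cases xs)
      case Nil
      then show ?thesis using Cons.prems by (simp add: chain_root)
    next
      case (Cons y zs)
      have p: "is_path T xs" "last xs = r" and e: "{x, y} \<in> edges T" and x: "x \<in> V" "x \<notin> set xs"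
        using Cons.prems Cons by (auto simp: is_path_def successively_Cons)
      have IH: "xs = chain y" using Cons.IH[OF p] Cons by simp
      from e consider "x \<noteq> r" "y = par x" | "y \<in> V" "y \<noteq> r" "x = par y"
        using edge_iff by blast
      then show ?thesis
      proof cases
        case 1
        then show ?thesis using IH chain_step[OF x(1)] by simp
      next
        case 2
        then have "x \<in> set xs" using IH chain_step[of y] hd_chain[of "par y"] chain_nonempty[of "par y"]
          by (metis hd_in_set list.set_intros(2))
        then show ?thesis using x by simp
      qed
    qed
  qed
  then show "path_between T v r xs \<Longrightarrow> xs = chain v" by (auto simp: path_between_def)
next
  assume "xs = chain v"
  then show "path_between T v r xs"
    using assms distinct_chain successively_chain hd_chain last_chain chain_nonempty anc_sub
    by (simp add: path_between_def is_path_def anc_def)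
qed

lemma below_iff: "x \<in> V \<Longrightarrow> below T t x \<longleftrightarrow> t \<in> anc x"
  by (simp add: below_def path_to_root_iff anc_def)

lemma incident_edges:
  assumes "v \<in> V"
  shows "{e \<in> edges T. v \<in> e} = (\<lambda>c. {c, v}) ` children v \<union> (if v = r then {} else {{v, par v}})"
  using assms unfolding edges_eq children_def by auto

lemma inj_on_child_edge: "inj_on (\<lambda>c. {c, v}) A"
  by (auto simp: inj_on_def doubleton_eq_iff)

lemma vdegree_eq:
  assumes "v \<in> V"
  shows "vdegree T v = card (children v) + (if v = r then 0 else 1)"
proof (cases "v = r")
  case True
  then show ?thesis
    unfolding vdegree_def incident_edges[OF assms] by (simp add: card_image inj_on_child_edge)
next
  case False
  have "par v \<notin> children v"
    using childD[of "par v" v] dep_par[OF assms False] by auto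
  then have "{v, par v} \<notin> (\<lambda>c. {c, v}) ` children v"
    using par_neq[OF assms False] by (auto simp: doubleton_eq_iff)
  then show ?thesis
    using False finite_children
    unfolding vdegree_def incident_edges[OF assms] by (simp add: card_image inj_on_child_edge)
qed

lemma outdegree_eq:
  assumes "v \<in> V"
  shows "outdegree T v = card (children v)"
proof -
  have on: "edge_on_path {v, par v} (chain v)" if "v \<noteq> r"
    unfolding edge_on_path_def using assms that chain_step[OF assms that] hd_chain[of "par v"] chain_nonempty[of "par v"]
    by (intro exI[of _ 0]) (simp add: hd_conv_nth)
  have off: "\<not> edge_on_path {c, v} (chain v)" if c: "c \<in> children v" for c
  proof
    assume "edge_on_path {c, v} (chain v)"
    then obtain i where "Suc i < length (chain v)" "{c, v} = {chain v ! i, chain v ! Suc i}"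
      by (auto simp: edge_on_path_def)
    then have "c \<in> anc v" unfolding anc_def by (metis Suc_lessD insertE insertI1 nth_mem singletonD)
    then show False using dep_anc[OF assms, of c] childD[OF c] by auto
  qed
  have "{e \<in> edges T. v \<in> e \<and> \<not> (\<exists>xs. path_between T v r xs \<and> edge_on_path e xs)}
      = {e \<in> {e \<in> edges T. v \<in> e}. \<not> edge_on_path e (chain v)}"
    by (simp add: path_to_root_iff[OF assms])
  also have "\<dots> = (\<lambda>c. {c, v}) ` children v"
    unfolding incident_edges[OF assms] using on off by (cases "v = r") auto
  finally have "{e \<in> edges T. v \<in> e \<and> \<not> (\<exists>xs. path_between T v r xs \<and> edge_on_path e xs)}
      = (\<lambda>c. {c, v}) ` children v" .
  then show ?thesis by (simp add: outdegree_def card_image inj_on_child_edge)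
qed

end

text \<open>Cutting out the loop between two visits of a vertex shortens a walk.\<close>

lemma walk_to_path:
  assumes "xs \<noteq> []" "set xs \<subseteq> verts T" "successively (\<lambda>u v. {u, v} \<in> edges T) xs"
  shows "\<exists>ys. path_between T (hd xs) (last xs) ys"
  using assms
proof (induction "length xs" arbitrary: xs rule: less_induct)
  case less
  show ?case
  proof (cases "distinct xs")
    case True
    then show ?thesis using less.prems by (auto simp: path_between_def is_path_def)
  next
    case False
    then obtain us x vs ws where xs: "xs = us @ [x] @ vs @ [x] @ ws"
      using not_distinct_decomp by blast
    let ?ys = "us @ [x] @ ws"
    have "successively (\<lambda>u v. {u, v} \<in> edges T) ?ys"
      using less.prems(3) unfolding xs by (auto simp: successively_append_iff successively_Cons)
    then have "\<exists>zs. path_between T (hd ?ys) (last ?ys) zs"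
      using less.prems(2) by (intro less.hyps) (auto simp: xs)
    moreover have "hd ?ys = hd xs" "last ?ys = last xs" by (simp_all add: xs hd_append)
    ultimately show ?thesis by simp
  qed
qed

context parent_tree
begin

lemma is_tree: "is_tree T"
  unfolding is_tree_def
proof (intro conjI)
  show "finite V" by (rule finite_verts)
  show "edges T \<subseteq> {{u, v} |u v. u \<in> V \<and> v \<in> V \<and> u \<noteq> v}"
  proof
    fix e assume "e \<in> edges T"
    then obtain v where "v \<in> V" "v \<noteq> r" "e = {v, par v}" by (auto simp: edges_eq)
    then show "e \<in> {{u, v} |u v. u \<in> V \<and> v \<in> V \<and> u \<noteq> v}"
      using par_in[of v] par_neq[of v] by auto
  qed
  show "\<forall>u\<in>V. \<forall>v\<in>V. \<exists>xs. path_between T u v xs"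
  proof (intro ballI)
    fix u v assume u: "u \<in> V" and v: "v \<in> V"
    let ?xs = "chain u @ tl (rev (chain v))"
    have rv: "rev (chain v) = r # tl (rev (chain v))"
      using last_chain[OF v] chain_nonempty[of v] by (metis hd_rev list.collapse rev_is_Nil_conv)
    have "successively (\<lambda>u w. {u, w} \<in> edges T) (rev (chain v))"
      using successively_chain[OF v] by (simp add: insert_commute)
    then have s: "successively (\<lambda>u w. {u, w} \<in> edges T) (r # tl (rev (chain v)))" using rv by metis
    have "successively (\<lambda>u w. {u, w} \<in> edges T) ?xs"
      using s successively_chain[OF u] last_chain[OF u]
      by (auto simp: successively_append_iff successively_Cons)
    moreover have "set ?xs \<subseteq> V"
    proof -
      have "set (tl (rev (chain v))) \<subseteq> set (rev (chain v))"
        using chain_nonempty[of v] list.set_sel(2)[of "rev (chain v)"] by auto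
      then show ?thesis using anc_sub[OF u] anc_sub[OF v] unfolding anc_def by auto
    qed
    moreover have "hd ?xs = u" using hd_chain[of u] chain_nonempty[of u] by simp
    moreover have "last ?xs = v"
    proof (cases "tl (rev (chain v)) = []")
      case True
      then have "rev (chain v) = [r]" using rv by metis
      then have "chain v = [r]" by simp
      then have "v = r" using hd_chain[of v] by simp
      then show ?thesis using True last_chain[OF u] by simp
    next
      case False
      then have "last ?xs = last (rev (chain v))" by (simp add: last_tl)
      then show ?thesis using hd_chain[of v] chain_nonempty[of v] by (simp add: last_rev)
    qed
    ultimately show "\<exists>xs. path_between T u v xs"
      using walk_to_path[of ?xs T] chain_nonempty[of u] by auto
  qed
  show "\<nexists>xs. is_path T xs \<and> 3 \<le> length xs \<and> {last xs, hd xs} \<in> edges T"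
  proof
    assume "\<exists>xs. is_path T xs \<and> 3 \<le> length xs \<and> {last xs, hd xs} \<in> edges T"
    then obtain xs where xs: "is_path T xs" "3 \<le> length xs" "{last xs, hd xs} \<in> edges T" by blast
    let ?L = "length xs"
    have ne: "xs \<noteq> []" using xs(2) by auto
    have succ: "{xs ! i, xs ! Suc i} \<in> edges T" if "Suc i < ?L" for i
      using xs(1) that by (auto simp: is_path_def successively_conv_nth)
    have wrap: "{xs ! (?L - 1), xs ! 0} \<in> edges T"
      using xs(3) ne by (simp add: last_conv_nth hd_conv_nth)
    have dist: "distinct xs" and sub: "set xs \<subseteq> V" using xs(1) by (auto simp: is_path_def)
    \<comment> \<open>Both neighbours of a deepest vertex on the cycle would be its parent.\<close>
    have "Max (dep ` set xs) \<in> dep ` set xs" using ne by (intro Max_in) auto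
    then obtain m where m: "m \<in> set xs" "dep m = Max (dep ` set xs)" by auto
    then have max: "dep u \<le> dep m" if "u \<in> set xs" for u using that by simp
    have nb: "u = par m" if "u \<in> set xs" "{m, u} \<in> edges T" for u
      using that max[OF that(1)] edge_iff[of m u] dep_par[of u] by auto
    obtain i where i: "i < ?L" "m = xs ! i" using m(1) by (metis in_set_conv_nth)
    define j where "j = (if Suc i < ?L then Suc i else 0)"
    define k where "k = (if i = 0 then ?L - 1 else i - 1)"
    have jk: "j < ?L" "k < ?L" "j \<noteq> k" using i xs(2) by (auto simp: j_def k_def)
    have "{m, xs ! j} \<in> edges T"
    proof (cases "Suc i < ?L")
      case True
      then show ?thesis using succ[OF True] i by (simp add: j_def)
    next
      case False
      then have "i = ?L - 1" using i(1) by linarith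
      then show ?thesis using wrap i False by (simp add: j_def)
    qed
    moreover have "{m, xs ! k} \<in> edges T"
    proof (cases "i = 0")
      case True
      then show ?thesis using wrap i by (simp add: k_def insert_commute)
    next
      case False
      then show ?thesis using succ[of "i - 1"] i by (simp add: k_def insert_commute)
    qed
    ultimately have "xs ! j = xs ! k"
      using nb[OF nth_mem[OF jk(1)]] nb[OF nth_mem[OF jk(2)]] by simp
    then show False using nth_eq_iff_index_eq[OF dist jk(1,2)] jk(3) by simp
  qed
qed

end

text \<open>
  The parent of a vertex is the next vertex on a shortest walk to the root. These parent edges already
  form a spanning tree, so the absence of cycles leaves no room for further edges.
\<close>

lemma is_tree_parent_tree:
  assumes tree: "is_tree T" and root: "troot T \<in> verts T"
  shows "\<exists>par dep. parent_tree T par dep"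
proof -
  let ?V = "verts T" and ?r = "troot T"
  define walk where "walk = (\<lambda>v xs. xs \<noteq> [] \<and> hd xs = v \<and> last xs = ?r \<and> set xs \<subseteq> ?V \<and>
      successively (\<lambda>u v. {u, v} \<in> edges T) xs)"
  define dep where "dep = (\<lambda>v. LEAST k. \<exists>xs. walk v xs \<and> length xs = Suc k)"
  have dep_le: "dep v \<le> k" if "walk v xs" "length xs = Suc k" for v xs k
    unfolding dep_def using that by (intro Least_le) blast
  have ex: "\<exists>xs. walk v xs \<and> length xs = Suc (dep v)" if v: "v \<in> ?V" for v
  proof -
    obtain xs where "path_between T v ?r xs" using tree v root unfolding is_tree_def by blast
    then have xs: "walk v xs" by (auto simp: path_between_def is_path_def walk_def)
    then have "length xs = Suc (length xs - 1)" by (cases xs) (auto simp: walk_def)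
    then have "\<exists>k. \<exists>xs. walk v xs \<and> length xs = Suc k" using xs by blast
    then show ?thesis unfolding dep_def by (rule LeastI_ex)
  qed
  have "\<exists>y. y \<in> ?V \<and> {v, y} \<in> edges T \<and> dep v = Suc (dep y)" if v: "v \<in> ?V" "v \<noteq> ?r" for v
  proof -
    obtain xs where xs: "walk v xs" "length xs = Suc (dep v)" using ex[OF v(1)] by blast
    then obtain y zs where xs_eq: "xs = v # y # zs"
      using v(2) by (cases xs rule: remdups_adj.cases) (auto simp: walk_def)
    have y: "y \<in> ?V" "{v, y} \<in> edges T" "walk y (y # zs)"
      using xs(1) unfolding xs_eq walk_def by auto
    have "dep y \<le> length zs" using dep_le[OF y(3)] by simp
    moreover have "dep v \<le> Suc (dep y)"
    proof -
      obtain ys where ys: "walk y ys" "length ys = Suc (dep y)" using ex[OF y(1)] by blast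
      then have "walk v (v # ys)" using v(1) y(2) by (auto simp: walk_def successively_Cons)
      then show ?thesis using dep_le ys(2) by simp
    qed
    ultimately show ?thesis using y xs(2) xs_eq by auto
  qed
  then obtain par where par: "\<And>v. v \<in> ?V \<Longrightarrow> v \<noteq> ?r \<Longrightarrow> par v \<in> ?V \<and> {v, par v} \<in> edges T \<and> dep v = Suc (dep (par v))"
    by metis
  have dep_r: "dep ?r = 0"
    using dep_le[of ?r "[?r]" 0] root by (simp add: walk_def)
  let ?E = "(\<lambda>v. {v, par v}) ` (?V - {?r})"
  let ?T = "LTree ?V ?E ?r (leaf_of T)"
  interpret T': parent_tree ?T par dep
    using tree root dep_r par by unfold_locales (auto simp: is_tree_def)
  have sub: "?E \<subseteq> edges T" using par by auto
  \<comment> \<open>An edge that is not a parent edge would close a cycle with a path along parent edges.\<close>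
  have "edges T \<subseteq> ?E"
  proof
    fix e assume e: "e \<in> edges T"
    then obtain u v where uv: "e = {u, v}" "u \<in> ?V" "v \<in> ?V" "u \<noteq> v"
      using tree unfolding is_tree_def by blast
    show "e \<in> ?E"
    proof (rule ccontr)
      assume no: "e \<notin> ?E"
      have "u \<in> verts ?T" "v \<in> verts ?T" using uv by simp_all
      moreover have "\<forall>u\<in>verts ?T. \<forall>v\<in>verts ?T. \<exists>xs. path_between ?T u v xs"
        using T'.is_tree unfolding is_tree_def by (elim conjE)
      ultimately obtain xs where "path_between ?T u v xs" by blast
      then have xs: "is_path ?T xs" "hd xs = u" "last xs = v" by (auto simp: path_between_def)
      have "is_path T xs"
        using xs(1) sub by (auto simp: is_path_def elim!: successively_mono)
      moreover have "3 \<le> length xs"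
      proof (rule ccontr)
        assume "\<not> ?thesis"
        moreover have "xs \<noteq> []" using xs(1) by (simp add: is_path_def)
        ultimately consider "xs = [u]" | "xs = [u, v]"
          using xs(2,3) by (cases xs rule: remdups_adj.cases) (auto simp: Suc_le_eq neq_Nil_conv split: if_splits)
        then show False using xs no uv by cases (auto simp: is_path_def)
      qed
      moreover have "{last xs, hd xs} \<in> edges T" using xs e uv(1) by (simp add: insert_commute)
      ultimately show False using tree unfolding is_tree_def by blast
    qed
  qed
  then have "edges T = ?E" using sub by blast
  then have "parent_tree T par dep"
    using tree root dep_r par by unfold_locales (auto simp: is_tree_def)
  then show ?thesis by blast
qed

section \<open>Labelled trees and their clusters\<close>

locale parent_labelled_tree = parent_tree T par dep for T par dep +
  fixes n :: nat
  assumes root_children: "children (troot T) \<noteq> {}"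
    and card_children: "v \<in> verts T \<Longrightarrow> card (children v) \<noteq> 1"
    and labels: "bij_betw (leaf_of T) {1..n} {v \<in> verts T. children v = {}}"
begin

lemma leaves_eq: "leaves T = {v \<in> V. children v = {}}"
proof -
  have "vdegree T v = 1 \<longleftrightarrow> children v = {}" if "v \<in> V" for v
    using vdegree_eq[OF that] root_children card_children[OF that] finite_children[of v]
    by (cases "v = r") auto
  then show ?thesis by (auto simp: leaves_def)
qed

lemma two_children:
  assumes "v \<in> V" "children v \<noteq> {}"
  obtains c c' where "c \<in> children v" "c' \<in> children v" "c \<noteq> c'"
proof -
  obtain c where c: "c \<in> children v" using assms by blast
  moreover have "children v \<noteq> {c}" using card_children[OF assms(1)] by force
  ultimately show ?thesis using that by blast
qed

lemma labelled_tree: "labelled_tree n T"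
proof -
  have two: "card (children v) \<ge> 2" if "v \<in> V" "children v \<noteq> {}" for v
  proof -
    have "card (children v) \<noteq> 0" using that finite_children by simp
    then show ?thesis using card_children[OF that(1)] by linarith
  qed
  have "vdegree T r > 1"
    using vdegree_eq[OF root_in] two[OF root_in root_children] by simp
  moreover have "vdegree T v \<ge> 3" if "v \<in> V - leaves T - {r}" for v
    using vdegree_eq[of v] two[of v] that leaves_eq by auto
  ultimately have "rooted_tree T"
    using is_tree root_in by (simp add: rooted_tree_def)
  then show ?thesis using labels by (simp add: labelled_tree_def leaves_eq)
qed

end

lemma labelled_tree_parent:
  assumes "labelled_tree n T"
  shows "\<exists>par dep. parent_labelled_tree T par dep n"
proof -
  have T: "rooted_tree T" "bij_betw (leaf_of T) {1..n} (leaves T)"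
    using assms by (auto simp: labelled_tree_def)
  then obtain par dep where pt: "parent_tree T par dep"
    using is_tree_parent_tree unfolding rooted_tree_def by blast
  interpret parent_tree T par dep by (rule pt)
  have root: "card (children r) > 1"
    using T(1) vdegree_eq[OF root_in] by (simp add: rooted_tree_def)
  have leaf: "v \<in> leaves T \<longleftrightarrow> children v = {}" "card (children v) \<noteq> 1" if v: "v \<in> V" for v
  proof -
    have deg: "v \<in> leaves T \<or> v = r \<or> vdegree T v \<ge> 3"
      using T(1) v by (auto simp: rooted_tree_def)
    show "v \<in> leaves T \<longleftrightarrow> children v = {}" "card (children v) \<noteq> 1"
      using deg root vdegree_eq[OF v] v finite_children[of v]
      by (auto simp: leaves_def split: if_splits)
  qed
  have "leaves T = {v \<in> V. children v = {}}" using leaf(1) by (auto simp: leaves_def)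
  then have "parent_labelled_tree T par dep n"
    using root leaf(2) T(2) by unfold_locales auto
  then show ?thesis by blast
qed

context parent_labelled_tree
begin

definition labs :: "nat \<Rightarrow> nat set" where
  "labs v = {i \<in> {1..n}. v \<in> anc (leaf_of T i)}"

definition internals :: "nat set" where
  "internals = {v \<in> V - {r}. children v \<noteq> {}}"

lemma leaf_in: "i \<in> {1..n} \<Longrightarrow> leaf_of T i \<in> V" "i \<in> {1..n} \<Longrightarrow> children (leaf_of T i) = {}"
  using labels by (auto simp: bij_betw_def)

lemma leaf_label: "v \<in> V \<Longrightarrow> children v = {} \<Longrightarrow> \<exists>i \<in> {1..n}. v = leaf_of T i"
  using labels by (auto simp: bij_betw_def)

lemma leaf_inj: "i \<in> {1..n} \<Longrightarrow> j \<in> {1..n} \<Longrightarrow> leaf_of T i = leaf_of T j \<Longrightarrow> i = j"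
  using labels by (auto simp: bij_betw_def dest: inj_onD)

lemma labels_below_eq: "labels_below n T v = labs v"
  using leaf_in below_iff by (auto simp: labels_below_def labs_def)

lemma nonleaves_eq: "nonleaves T = {v \<in> V. children v \<noteq> {}}"
  by (auto simp: nonleaves_def leaves_eq)

lemma labs_root: "labs r = {1..n}"
  using leaf_in root_anc by (auto simp: labs_def)

lemma labs_leaf: "i \<in> {1..n} \<Longrightarrow> labs (leaf_of T i) = {i}"
proof -
  assume i: "i \<in> {1..n}"
  have "j = i" if j: "j \<in> {1..n}" "leaf_of T i \<in> anc (leaf_of T j)" for j
    using leaf_anc[OF leaf_in(1)[OF j(1)] j(2) leaf_in(2)[OF i]] leaf_inj[OF i j(1)] by simp
  then show ?thesis using i self_anc unfolding labs_def by blast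
qed

lemma labs_mono: "v \<in> V \<Longrightarrow> u \<in> anc v \<Longrightarrow> labs v \<subseteq> labs u"
  using anc_trans leaf_in by (auto simp: labs_def)

lemma labs_children:
  assumes "children v \<noteq> {}"
  shows "labs v = (\<Union>c\<in>children v. labs c)"
proof
  show "labs v \<subseteq> (\<Union>c\<in>children v. labs c)"
  proof
    fix i assume i: "i \<in> labs v"
    then have "leaf_of T i \<in> V" "v \<in> anc (leaf_of T i)" "v \<noteq> leaf_of T i"
      using leaf_in assms by (auto simp: labs_def)
    then obtain c where "c \<in> children v" "c \<in> anc (leaf_of T i)"
      using anc_via_child by blast
    then show "i \<in> (\<Union>c\<in>children v. labs c)" using i by (auto simp: labs_def)
  qed
  show "(\<Union>c\<in>children v. labs c) \<subseteq> labs v"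
    using labs_mono childD by blast
qed

lemma labs_children_disjoint:
  "c \<in> children v \<Longrightarrow> c' \<in> children v \<Longrightarrow> c \<noteq> c' \<Longrightarrow> labs c \<inter> labs c' = {}"
  using child_anc_unique[OF leaf_in(1)] unfolding labs_def by blast

lemma labs_nonempty: "v \<in> V \<Longrightarrow> labs v \<noteq> {}"
proof (induction rule: children_induct)
  case (vertex v)
  show ?case
  proof (cases "children v = {}")
    case True
    then show ?thesis using leaf_label[OF vertex.hyps] labs_leaf by auto
  next
    case False
    then show ?thesis using vertex.IH labs_children[OF False] by blast
  qed
qed

lemma labs_sub: "labs v \<subseteq> {1..n}"
  by (auto simp: labs_def)

lemma labs_comparable:
  assumes "labs u \<inter> labs v \<noteq> {}"
  shows "u \<in> anc v \<or> v \<in> anc u"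
proof -
  obtain i where "i \<in> {1..n}" "u \<in> anc (leaf_of T i)" "v \<in> anc (leaf_of T i)"
    using assms by (auto simp: labs_def)
  then show ?thesis using anc_linear leaf_in by blast
qed

text \<open>
  A proper descendant of \<open>u\<close> lies below one child of \<open>u\<close>, and misses the labels below another child.
\<close>

lemma labs_inj: "inj_on labs V"
proof (rule inj_onI)
  have no: "u = v" if uv: "u \<in> V" "v \<in> V" "labs u = labs v" "u \<in> anc v" for u v
  proof (rule ccontr)
    assume "u \<noteq> v"
    then obtain c where c: "c \<in> children u" "c \<in> anc v"
      using anc_via_child[OF uv(2,4)] by blast
    then obtain c' where c': "c' \<in> children u" "c' \<noteq> c"
      using two_children[OF uv(1)] by (metis empty_iff)
    have "labs c' \<subseteq> labs c"
      using labs_mono[OF uv(2) c(2)] labs_children[of u] c' uv(3) by blast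
    then show False
      using labs_children_disjoint[OF c'(1) c(1) c'(2)] labs_nonempty[of c'] childD[OF c'(1)] by blast
  qed
  fix u v assume uv: "u \<in> V" "v \<in> V" "labs u = labs v"
  then have "u \<in> anc v \<or> v \<in> anc u" using labs_comparable[of u v] labs_nonempty by auto
  then show "u = v" using no[of u v] no[of v u] uv by auto
qed

lemma card_labs: "v \<in> V \<Longrightarrow> card (labs v) = 1 \<longleftrightarrow> children v = {}"
proof
  assume v: "v \<in> V" and card: "card (labs v) = 1"
  then obtain i where i: "labs v = {i}" "i \<in> {1..n}"
    using labs_sub by (metis card_1_singletonE insert_subset)
  then have "labs v = labs (leaf_of T i)" using labs_leaf by simp
  then have "v = leaf_of T i" using labs_inj v leaf_in(1)[OF i(2)] by (auto dest: inj_onD)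
  then show "children v = {}" using leaf_in(2)[OF i(2)] by simp
next
  assume "v \<in> V" "children v = {}"
  then show "card (labs v) = 1" using leaf_label labs_leaf by fastforce
qed

definition clusters :: "nat set set" where
  "clusters = labs ` internals"

lemma labs_verts: "labs ` V = clusters \<union> trivial_clusters {1..n}"
proof -
  have "V = internals \<union> {r} \<union> {v \<in> V. children v = {}}"
    using root_in by (auto simp: internals_def)
  also have "{v \<in> V. children v = {}} = leaf_of T ` {1..n}"
    using labels by (simp add: bij_betw_def)
  finally have "labs ` V = clusters \<union> {{1..n}} \<union> (\<lambda>i. labs (leaf_of T i)) ` {1..n}"
    by (simp add: clusters_def image_Un image_image labs_root)
  also have "(\<lambda>i. labs (leaf_of T i)) ` {1..n} = (\<lambda>i. {i}) ` {1..n}"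
    by (intro image_cong refl) (simp only: labs_leaf)
  finally show ?thesis by (auto simp: trivial_clusters_def)
qed

lemma clusters_nontrivial: "clusters \<inter> trivial_clusters {1..n} = {}"
proof -
  have "labs v \<notin> trivial_clusters {1..n}" if v: "v \<in> internals" for v
  proof
    assume "labs v \<in> trivial_clusters {1..n}"
    then consider "labs v = labs r" | i where "labs v = {i}"
      by (auto simp: trivial_clusters_def labs_root)
    then show False
    proof cases
      case 1
      then show False using labs_inj v root_in by (auto simp: internals_def dest: inj_onD)
    next
      case 2
      then show False using card_labs[of v] v by (auto simp: internals_def)
    qed
  qed
  then show ?thesis by (auto simp: clusters_def)
qed

lemma clusters_eq: "clusters = labs ` V - trivial_clusters {1..n}"
  using labs_verts clusters_nontrivial by blast

end

locale parent_binary_tree = parent_labelled_tree T par dep n for T par dep n +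
  assumes binary: "v \<in> verts T \<Longrightarrow> children v \<noteq> {} \<Longrightarrow> card (children v) = 2"
begin

lemma binary_tree: "binary_tree n T"
  using labelled_tree binary outdegree_eq by (auto simp: binary_tree_def nonleaves_eq)

lemma binary_hierarchy: "binary_hierarchy {1..n} (labs ` V)"
  unfolding binary_hierarchy_def
proof (intro conjI ballI impI)
  show "{x} \<in> labs ` V" if "x \<in> {1..n}" for x
    unfolding labs_verts using that by (auto simp: trivial_clusters_def)
  show "{1..n} \<in> labs ` V" unfolding labs_verts by (auto simp: trivial_clusters_def)
  show "A \<subseteq> {1..n}" "A \<noteq> {}" if "A \<in> labs ` V" for A
    using that labs_sub labs_nonempty by auto
  show "A \<subseteq> B \<or> B \<subseteq> A \<or> A \<inter> B = {}" if AB: "A \<in> labs ` V" "B \<in> labs ` V" for A B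
  proof -
    obtain u v where uv: "u \<in> V" "v \<in> V" "A = labs u" "B = labs v" using AB by blast
    show ?thesis using labs_comparable[of u v] labs_mono[of u v] labs_mono[of v u] uv by blast
  qed
  show "\<exists>A S. splits (labs ` V) P A S" if P: "P \<in> labs ` V" "card P \<noteq> 1" for P
  proof -
    obtain v where v: "v \<in> V" "P = labs v" using P by blast
    then have ne: "children v \<noteq> {}" using P card_labs by blast
    then obtain a b where ab: "children v = {a, b}" "a \<noteq> b"
      using binary[OF v(1) ne] by (auto simp: card_2_iff)
    then have abV: "a \<in> V" "b \<in> V" using childD by blast+
    show ?thesis
    proof (rule splits_existsI[of "labs a" _ "labs b"])
      show "P = labs a \<union> labs b" using labs_children[OF ne] v ab by simp
      show "labs a \<inter> labs b = {}" using labs_children_disjoint ab by blast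
      show "finite (labs a)" "finite (labs b)" using labs_sub finite_subset by blast+
    qed (use abV labs_nonempty in auto)
  qed
qed simp

text \<open>Non-leaves correspond to branching clusters, so admissibility is a property of the clusters.\<close>

lemma admissible_iff: "n \<ge> 1 \<Longrightarrow> admissible n T \<longleftrightarrow> (\<forall>Z \<in> labs ` V. \<not> bad (labs ` V) Z)"
proof -
  assume n: "n \<ge> 1"
  interpret H: hierarchy "{1..n}" "labs ` V" using binary_hierarchy by unfold_locales
  have br: "bij_betw labs (nonleaves T) H.branching"
    using labs_inj card_labs
    by (auto simp: bij_betw_def nonleaves_eq H.branching_def inj_on_def)
  have "Min {1..n} = 1" using n by (intro Min_eqI) auto
  then have X: "{1..n} - {Min {1..n}} = {2..n}" by auto
  have "admissible n T \<longleftrightarrow> bij_betw (second_smallest \<circ> labs) (nonleaves T) {2..n}"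
    using binary_tree by (simp add: admissible_def labels_below_eq comp_def)
  also have "\<dots> \<longleftrightarrow> bij_betw second_smallest H.branching {2..n}"
    by (rule bij_betw_comp_iff[OF br, symmetric])
  also have "\<dots> \<longleftrightarrow> (\<forall>Z \<in> labs ` V. \<not> bad (labs ` V) Z)"
    using H.second_smallest_bij_iff X by simp
  finally show ?thesis .
qed

end

lemma binary_tree_parent:
  assumes "binary_tree n T"
  shows "\<exists>par dep. parent_binary_tree T par dep n"
proof -
  obtain par dep where "parent_labelled_tree T par dep n"
    using assms labelled_tree_parent unfolding binary_tree_def by blast
  then interpret parent_labelled_tree T par dep n .
  have "parent_binary_tree T par dep n"
    using assms outdegree_eq by unfold_locales (auto simp: binary_tree_def nonleaves_eq)
  then show ?thesis by blast
qed

section \<open>Every binary hierarchy comes from a tree\<close>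

context hierarchy
begin

lemma parent_function:
  obtains p where "\<And>Z. Z \<in> H \<Longrightarrow> Z \<noteq> X \<Longrightarrow> p Z \<in> H \<and> Z \<subset> p Z \<and> (\<forall>B\<in>H. Z \<subset> B \<longrightarrow> p Z \<subseteq> B) \<and> p Z - Z \<in> H"
proof -
  have "\<exists>P. P \<in> H \<and> Z \<subset> P \<and> (\<forall>B\<in>H. Z \<subset> B \<longrightarrow> P \<subseteq> B) \<and> P - Z \<in> H" if Z: "Z \<in> H" "Z \<noteq> X" for Z
  proof -
    obtain S where S: "S \<in> H" "Z \<inter> S = {}" "Z \<union> S \<in> H" using parent_exists[OF Z] by blast
    have "Z \<union> S \<subseteq> B" if B: "B \<in> H" "Z \<subset> B" for B
    proof (rule ccontr)
      assume "\<not> ?thesis"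
      then have "B \<subset> Z \<union> S" using laminar[OF B(1) S(3)] B(2) cluster_nonempty[OF Z(1)] by blast
      from sub_part[OF Z(1) S(1,2) B(1) this] show False
        using B(2) S(2) cluster_nonempty[OF Z(1)] by blast
    qed
    moreover have "Z \<union> S - Z = S" using S(2) by blast
    moreover have "Z \<subset> Z \<union> S" using S(2) cluster_nonempty[OF S(1)] by blast
    ultimately show ?thesis using S by (intro exI[of _ "Z \<union> S"]) auto
  qed
  then show ?thesis using that by metis
qed

text \<open>
  The vertices are codes of the members of \<open>H\<close>, the parent of a member is the least member properly
  containing it, and the distance to the root is the number of members properly containing it.
\<close>

lemma realised:
  assumes X: "X = {1..n}" "2 \<le> n"
  shows "\<exists>T par dep. parent_binary_tree T par dep n \<and> parent_labelled_tree.labs T par dep n ` verts T = H"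
proof -
  obtain p where p: "\<And>Z. Z \<in> H \<Longrightarrow> Z \<noteq> X \<Longrightarrow>
      p Z \<in> H \<and> Z \<subset> p Z \<and> (\<forall>B\<in>H. Z \<subset> B \<longrightarrow> p Z \<subseteq> B) \<and> p Z - Z \<in> H"
    using parent_function by blast
  obtain f :: "nat set \<Rightarrow> nat" where f: "inj_on f H"
    using finite_H finite_imp_inj_to_nat_seg by blast
  define g where "g = inv_into H f"
  have gf: "g (f A) = A" if "A \<in> H" for A using that f by (simp add: g_def)
  have f_eq: "f A = f B \<longleftrightarrow> A = B" if "A \<in> H" "B \<in> H" for A B
    using that f by (auto dest: inj_onD)
  define par where "par = (\<lambda>v. f (p (g v)))"
  define dep where "dep = (\<lambda>v. card {B \<in> H. g v \<subset> B})"
  define T where "T = LTree (f ` H) ((\<lambda>v. {v, par v}) ` (f ` H - {f X})) (f X) (\<lambda>i. f {i})"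
  have T: "verts T = f ` H" "edges T = (\<lambda>v. {v, par v}) ` (f ` H - {f X})" "troot T = f X"
    "leaf_of T i = f {i}" for i
    by (simp_all add: T_def)
  have par: "par (f A) = f (p A)" if "A \<in> H" for A using gf[OF that] by (simp add: par_def)
  have dep: "dep (f A) = Suc (dep (f (p A)))" if A: "A \<in> H" "A \<noteq> X" for A
  proof -
    note pA = p[OF A]
    have "{B \<in> H. A \<subset> B} = insert (p A) {B \<in> H. p A \<subset> B}" using pA by blast
    then show ?thesis using gf A pA finite_H by (simp add: dep_def)
  qed
  interpret parent_tree T par dep
  proof
    show "finite (verts T)" "troot T \<in> verts T" using finite_H top_in by (simp_all add: T)
    have "{B \<in> H. X \<subset> B} = {}" using cluster_sub by blast
    then show "dep (troot T) = 0" unfolding T dep_def gf[OF top_in] by (simp only: card.empty)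
    fix v assume v: "v \<in> verts T" "v \<noteq> troot T"
    then obtain A where A: "A \<in> H" "v = f A" "A \<noteq> X" by (auto simp: T)
    then show "par v \<in> verts T" "dep v = Suc (dep (par v))"
      using par[OF A(1)] dep[OF A(1,3)] p[OF A(1,3)] by (auto simp: T)
  qed (simp add: T)
  have anc: "anc v = f ` {A \<in> H. g v \<subseteq> A}" if "v \<in> verts T" for v
    using that
  proof (induction rule: parent_induct)
    case root
    have "{A \<in> H. X \<subseteq> A} = {X}" using cluster_sub top_in by blast
    then show ?case using gf[OF top_in] by (simp add: T anc_root flip: T(3))
  next
    case (step v)
    then obtain A where A: "A \<in> H" "v = f A" "A \<noteq> X" by (auto simp: T)
    have "{B \<in> H. A \<subseteq> B} = insert A {B \<in> H. p A \<subseteq> B}" using p[OF A(1,3)] A(1) by blast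
    then show ?case
      using step A gf par p[OF A(1,3)] by (simp add: anc_step)
  qed
  have children: "children (f P) = f ` {A \<in> H. A \<noteq> X \<and> p A = P}" if "P \<in> H" for P
    using that p top_in by (auto simp: children_def T par f_eq)
  have split: "{A \<in> H. A \<noteq> X \<and> p A = P} = {A, S}" if sp: "splits H P A S" and P: "P \<in> H" for P A S
  proof
    note s = splitsD[OF sp]
    show "{B \<in> H. B \<noteq> X \<and> p B = P} \<subseteq> {A, S}"
    proof
      fix B assume "B \<in> {B \<in> H. B \<noteq> X \<and> p B = P}"
      then have B: "B \<in> H" "B \<noteq> X" "p B = P" by auto
      note pB = p[OF B(1,2)]
      have "B \<subseteq> A \<or> B \<subseteq> S" using sub_part[OF s(1,2,4) B(1)] pB B(3) s(3) by blast
      then show "B \<in> {A, S}" using pB B(3) s(1,2,8,9) by blast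
    qed
    have "A \<noteq> X" "S \<noteq> X" using s(8,9) cluster_sub[OF P] by auto
    moreover have "p A = P" if AS: "A \<in> H" "S \<in> H" "A \<inter> S = {}" "P = A \<union> S" "A \<noteq> X" "A \<subset> P" for A S
    proof -
      note pA = p[OF AS(1,5)]
      have "p A \<subseteq> P" using pA AS(6) P by blast
      moreover have "\<not> p A \<subset> P" using sub_part[OF AS(1-3), of "p A"] pA AS(3,4) cluster_nonempty[OF AS(1)] by blast
      ultimately show ?thesis by blast
    qed
    ultimately show "{A, S} \<subseteq> {B \<in> H. B \<noteq> X \<and> p B = P}"
      using s by (auto simp: Un_commute inf_commute)
  qed
  have leafless: "children (f P) = {}" if P: "P \<in> H" "card P = 1" for P
  proof -
    obtain x where "P = {x}" using P(2) by (auto simp: card_1_singleton_iff)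
    then have "p A \<noteq> P" if "A \<in> H" "A \<noteq> X" for A
      using p[OF that] cluster_nonempty[OF that(1)] by auto
    then show ?thesis using children[OF P(1)] by auto
  qed
  have two: "card (children (f P)) = 2" if P: "P \<in> H" "card P \<noteq> 1" for P
  proof -
    obtain A S where sp: "splits H P A S" using split_exists P by blast
    note s = splitsD[OF sp]
    have "children (f P) = {f A, f S}" using children[OF P(1)] split[OF sp P(1)] by auto
    moreover have "f A \<noteq> f S" using f_eq s by auto
    ultimately show ?thesis by simp
  qed
  have leaves: "{v \<in> verts T. children v = {}} = (\<lambda>i. f {i}) ` {1..n}"
  proof -
    have "children (f P) = {} \<longleftrightarrow> card P = 1" if "P \<in> H" for P
      using leafless[OF that] two[OF that] by fastforce
    then have "{v \<in> verts T. children v = {}} = f ` {P \<in> H. card P = 1}" by (auto simp: T)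
    also have "{P \<in> H. card P = 1} = (\<lambda>i. {i}) ` {1..n}"
      using singleton_in cluster_sub X by (auto simp: card_1_singleton_iff)
    finally show ?thesis by (simp add: image_image)
  qed
  have binary: "parent_binary_tree T par dep n"
  proof
    have "card X \<noteq> 1" using X by simp
    then have "card (children (troot T)) = 2" using two[OF top_in] by (simp add: T)
    then show "children (troot T) \<noteq> {}" by auto
    show "card (children v) \<noteq> 1" if "v \<in> verts T" for v
      using that leafless two by (fastforce simp: T)
    have "inj_on (\<lambda>i. f {i}) {1..n}"
      using f_eq singleton_in X by (intro inj_onI) blast
    then show "bij_betw (leaf_of T) {1..n} {v \<in> verts T. children v = {}}"
      using leaves by (simp add: bij_betw_def T_def)
    show "card (children v) = 2" if "v \<in> verts T" "children v \<noteq> {}" for v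
      using that leafless two by (auto simp: T)
  qed
  then interpret B: parent_binary_tree T par dep n .
  have "B.labs (f A) = A" if A: "A \<in> H" for A
  proof -
    have "f A \<in> anc (f {i}) \<longleftrightarrow> i \<in> A" if "i \<in> {1..n}" for i
    proof -
      have "{i} \<in> H" using singleton_in that X by blast
      then show ?thesis using anc[of "f {i}"] gf f_eq A by (auto simp: T)
    qed
    then show ?thesis using cluster_sub[OF A] X by (auto simp: B.labs_def T)
  qed
  then have "B.labs ` verts T = H" by (auto simp: T image_image)
  then show ?thesis using binary by blast
qed

end

section \<open>Contracting internal edges\<close>

lemma contractsE:
  assumes "contracts n T F T'"
  obtains \<phi> where "verts T' = \<phi> ` verts T"
    "\<forall>u\<in>verts T. \<forall>v\<in>verts T. \<phi> u = \<phi> v \<longleftrightarrow> (u, v) \<in> {(a, b). {a, b} \<in> F}\<^sup>*"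
    "edges T' = (\<lambda>e. \<phi> ` e) ` (edges T - F)" "troot T' = \<phi> (troot T)"
    "\<forall>i\<in>{1..n}. leaf_of T' i = \<phi> (leaf_of T i)"
  using assms unfolding contracts_def by (elim exE conjE) (rule that, assumption+)

text \<open>Each class of identified vertices is represented by its smallest element.\<close>

lemma contraction_exists: "\<exists>T'. contracts n T F T'"
proof -
  let ?R = "{(a, b). {a, b} \<in> F}\<^sup>*"
  have "sym ?R" by (intro sym_rtrancl symI) (auto simp: insert_commute)
  then have *: "(u, w) \<in> ?R \<longleftrightarrow> (v, w) \<in> ?R" if "(u, v) \<in> ?R" for u v w
    using that by (meson rtrancl_trans symD)
  define \<phi> where "\<phi> = (\<lambda>v. LEAST w. (v, w) \<in> ?R)"
  have in_class: "(v, \<phi> v) \<in> ?R" for v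
    unfolding \<phi>_def by (rule LeastI[of _ v]) simp
  have "\<phi> u = \<phi> v \<longleftrightarrow> (u, v) \<in> ?R" for u v
  proof
    assume "\<phi> u = \<phi> v"
    then have "(u, \<phi> u) \<in> ?R" "(\<phi> u, v) \<in> ?R"
      using in_class[of u] in_class[of v] \<open>sym ?R\<close> by (auto dest: symD)
    then show "(u, v) \<in> ?R" by (rule rtrancl_trans)
  next
    assume "(u, v) \<in> ?R"
    then have "(\<lambda>w. (u, w) \<in> ?R) = (\<lambda>w. (v, w) \<in> ?R)" by (intro ext *)
    then show "\<phi> u = \<phi> v" unfolding \<phi>_def by (rule arg_cong)
  qed
  then have "contracts n T F (LTree (\<phi> ` verts T) ((\<lambda>e. \<phi> ` e) ` (edges T - F)) (\<phi> (troot T)) (\<phi> \<circ> leaf_of T))"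
    unfolding contracts_def by (intro exI[of _ \<phi>]) auto
  then show ?thesis by blast
qed

context parent_labelled_tree
begin

lemma parent_edge_inj: "inj_on (\<lambda>v. {v, par v}) (V - {r})"
proof (rule inj_onI)
  fix u v assume uv: "u \<in> V - {r}" "v \<in> V - {r}" "{u, par u} = {v, par v}"
  show "u = v"
  proof (rule ccontr)
    assume "u \<noteq> v"
    then have "u = par v" "v = par u" using uv(3) by (auto simp: doubleton_eq_iff)
    then show False using dep_par[of u] dep_par[of v] uv by auto
  qed
qed

lemma par_nonleaf: "v \<in> V \<Longrightarrow> v \<noteq> r \<Longrightarrow> children (par v) \<noteq> {}"
  by (auto simp: children_def)

lemma internal_edges_eq: "internal_edges T = (\<lambda>v. {v, par v}) ` internals"
  unfolding internal_edges_def edges_eq leaves_eq internals_def using par_nonleaf by auto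

end

locale contraction = parent_labelled_tree T par dep n for T par dep n +
  fixes F :: "nat set set"
  assumes F_internal: "F \<subseteq> internal_edges T"
begin

definition kept :: "nat \<Rightarrow> bool" where
  "kept v \<longleftrightarrow> v = r \<or> {v, par v} \<notin> F"

text \<open>The classes of vertices identified by the contraction are subtrees; their topmost vertex represents them.\<close>

definition top :: "nat \<Rightarrow> nat" where
  "top v = (par ^^ (LEAST k. kept ((par ^^ k) v))) v"

lemma top_kept: "kept v \<Longrightarrow> top v = v"
  unfolding top_def by (subst Least_eq_0) auto

lemma kept_exists: "v \<in> V \<Longrightarrow> \<exists>k. kept ((par ^^ k) v)"
proof (induction rule: parent_induct)
  case root
  then show ?case by (intro exI[of _ 0]) (simp add: kept_def)
next
  case (step v)
  then obtain k where "kept ((par ^^ k) (par v))" by blast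
  then show ?case by (intro exI[of _ "Suc k"]) (simp add: funpow_swap1)
qed

lemma top_par:
  assumes "v \<in> V" "\<not> kept v"
  shows "top v = top (par v)"
proof -
  obtain k where k: "kept ((par ^^ k) v)" using kept_exists assms by blast
  have "(LEAST k. kept ((par ^^ k) v)) = Suc (LEAST k. kept ((par ^^ Suc k) v))"
    using assms(2) Least_Suc[of "\<lambda>k. kept ((par ^^ k) v)" k] k by simp
  then show ?thesis by (simp add: top_def funpow_swap1)
qed

lemma not_keptD: "v \<in> V \<Longrightarrow> \<not> kept v \<Longrightarrow> v \<in> internals \<and> v \<noteq> r"
proof -
  assume v: "v \<in> V" "\<not> kept v"
  then have "v \<noteq> r" "{v, par v} \<in> internal_edges T" using F_internal by (auto simp: kept_def)
  then obtain w where "w \<in> internals" "{v, par v} = {w, par w}" by (auto simp: internal_edges_eq)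
  then show ?thesis using parent_edge_inj v \<open>v \<noteq> r\<close> by (auto simp: internals_def dest: inj_onD)
qed

lemma kept_leaf: "v \<in> V \<Longrightarrow> children v = {} \<Longrightarrow> kept v"
  using not_keptD by (auto simp: internals_def)

lemma top_anc: "v \<in> V \<Longrightarrow> top v \<in> anc v"
proof (induction rule: parent_induct)
  case root
  then show ?case by (simp add: top_kept kept_def self_anc)
next
  case (step v)
  then show ?case using top_kept top_par anc_step self_anc by (cases "kept v") auto
qed

lemma kept_top: "v \<in> V \<Longrightarrow> kept (top v)"
proof (induction rule: parent_induct)
  case root
  then show ?case by (simp add: top_kept kept_def)
next
  case (step v)
  then show ?case using top_kept top_par by (cases "kept v") auto
qed

lemma top_in: "v \<in> V \<Longrightarrow> top v \<in> V"
  using top_anc anc_sub by blast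

lemma top_top: "v \<in> V \<Longrightarrow> top (top v) = top v"
  using kept_top top_kept by blast

lemma kept_edge_iff: "v \<in> V \<Longrightarrow> v \<noteq> r \<Longrightarrow> {v, par v} \<in> F \<longleftrightarrow> \<not> kept v"
  by (simp add: kept_def)

lemma linked_iff:
  assumes "u \<in> V" "v \<in> V"
  shows "(u, v) \<in> {(a, b). {a, b} \<in> F}\<^sup>* \<longleftrightarrow> top u = top v"
proof
  let ?R = "{(a, b). {a, b} \<in> F}"
  have s: "sym (?R\<^sup>*)" by (intro sym_rtrancl symI) (auto simp: insert_commute)
  have "(v, top v) \<in> ?R\<^sup>*" if "v \<in> V" for v
    using that
  proof (induction rule: parent_induct)
    case root
    then show ?case by (simp add: top_kept kept_def)
  next
    case (step v)
    show ?case
    proof (cases "kept v")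
      case True
      then show ?thesis by (simp add: top_kept)
    next
      case False
      then have "(v, par v) \<in> ?R" using kept_edge_iff step.hyps by simp
      moreover have "(par v, top v) \<in> ?R\<^sup>*" using step.IH top_par[OF step.hyps(1) False] by simp
      ultimately show ?thesis by (rule converse_rtrancl_into_rtrancl)
    qed
  qed
  then have "(u, top u) \<in> ?R\<^sup>*" "(top v, v) \<in> ?R\<^sup>*" using assms s by (auto dest: symD)
  then show "top u = top v \<Longrightarrow> (u, v) \<in> ?R\<^sup>*" using rtrancl_trans[of u "top u" ?R v] by simp
  have step: "top a = top b" if ab: "(a, b) \<in> ?R" for a b
  proof -
    have e: "{a, b} \<in> F" "{a, b} \<in> edges T"
      using ab F_internal by (auto simp: internal_edges_def)
    from e(2) consider "a \<in> V" "a \<noteq> r" "b = par a" | "b \<in> V" "b \<noteq> r" "a = par b"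
      using edge_iff by blast
    then show ?thesis
    proof cases
      case 1
      then show ?thesis using e(1) kept_edge_iff top_par by simp
    next
      case 2
      then show ?thesis using e(1) kept_edge_iff top_par by (simp add: insert_commute)
    qed
  qed
  show "(u, v) \<in> ?R\<^sup>* \<Longrightarrow> top u = top v"
    by (induction rule: rtrancl_induct) (use step in auto)
qed

lemma kept_edges: "edges T - F = (\<lambda>v. {v, par v}) ` {v \<in> V - {r}. kept v}"
  unfolding edges_eq using kept_edge_iff by auto

lemma kept_edge_inj: "inj_on (\<lambda>v. {v, par v}) {v \<in> V - {r}. kept v}"
  by (rule inj_on_subset[OF parent_edge_inj]) auto

text \<open>
  Every non-leaf has a path downwards that leaves its class, because leaves are not contracted.
\<close>

lemma exits_class:
  "v \<in> V \<Longrightarrow> children v \<noteq> {} \<Longrightarrow> \<exists>w \<in> V - {r}. kept w \<and> v \<in> anc w \<and> top (par w) = top v"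
proof (induction rule: children_induct)
  case (vertex v)
  then obtain c where c: "c \<in> children v" by blast
  note cD = childD[OF c]
  show ?case
  proof (cases "kept c")
    case True
    then show ?thesis using cD by auto
  next
    case False
    then have "children c \<noteq> {}" using not_keptD cD by (auto simp: internals_def)
    then obtain w where w: "w \<in> V - {r}" "kept w" "c \<in> anc w" "top (par w) = top c"
      using vertex.IH[OF c] by blast
    then show ?thesis using cD anc_trans[of w c v] top_par[OF _ False] by auto
  qed
qed

end

locale quotient_tree = contraction T par dep n F for T par dep n F +
  fixes \<phi> :: "nat \<Rightarrow> nat"
  assumes \<phi>_eq_iff: "u \<in> verts T \<Longrightarrow> v \<in> verts T \<Longrightarrow> \<phi> u = \<phi> v \<longleftrightarrow> top u = top v"
begin

text \<open>
  An edge that is kept joins the top of a class to another class, and the depths of the tops determine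
  which of its end points is the lower one.
\<close>

lemma edge_image_inj: "inj_on ((`) \<phi>) (edges T - F)"
proof (rule inj_onI)
  fix e e' assume "e \<in> edges T - F" "e' \<in> edges T - F" and eq': "\<phi> ` e = \<phi> ` e'"
  then obtain u v where u: "u \<in> V" "u \<noteq> r" "kept u" and v: "v \<in> V" "v \<noteq> r" "kept v"
    and e: "e = {u, par u}" "e' = {v, par v}"
    unfolding kept_edges by blast
  have eq: "\<phi> ` {u, par u} = \<phi> ` {v, par v}" using eq' e by simp
  have "\<phi> u = \<phi> v \<or> \<phi> u = \<phi> (par v) \<and> \<phi> v = \<phi> (par u)" using eq by (auto simp: doubleton_eq_iff)
  then show "e = e'"
  proof
    assume "\<phi> u = \<phi> v"
    then show ?thesis using \<phi>_eq_iff[OF u(1) v(1)] top_kept u v e by simp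
  next
    assume "\<phi> u = \<phi> (par v) \<and> \<phi> v = \<phi> (par u)"
    then have tops: "top u = top (par v)" "top v = top (par u)"
      using \<phi>_eq_iff[OF u(1) par_in[OF v(1,2)]] \<phi>_eq_iff[OF v(1) par_in[OF u(1,2)]] by auto
    have "dep (top (par u)) \<le> dep (par u)" "dep (top (par v)) \<le> dep (par v)"
      using dep_anc[OF par_in top_anc[OF par_in]] u v by auto
    then have "dep u \<le> dep (par v)" "dep v \<le> dep (par u)"
      unfolding tops[symmetric] using top_kept u v by auto
    then show ?thesis using dep_par[of u] dep_par[of v] u v by simp
  qed
qed

text \<open>
  The lower end points of the edges of the quotient at the class of \<open>v\<close>: the top of the class, unless
  it is the root, and the vertices just below the class.
\<close>

definition exits :: "nat \<Rightarrow> nat set" where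
  "exits v = {w \<in> V - {r}. kept w \<and> (w = top v \<or> top (par w) = top v)}"

lemma card_incident:
  assumes "v \<in> V"
  shows "card {e' \<in> (`) \<phi> ` (edges T - F). \<phi> v \<in> e'} = card (exits v)"
proof -
  have "\<phi> v \<in> \<phi> ` {w, par w} \<longleftrightarrow> w = top v \<or> top (par w) = top v"
    if w: "w \<in> V" "w \<noteq> r" "kept w" for w
    using \<phi>_eq_iff[OF assms w(1)] \<phi>_eq_iff[OF assms par_in[OF w(1,2)]] top_kept[OF w(3)] by auto
  then have "{e' \<in> (`) \<phi> ` (edges T - F). \<phi> v \<in> e'} = (`) \<phi> ` ((\<lambda>w. {w, par w}) ` exits v)"
    unfolding kept_edges exits_def by blast
  moreover have sub: "(\<lambda>w. {w, par w}) ` exits v \<subseteq> edges T - F"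
    unfolding kept_edges exits_def by blast
  moreover have "inj_on (\<lambda>w. {w, par w}) (exits v)"
    by (rule inj_on_subset[OF kept_edge_inj]) (auto simp: exits_def)
  ultimately show ?thesis
    using inj_on_subset[OF edge_image_inj sub] by (simp add: card_image)
qed

lemma exits_leaf:
  assumes "v \<in> V" "children v = {}"
  shows "exits v = {v}"
proof -
  have k: "kept v" "v \<noteq> r" using assms kept_leaf root_children by auto
  then have t: "top v = v" by (simp add: top_kept)
  have "top (par w) \<noteq> v" if "w \<in> V" "w \<noteq> r" for w
  proof
    assume "top (par w) = v"
    then have "v = par w" using leaf_anc[OF par_in[OF that] _ assms(2)] top_anc[OF par_in[OF that]] by simp
    then show False using par_nonleaf[OF that] assms(2) by simp
  qed
  then show ?thesis using k t assms(1) by (auto simp: exits_def)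
qed

lemma exits_nonleaf:
  assumes "v \<in> V" "children v \<noteq> {}"
  shows "card (exits v) \<noteq> 1"
proof
  assume one: "card (exits v) = 1"
  let ?t = "top v"
  have tV: "?t \<in> V" using top_in assms by blast
  have "children ?t \<noteq> {}" using leaf_anc[OF assms(1) top_anc[OF assms(1)]] assms(2) by auto
  then obtain c c' where c: "c \<in> children ?t" "c' \<in> children ?t" "c \<noteq> c'" using two_children tV by blast
  have ex: "\<exists>w \<in> exits v. c \<in> anc w" if c: "c \<in> children ?t" for c
  proof (cases "kept c")
    case True
    then show ?thesis using childD[OF c] self_anc top_top[OF assms(1)] by (auto simp: exits_def)
  next
    case False
    then have "children c \<noteq> {}" "top c = ?t"
      using childD[OF c] not_keptD[of c] top_par[of c] top_top[OF assms(1)] by (auto simp: internals_def)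
    then show ?thesis using exits_class[of c] childD[OF c] by (auto simp: exits_def)
  qed
  obtain w w' where w: "w \<in> exits v" "c \<in> anc w" "w' \<in> exits v" "c' \<in> anc w'"
    using ex c by blast
  then have "w = w'" using one by (metis card_1_singletonE singletonD)
  then have "c = c'" using child_anc_unique[of w c ?t c'] c w by (auto simp: exits_def)
  then show False using c by simp
qed

text \<open>
  The class of a leaf is met by one edge only. The class of a non-leaf is left downwards below at
  least two children of its top.
\<close>

lemma leaves_quotient:
  assumes "verts T' = \<phi> ` V" "edges T' = (`) \<phi> ` (edges T - F)"
  shows "leaves T' = \<phi> ` leaves T"
proof -
  have "\<phi> v \<in> leaves T' \<longleftrightarrow> children v = {}" if v: "v \<in> V" for v
  proof -
    have "\<phi> v \<in> leaves T' \<longleftrightarrow> card (exits v) = 1"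
      using v card_incident[OF v] assms by (simp add: leaves_def vdegree_def)
    then show ?thesis using exits_leaf[OF v] exits_nonleaf[OF v] by auto
  qed
  moreover have "leaves T' \<subseteq> \<phi> ` V" using assms by (auto simp: leaves_def)
  ultimately show ?thesis unfolding leaves_eq by blast
qed

lemma internal_edges_quotient:
  assumes "verts T' = \<phi> ` V" "edges T' = (`) \<phi> ` (edges T - F)"
  shows "internal_edges T' = (`) \<phi> ` (internal_edges T - F)"
proof -
  have leaf: "\<phi> v \<in> \<phi> ` leaves T \<longleftrightarrow> v \<in> leaves T" if v: "v \<in> V" for v
  proof
    assume "\<phi> v \<in> \<phi> ` leaves T"
    then obtain l where l: "l \<in> V" "children l = {}" "\<phi> v = \<phi> l" by (auto simp: leaves_eq)
    then have "top v = l" using \<phi>_eq_iff[OF v l(1)] top_kept kept_leaf by simp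
    then show "v \<in> leaves T" using leaf_anc[OF v top_anc[OF v]] l by (auto simp: leaves_eq)
  qed simp
  have "\<phi> ` e \<inter> leaves T' = {} \<longleftrightarrow> e \<inter> leaves T = {}" if "e \<in> edges T" for e
  proof -
    have "e \<subseteq> V" using that par_in by (auto simp: edges_eq)
    then show ?thesis using leaf unfolding leaves_quotient[OF assms] by blast
  qed
  then show ?thesis unfolding internal_edges_def assms(2) by blast
qed

end

context parent_labelled_tree
begin

text \<open>
  Vertices of simplices are defined by contracting a tree that is itself a contraction of a binary
  tree. Both steps together contract all internal edges but one of the binary tree, which has a
  simpler structure than the intermediate tree.
\<close>

lemma contraction_compose:
  assumes F: "F \<subseteq> internal_edges T" and T': "contracts n T F T'"
  shows "\<exists>\<phi>. internal_edges T' = (`) \<phi> ` (internal_edges T - F) \<and>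
    (\<forall>e \<in> internal_edges T - F. \<forall>T''. contracts n T' (internal_edges T' - {\<phi> ` e}) T''
        \<longrightarrow> contracts n T (internal_edges T - {e}) T'')"
proof -
  interpret contraction T par dep n F using F by unfold_locales
  obtain \<phi> where \<phi>: "verts T' = \<phi> ` verts T"
    "\<forall>u\<in>verts T. \<forall>v\<in>verts T. \<phi> u = \<phi> v \<longleftrightarrow> (u, v) \<in> {(a, b). {a, b} \<in> F}\<^sup>*"
    "edges T' = (\<lambda>e. \<phi> ` e) ` (edges T - F)" "troot T' = \<phi> (troot T)"
    "\<forall>i\<in>{1..n}. leaf_of T' i = \<phi> (leaf_of T i)"
    by (rule contractsE[OF T'])
  interpret quotient_tree T par dep n F \<phi>
    using \<phi>(2) linked_iff by unfold_locales auto
  let ?I = "internal_edges T" and ?I' = "internal_edges T'"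
  have I': "?I' = (`) \<phi> ` (?I - F)" using internal_edges_quotient \<phi> by blast
  have I_edges: "?I \<subseteq> edges T" by (auto simp: internal_edges_def)
  have "contracts n T (?I - {e}) T''"
    if e: "e \<in> ?I - F" and T'': "contracts n T' (?I' - {\<phi> ` e}) T''" for e T''
  proof -
    obtain \<psi> where \<psi>: "verts T'' = \<psi> ` verts T'"
      "\<forall>u\<in>verts T'. \<forall>v\<in>verts T'. \<psi> u = \<psi> v \<longleftrightarrow> (u, v) \<in> {(a, b). {a, b} \<in> ?I' - {\<phi> ` e}}\<^sup>*"
      "edges T'' = (\<lambda>e. \<psi> ` e) ` (edges T' - (?I' - {\<phi> ` e}))" "troot T'' = \<psi> (troot T')"
      "\<forall>i\<in>{1..n}. leaf_of T'' i = \<psi> (leaf_of T' i)"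
      by (rule contractsE[OF T''])
    let ?R = "{(a, b). {a, b} \<in> ?I - {e}}" and ?R' = "{(a, b). {a, b} \<in> ?I' - {\<phi> ` e}}"
    have img: "\<phi> ` e' = \<phi> ` e \<longleftrightarrow> e' = e" if "e' \<in> edges T - F" for e'
      using edge_image_inj that e I_edges by (auto dest: inj_onD)
    have FI: "F \<subseteq> ?I - {e}" using F e by auto
    have "(u, v) \<in> ?R\<^sup>* \<longleftrightarrow> (\<phi> u, \<phi> v) \<in> ?R'\<^sup>*" if u: "u \<in> V" and v: "v \<in> V" for u v
    proof
      have step: "(\<phi> a, \<phi> b) \<in> ?R'\<^sup>*" if ab: "(a, b) \<in> ?R" for a b
      proof (cases "{a, b} \<in> F")
        case True
        then have "a \<in> V" "b \<in> V" using F I_edges edge_iff[of a b] par_in by blast+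
        moreover have "(a, b) \<in> {(a, b). {a, b} \<in> F}\<^sup>*" using True by blast
        ultimately have "\<phi> a = \<phi> b" using \<phi>(2) by blast
        then show ?thesis by simp
      next
        case False
        then have "\<phi> ` {a, b} \<in> ?I' - {\<phi> ` e}"
          using ab I' img[of "{a, b}"] I_edges by blast
        then show ?thesis by auto
      qed
      show "(u, v) \<in> ?R\<^sup>* \<Longrightarrow> (\<phi> u, \<phi> v) \<in> ?R'\<^sup>*"
      proof (induction rule: rtrancl_induct)
        case (step b c)
        then show ?case using \<open>\<And>a b. (a, b) \<in> ?R \<Longrightarrow> (\<phi> a, \<phi> b) \<in> ?R'\<^sup>*\<close>[of b c] by (meson rtrancl_trans)
      qed simp
    next
      have same: "(a, b) \<in> ?R\<^sup>*" if "a \<in> V" "b \<in> V" "\<phi> a = \<phi> b" for a b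
      proof -
        have "(a, b) \<in> {(a, b). {a, b} \<in> F}\<^sup>*" using \<phi>(2) that by blast
        moreover have "{(a, b). {a, b} \<in> F} \<subseteq> ?R" using FI by blast
        ultimately show ?thesis using rtrancl_mono by blast
      qed
      assume "(\<phi> u, \<phi> v) \<in> ?R'\<^sup>*"
      moreover have "\<exists>w \<in> V. x = \<phi> w \<and> (u, w) \<in> ?R\<^sup>*" if "(\<phi> u, x) \<in> ?R'\<^sup>*" for x
        using that
      proof (induction rule: rtrancl_induct)
        case base
        then show ?case using u by blast
      next
        case (step x y)
        then obtain w where w: "w \<in> V" "x = \<phi> w" "(u, w) \<in> ?R\<^sup>*" by blast
        have "{x, y} \<in> ?I'" "{x, y} \<noteq> \<phi> ` e" using step.hyps by auto
        then have "{x, y} \<in> (`) \<phi> ` (?I - F)" using I' by simp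
        then obtain e' where e': "{x, y} = \<phi> ` e'" "e' \<in> ?I - F" by (rule imageE)
        have ne: "e' \<noteq> e" using e'(1) \<open>{x, y} \<noteq> \<phi> ` e\<close> by blast
        have "e' \<in> edges T" using e'(2) I_edges by blast
        then obtain c where c: "c \<in> V" "c \<noteq> r" "e' = {c, par c}"
          unfolding edges_eq by blast
        then have pV: "par c \<in> V" using par_in by blast
        have "{x, y} = {\<phi> c, \<phi> (par c)}" using e' c by simp
        then consider "x = \<phi> c" "y = \<phi> (par c)" | "x = \<phi> (par c)" "y = \<phi> c"
          by (auto simp: doubleton_eq_iff)
        then obtain a b where ab: "a \<in> V" "b \<in> V" "x = \<phi> a" "y = \<phi> b" "{a, b} = e'"
        proof cases
          case 1
          then show ?thesis using that[of c "par c"] c pV by simp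
        next
          case 2
          then show ?thesis using that[of "par c" c] c pV by (simp add: insert_commute)
        qed
        have "(w, a) \<in> ?R\<^sup>*" using same[OF w(1) ab(1)] w(2) ab(3) by simp
        then have "(u, a) \<in> ?R\<^sup>*" by (rule rtrancl_trans[OF w(3)])
        moreover have "(a, b) \<in> ?R" using ab(5) e'(2) ne by simp
        ultimately have "(u, b) \<in> ?R\<^sup>*" by (rule rtrancl_into_rtrancl)
        then show ?case using ab(2,4) by (intro bexI[of _ b] conjI)
      qed
      ultimately obtain w where "w \<in> V" "\<phi> v = \<phi> w" "(u, w) \<in> ?R\<^sup>*" by blast
      then have "(w, v) \<in> ?R\<^sup>*" using same[of w v] v by simp
      then show "(u, v) \<in> ?R\<^sup>*" by (rule rtrancl_trans[OF \<open>(u, w) \<in> ?R\<^sup>*\<close>])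
    qed
    then have eq_iff: "\<forall>u\<in>V. \<forall>v\<in>V. (\<psi> \<circ> \<phi>) u = (\<psi> \<circ> \<phi>) v \<longleftrightarrow> (u, v) \<in> ?R\<^sup>*"
      using \<psi>(2) \<phi>(1) by simp
    have "edges T' - (?I' - {\<phi> ` e}) = (`) \<phi> ` (edges T - (?I - {e}))"
    proof -
      have "(`) \<phi> ` ((edges T - F) - (?I - F - {e})) = (`) \<phi> ` (edges T - F) - (`) \<phi> ` (?I - F - {e})"
        by (rule inj_on_image_set_diff[OF edge_image_inj]) (use I_edges in auto)
      moreover have "(`) \<phi> ` (?I - F - {e}) = ?I' - {\<phi> ` e}"
      proof -
        have "(`) \<phi> ` (?I - F - {e}) = (`) \<phi> ` (?I - F) - (`) \<phi> ` {e}"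
          by (rule inj_on_image_set_diff[OF edge_image_inj]) (use I_edges e in auto)
        then show ?thesis unfolding I' by simp
      qed
      moreover have "(edges T - F) - (?I - F - {e}) = edges T - (?I - {e})"
        using FI by blast
      ultimately show ?thesis using \<phi>(3) by simp
    qed
    then have "edges T'' = (\<lambda>e. (\<psi> \<circ> \<phi>) ` e) ` (edges T - (?I - {e}))"
      using \<psi>(3) by (simp add: image_image image_comp)
    then show ?thesis
      unfolding contracts_def using \<phi> \<psi> eq_iff
      by (intro exI[of _ "\<psi> \<circ> \<phi>"]) (simp add: image_comp)
  qed
  then show ?thesis using I' by blast
qed

end

section \<open>Trees with one internal edge\<close>

text \<open>
  Vertex \<open>0\<close> is the root, vertex \<open>1\<close> the only internal vertex, and label \<open>i\<close> sits at vertex \<open>Suc i\<close>,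
  which hangs below \<open>1\<close> if \<open>i \<in> A\<close> and below the root otherwise.
\<close>

definition star_tree :: "nat \<Rightarrow> nat set \<Rightarrow> ltree" where
  "star_tree n A = LTree {0..Suc n}
     (insert {0, 1} ((\<lambda>i. {Suc i, if i \<in> A then 1 else 0}) ` {1..n})) 0 Suc"

lemma star_tree_labelled:
  assumes A: "A \<subseteq> {1..n}" "2 \<le> card A" "card A < n"
  shows "labelled_tree n (star_tree n A)"
proof -
  define par where "par = (\<lambda>v :: nat. if v \<ge> 2 \<and> v - 1 \<in> A then 1 else 0 :: nat)"
  define dep where "dep = (\<lambda>v :: nat. if v = 0 then 0 else if v \<ge> 2 \<and> v - 1 \<in> A then 2 else 1 :: nat)"
  let ?T = "star_tree n A"
  have T: "verts ?T = {0..Suc n}" "troot ?T = 0" "leaf_of ?T = Suc"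
    "edges ?T = insert {0, 1} ((\<lambda>i. {Suc i, if i \<in> A then 1 else 0}) ` {1..n})"
    by (simp_all add: star_tree_def)
  have verts: "{0..Suc n} - {0} = insert 1 (Suc ` {1..n})"
    unfolding image_Suc_atLeastAtMost by auto
  note [simp del] = image_Suc_atLeastAtMost
  have parS: "par (Suc i) = (if i \<in> A then 1 else 0)" if "i \<in> {1..n}" for i
    using that by (auto simp: par_def)
  have par1: "par 1 = 0" by (simp add: par_def)
  interpret parent_tree ?T par dep
  proof
    have "(\<lambda>i. {Suc i, par (Suc i)}) ` {1..n} = (\<lambda>i. {Suc i, if i \<in> A then 1 else 0}) ` {1..n}"
      by (intro image_cong refl) (simp only: parS)
    then have "(\<lambda>v. {v, par v}) ` insert 1 (Suc ` {1..n}) = edges ?T"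
      unfolding T image_insert image_image par1 by (simp only: insert_commute)
    then show "edges ?T = (\<lambda>v. {v, par v}) ` (verts ?T - {troot ?T})"
      by (simp only: T verts)
  qed (auto simp: T par_def dep_def)
  have fin: "finite A" using A finite_subset by auto
  have par_iff: "par (Suc i) = 1 \<longleftrightarrow> i \<in> A" "par (Suc i) = 0 \<longleftrightarrow> i \<notin> A" if "i \<in> {1..n}" for i
    using parS[OF that] by simp_all
  have par1': "par 1 \<noteq> 1" using par1 by simp
  have ch1: "children 1 = Suc ` A"
    unfolding children_def T verts using A(1) par1' par_iff(1) by blast
  have ch0: "children 0 = insert 1 (Suc ` ({1..n} - A))"
    unfolding children_def T verts
  proof (intro equalityI subsetI)
    fix c assume "c \<in> {c \<in> insert 1 (Suc ` {1..n}). par c = 0}"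
    then have "c = 1 \<or> (\<exists>i \<in> {1..n}. c = Suc i)" "par c = 0" by blast+
    then show "c \<in> insert 1 (Suc ` ({1..n} - A))" using par_iff(2) by blast
  next
    fix c assume "c \<in> insert 1 (Suc ` ({1..n} - A))"
    then consider "c = 1" | i where "i \<in> {1..n}" "i \<notin> A" "c = Suc i" by blast
    then show "c \<in> {c \<in> insert 1 (Suc ` {1..n}). par c = 0}"
      using par1 par_iff(2) by cases simp_all
  qed
  have ch: "children (Suc i) = {}" if "i \<in> {1..n}" for i
  proof -
    have "par c \<noteq> Suc i" for c using that by (simp add: par_def)
    then show ?thesis unfolding children_def by blast
  qed
  have card1: "card (children 1) = card A" unfolding ch1 by (simp add: card_image)
  have card0: "card (children 0) = Suc (n - card A)"
  proof -
    have "1 \<notin> Suc ` ({1..n} - A)" by auto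
    then show ?thesis unfolding ch0 using A fin by (simp add: card_image card_Diff_subset)
  qed
  have v_cases: "v = 0 \<or> v = 1 \<or> (\<exists>i \<in> {1..n}. v = Suc i)" if "v \<in> verts ?T" for v
    using that verts T(1) by blast
  have "parent_labelled_tree ?T par dep n"
  proof
    show "children (troot ?T) \<noteq> {}" using ch0 T by auto
    show "card (children v) \<noteq> 1" if "v \<in> verts ?T" for v
    proof -
      consider "v = 0" | "v = 1" | i where "i \<in> {1..n}" "v = Suc i" using v_cases \<open>v \<in> _\<close> by blast
      then show ?thesis
      proof cases
        case 1
        then show ?thesis using card0 A(3) by simp
      next
        case 2
        then show ?thesis using card1 A(2) by (simp only:)
      next
        case 3
        then show ?thesis by (simp only: ch card.empty)
      qed
    qed
    have "{v \<in> verts ?T. children v = {}} = Suc ` {1..n}"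
    proof
      have "children 0 \<noteq> {}" "children 1 \<noteq> {}" using ch0 ch1 A(2) by auto
      then show "{v \<in> verts ?T. children v = {}} \<subseteq> Suc ` {1..n}"
        using v_cases by blast
      show "Suc ` {1..n} \<subseteq> {v \<in> verts ?T. children v = {}}"
        using ch unfolding T(1) by auto
    qed
    then show "bij_betw (leaf_of ?T) {1..n} {v \<in> verts ?T. children v = {}}"
      by (simp add: T bij_betw_def)
  qed
  then interpret parent_labelled_tree ?T par dep n .
  show ?thesis by (rule labelled_tree)
qed

lemma tree_iso_refl: "tree_iso n T T"
  unfolding tree_iso_def by (intro exI[of _ id]) auto

lemma tree_iso_trans:
  assumes "tree_iso n T1 T2" "tree_iso n T2 T3"
  shows "tree_iso n T1 T3"
proof -
  obtain \<phi> where "bij_betw \<phi> (verts T1) (verts T2)" "edges T2 = (\<lambda>e. \<phi> ` e) ` edges T1"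
    "troot T2 = \<phi> (troot T1)" "\<forall>i\<in>{1..n}. leaf_of T2 i = \<phi> (leaf_of T1 i)"
    using assms(1) unfolding tree_iso_def by auto
  moreover obtain \<psi> where "bij_betw \<psi> (verts T2) (verts T3)" "edges T3 = (\<lambda>e. \<psi> ` e) ` edges T2"
    "troot T3 = \<psi> (troot T2)" "\<forall>i\<in>{1..n}. leaf_of T3 i = \<psi> (leaf_of T2 i)"
    using assms(2) unfolding tree_iso_def by auto
  ultimately show ?thesis
    unfolding tree_iso_def by (intro exI[of _ "\<psi> \<circ> \<phi>"]) (auto simp: bij_betw_trans image_image image_comp)
qed

lemma tree_iso_sym:
  assumes iso: "tree_iso n T T'"
    and T: "\<And>e. e \<in> edges T \<Longrightarrow> e \<subseteq> verts T" "troot T \<in> verts T" "\<And>i. i \<in> {1..n} \<Longrightarrow> leaf_of T i \<in> verts T"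
  shows "tree_iso n T' T"
proof -
  obtain \<phi> where \<phi>: "bij_betw \<phi> (verts T) (verts T')" "edges T' = (\<lambda>e. \<phi> ` e) ` edges T"
    "troot T' = \<phi> (troot T)" "\<forall>i\<in>{1..n}. leaf_of T' i = \<phi> (leaf_of T i)"
    using iso unfolding tree_iso_def by auto
  define \<psi> where "\<psi> = inv_into (verts T) \<phi>"
  have inv: "\<psi> (\<phi> v) = v" if "v \<in> verts T" for v
    using that \<phi>(1) by (simp add: \<psi>_def bij_betw_def)
  have "\<psi> ` \<phi> ` e = e" if "e \<in> edges T" for e
    using inv T(1)[OF that] by (force simp: image_image)
  then have "edges T = (\<lambda>e. \<psi> ` e) ` edges T'" by (simp add: \<phi>(2) image_image[of _ _ "edges T"])
  moreover have "bij_betw \<psi> (verts T') (verts T)" unfolding \<psi>_def by (rule bij_betw_inv_into[OF \<phi>(1)])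
  ultimately show ?thesis
    unfolding tree_iso_def using inv T \<phi> by (intro exI[of _ \<psi>]) auto
qed

definition cluster_vertex :: "nat \<Rightarrow> nat set \<Rightarrow> ltree set" where
  "cluster_vertex n A = comb_type n (star_tree n A)"

lemma comb_type_star:
  assumes "tree_iso n (star_tree n A) T"
  shows "comb_type n T = cluster_vertex n A"
proof -
  have "tree_iso n T (star_tree n A)"
  proof (rule tree_iso_sym[OF assms])
    fix e assume "e \<in> edges (star_tree n A)"
    then show "e \<subseteq> verts (star_tree n A)" by (auto simp: star_tree_def)
  qed (auto simp: star_tree_def)
  then show ?thesis
    using assms tree_iso_trans unfolding cluster_vertex_def comb_type_def by blast
qed

lemma star_tree_edge:
  assumes i: "i \<in> {1..n}" and b: "b \<le> 1" and e: "{Suc i, b} \<in> edges (star_tree n A)"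
  shows "b = (if i \<in> A then 1 else 0)"
proof -
  have "{Suc i, b} \<noteq> {0, 1}" using i by (auto simp: doubleton_eq_iff)
  then obtain j where j: "j \<in> {1..n}" "{Suc i, b} = {Suc j, if j \<in> A then 1 else 0}"
    using e unfolding star_tree_def ltree.sel by blast
  then have "Suc i = Suc j \<and> b = (if j \<in> A then 1 else 0) \<or> b = Suc j"
    by (auto simp: doubleton_eq_iff)
  then show ?thesis using b j(1) by auto
qed

text \<open>
  An isomorphism of star trees fixes the root and all leaves, hence also the internal vertex, so it
  preserves the neighbour of each leaf.
\<close>

lemma cluster_vertex_inj:
  "inj_on (cluster_vertex n) {A. A \<subseteq> {1..n} \<and> 2 \<le> card A \<and> card A < n}"
proof (rule inj_onI)
  fix A B assume A: "A \<in> {A. A \<subseteq> {1..n} \<and> 2 \<le> card A \<and> card A < n}"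
    and B: "B \<in> {A. A \<subseteq> {1..n} \<and> 2 \<le> card A \<and> card A < n}"
    and eq: "cluster_vertex n A = cluster_vertex n B"
  have "star_tree n A \<in> cluster_vertex n A"
    using A star_tree_labelled tree_iso_refl by (auto simp: cluster_vertex_def comb_type_def)
  then have "star_tree n A \<in> cluster_vertex n B" using eq by simp
  then have "tree_iso n (star_tree n B) (star_tree n A)"
    by (simp add: cluster_vertex_def comb_type_def)
  then obtain \<phi> where \<phi>: "bij_betw \<phi> {0..Suc n} {0..Suc n}"
    "edges (star_tree n A) = (\<lambda>e. \<phi> ` e) ` edges (star_tree n B)" "0 = \<phi> 0" "\<forall>i\<in>{1..n}. Suc i = \<phi> (Suc i)"
    unfolding tree_iso_def by (auto simp: star_tree_def)
  have one: "\<phi> 1 = 1"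
  proof -
    have "1 \<in> \<phi> ` {0..Suc n}" using \<phi>(1) by (auto simp: bij_betw_def)
    then obtain v where v: "v \<le> Suc n" "\<phi> v = 1" by auto
    then have "v \<noteq> 0" using \<phi>(3) by (metis zero_neq_one)
    moreover have "\<not> v \<ge> 2"
    proof
      assume "v \<ge> 2"
      then have "v - 1 \<in> {1..n}" "v = Suc (v - 1)" using v(1) by auto
      then have "\<phi> v = v" using \<phi>(4) by metis
      then show False using v(2) \<open>v \<ge> 2\<close> by simp
    qed
    ultimately have "v = 1" by linarith
    then show ?thesis using v(2) by simp
  qed
  have "i \<in> A \<longleftrightarrow> i \<in> B" if i: "i \<in> {1..n}" for i
  proof -
    have "{Suc i, if i \<in> B then 1 else 0} \<in> edges (star_tree n B)"
      using i by (auto simp: star_tree_def)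
    then have "\<phi> ` {Suc i, if i \<in> B then 1 else 0} \<in> edges (star_tree n A)"
      using \<phi>(2) by blast
    then have "{Suc i, if i \<in> B then 1 else 0} \<in> edges (star_tree n A)"
      using \<phi>(3,4) one i by (auto split: if_splits)
    then have "(if i \<in> B then 1 else 0) = (if i \<in> A then 1 else 0 :: nat)"
      using star_tree_edge[OF i, of "if i \<in> B then 1 else 0" A] by simp
    then show ?thesis by (simp split: if_splits)
  qed
  then show "A = B" using A B by blast
qed

context parent_labelled_tree
begin

text \<open>
  Contracting every internal edge except the one above \<open>w\<close> leaves two classes of non-leaves: \<open>w\<close> with
  the non-leaves below it, and the others.
\<close>

lemma contraction_star:
  assumes w: "w \<in> internals" and T'': "contracts n T (internal_edges T - {{w, par w}}) T''"
  shows "comb_type n T'' = cluster_vertex n (labs w)"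
proof -
  let ?F = "internal_edges T - {{w, par w}}"
  interpret contraction T par dep n ?F by unfold_locales auto
  obtain \<phi> where \<phi>: "verts T'' = \<phi> ` verts T"
    "\<forall>u\<in>verts T. \<forall>v\<in>verts T. \<phi> u = \<phi> v \<longleftrightarrow> (u, v) \<in> {(a, b). {a, b} \<in> ?F}\<^sup>*"
    "edges T'' = (\<lambda>e. \<phi> ` e) ` (edges T - ?F)" "troot T'' = \<phi> (troot T)"
    "\<forall>i\<in>{1..n}. leaf_of T'' i = \<phi> (leaf_of T i)"
    by (rule contractsE[OF T''])
  interpret quotient_tree T par dep n ?F \<phi>
    using \<phi>(2) linked_iff by unfold_locales auto
  have wV: "w \<in> V" "w \<noteq> r" "children w \<noteq> {}" using w by (auto simp: internals_def)
  have kept: "kept v \<longleftrightarrow> v = r \<or> v = w \<or> children v = {}" if v: "v \<in> V" for v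
  proof (cases "v = r")
    case False
    have "{v, par v} \<in> internal_edges T \<longleftrightarrow> v \<in> internals"
      using parent_edge_inj v False unfolding internal_edges_eq
      by (auto simp: internals_def dest: inj_onD)
    moreover have "{v, par v} = {w, par w} \<longleftrightarrow> v = w"
      using inj_on_eq_iff[OF parent_edge_inj, of v w] v wV False by blast
    ultimately show ?thesis using v False by (auto simp: kept_def internals_def)
  qed (simp add: kept_def)
  have top: "top v = (if w \<in> anc v then w else r)" if "v \<in> V" "children v \<noteq> {}" for v
    using that
  proof (induction rule: parent_induct)
    case root
    then show ?case using wV by (simp add: top_kept kept_def anc_root)
  next
    case (step v)
    show ?case
    proof (cases "v = w")
      case True
      then show ?thesis using kept[OF wV(1)] by (simp add: top_kept self_anc)
    next
      case False
      then have "\<not> kept v" using kept[OF step.hyps(1)] step by simp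
      then show ?thesis
        using step False top_par par_nonleaf[OF step.hyps] by (simp add: anc_step)
    qed
  qed
  define \<rho> where "\<rho> = (\<lambda>j. if j = 0 then r else if j = 1 then w else leaf_of T (j - 1))"
  have \<rho>: "\<rho> 0 = r" "\<rho> 1 = w" "i \<in> {1..n} \<Longrightarrow> \<rho> (Suc i) = leaf_of T i" for i
    by (auto simp: \<rho>_def)
  have \<rho>_leaves: "\<rho> ` Suc ` {1..n} = leaf_of T ` {1..n}"
    unfolding image_image by (intro image_cong refl \<rho>(3))
  have idx: "{0..Suc n} = insert 0 (insert 1 (Suc ` {1..n}))"
    unfolding image_Suc_atLeastAtMost by auto
  have range: "\<rho> ` {0..Suc n} = {v \<in> V. kept v}"
  proof -
    have "\<rho> ` {0..Suc n} = insert r (insert w (leaf_of T ` {1..n}))"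
      unfolding idx image_insert \<rho>_leaves \<rho>(1,2) ..
    also have "leaf_of T ` {1..n} = {v \<in> V. children v = {}}" using labels by (simp add: bij_betw_def)
    finally show ?thesis using kept wV root_in by auto
  qed
  have "inj_on \<rho> {0..Suc n}"
  proof -
    have "inj_on \<rho> (Suc ` {1..n})"
    proof (rule inj_onI)
      fix x y assume xy: "x \<in> Suc ` {1..n}" "y \<in> Suc ` {1..n}" "\<rho> x = \<rho> y"
      then obtain i j where ij: "x = Suc i" "y = Suc j" "i \<in> {1..n}" "j \<in> {1..n}" by blast
      then show "x = y" using leaf_inj[of i j] \<rho>(3) xy(3) by simp
    qed
    moreover have "\<rho> 1 \<notin> \<rho> ` (Suc ` {1..n})" "\<rho> 0 \<notin> \<rho> ` (Suc ` {1..n})"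
      unfolding \<rho>_leaves \<rho>(1,2) using leaf_in(2) wV(3) root_children by auto
    moreover have "\<rho> 0 \<noteq> \<rho> 1" unfolding \<rho>(1,2) using wV(2) by simp
    ultimately show ?thesis unfolding idx inj_on_insert by blast
  qed
  moreover have "inj_on \<phi> (\<rho> ` {0..Suc n})"
    unfolding range using \<phi>_eq_iff top_kept by (intro inj_onI) auto
  ultimately have inj: "inj_on (\<phi> \<circ> \<rho>) {0..Suc n}" by (rule comp_inj_on)
  have "\<phi> v \<in> \<phi> ` {v \<in> V. kept v}" if v: "v \<in> V" for v
  proof (rule image_eqI)
    show "\<phi> v = \<phi> (top v)" using \<phi>_eq_iff[OF v top_in[OF v]] top_top[OF v] by simp
    show "top v \<in> {v \<in> V. kept v}" using kept_top[OF v] top_in[OF v] by simp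
  qed
  then have "\<phi> ` \<rho> ` {0..Suc n} = \<phi> ` V" unfolding range by blast
  then have bij: "bij_betw (\<phi> \<circ> \<rho>) {0..Suc n} (verts T'')"
    using inj \<phi>(1) by (simp add: bij_betw_def image_comp)
  have \<phi>_top: "\<phi> v = \<phi> (if w \<in> anc v then w else r)" if v: "v \<in> V" "children v \<noteq> {}" for v
    using \<phi>_eq_iff[OF v(1) top_in[OF v(1)]] top_top[OF v(1)] top[OF v] by simp
  have par_w: "\<phi> (par w) = \<phi> r"
  proof -
    have "w \<notin> anc (par w)"
      using dep_anc[OF par_in[OF wV(1,2)], of w] dep_par[OF wV(1,2)] by auto
    then show ?thesis using \<phi>_top[OF par_in[OF wV(1,2)] par_nonleaf[OF wV(1,2)]] by simp
  qed
  have par_leaf: "\<phi> (par (leaf_of T i)) = \<phi> (if i \<in> labs w then w else r)" if i: "i \<in> {1..n}" for i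
  proof -
    note l = leaf_in[OF i]
    have lr: "leaf_of T i \<noteq> r" "leaf_of T i \<noteq> w" using l(2) root_children wV(3) by auto
    have "w \<in> anc (par (leaf_of T i)) \<longleftrightarrow> i \<in> labs w"
      using anc_step[OF l(1) lr(1)] lr(2) i by (auto simp: labs_def)
    then show ?thesis using \<phi>_top[OF par_in[OF l(1) lr(1)] par_nonleaf[OF l(1) lr(1)]] by simp
  qed
  have "edges T - ?F = (\<lambda>v. {v, par v}) ` insert w (leaf_of T ` {1..n})"
  proof -
    have "{v \<in> V - {r}. kept v} = insert w {v \<in> V. children v = {}}"
      using kept wV root_children by auto
    also have "{v \<in> V. children v = {}} = leaf_of T ` {1..n}" using labels by (simp add: bij_betw_def)
    finally show ?thesis by (simp only: kept_edges)
  qed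
  then have "edges T'' = insert {\<phi> w, \<phi> r} ((\<lambda>i. {\<phi> (leaf_of T i), \<phi> (if i \<in> labs w then w else r)}) ` {1..n})"
  proof -
    have "(\<lambda>i. {\<phi> (leaf_of T i), \<phi> (par (leaf_of T i))}) ` {1..n}
        = (\<lambda>i. {\<phi> (leaf_of T i), \<phi> (if i \<in> labs w then w else r)}) ` {1..n}"
      by (intro image_cong refl) (simp only: par_leaf)
    then show ?thesis
      using \<phi>(3) par_w \<open>edges T - ?F = _\<close> by (simp add: image_image)
  qed
  also have "\<dots> = (\<lambda>e. (\<phi> \<circ> \<rho>) ` e) ` edges (star_tree n (labs w))"
  proof -
    have edge: "(\<phi> \<circ> \<rho>) ` {Suc i, if i \<in> labs w then 1 else 0} = {\<phi> (leaf_of T i), \<phi> (if i \<in> labs w then w else r)}"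
      if "i \<in> {1..n}" for i
      using \<rho>(1,2) \<rho>(3)[OF that] by simp
    have "(\<phi> \<circ> \<rho>) ` {0, 1} = {\<phi> w, \<phi> r}" using \<rho>(1,2) by auto
    moreover have "(\<lambda>i. {\<phi> (leaf_of T i), \<phi> (if i \<in> labs w then w else r)}) ` {1..n}
        = (\<lambda>e. (\<phi> \<circ> \<rho>) ` e) ` (\<lambda>i. {Suc i, if i \<in> labs w then 1 else 0}) ` {1..n}"
      unfolding image_image[of "\<lambda>e. (\<phi> \<circ> \<rho>) ` e"] by (intro image_cong refl) (rule edge[symmetric])
    ultimately show ?thesis
      by (simp only: star_tree_def ltree.sel image_insert[of "\<lambda>e. (\<phi> \<circ> \<rho>) ` e"])
  qed
  finally have "tree_iso n (star_tree n (labs w)) T''"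
    unfolding tree_iso_def using bij \<phi>(4,5) \<rho>
    by (intro exI[of _ "\<phi> \<circ> \<rho>"]) (simp add: star_tree_def)
  then show ?thesis by (rule comb_type_star)
qed

lemma tree_simplex_contraction:
  assumes F: "F \<subseteq> internal_edges T" and T': "contracts n T F T'"
  shows "tree_simplex n T' = cluster_vertex n ` labs ` {v \<in> internals. {v, par v} \<notin> F}"
proof -
  obtain \<phi> where I': "internal_edges T' = (`) \<phi> ` (internal_edges T - F)"
    and comp: "\<forall>e \<in> internal_edges T - F. \<forall>T''. contracts n T' (internal_edges T' - {\<phi> ` e}) T''
        \<longrightarrow> contracts n T (internal_edges T - {e}) T''"
    using contraction_compose[OF F T'] by blast
  have I: "internal_edges T - F = (\<lambda>v. {v, par v}) ` {v \<in> internals. {v, par v} \<notin> F}"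
    unfolding internal_edges_eq by blast
  have type: "comb_type n T'' = cluster_vertex n (labs w)"
    if "w \<in> internals" "{w, par w} \<notin> F" "contracts n T' (internal_edges T' - {\<phi> ` {w, par w}}) T''" for w T''
    using comp contraction_star[OF that(1)] that I by blast
  show ?thesis
  proof
    show "tree_simplex n T' \<subseteq> cluster_vertex n ` labs ` {v \<in> internals. {v, par v} \<notin> F}"
    proof
      fix x assume "x \<in> tree_simplex n T'"
      then obtain T'' e where x: "x = comb_type n T''" and e: "e \<in> internal_edges T'"
        and T'': "contracts n T' (internal_edges T' - {e}) T''"
        by (auto simp: tree_simplex_def)
      obtain w where w: "w \<in> internals" "{w, par w} \<notin> F" "e = \<phi> ` {w, par w}"
        using e unfolding I' I by blast
      then show "x \<in> cluster_vertex n ` labs ` {v \<in> internals. {v, par v} \<notin> F}"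
        using type[OF w(1,2)] T'' x by blast
    qed
    show "cluster_vertex n ` labs ` {v \<in> internals. {v, par v} \<notin> F} \<subseteq> tree_simplex n T'"
    proof
      fix x assume "x \<in> cluster_vertex n ` labs ` {v \<in> internals. {v, par v} \<notin> F}"
      then obtain w where w: "w \<in> internals" "{w, par w} \<notin> F" "x = cluster_vertex n (labs w)" by blast
      obtain T'' where T'': "contracts n T' (internal_edges T' - {\<phi> ` {w, par w}}) T''"
        using contraction_exists by blast
      have "\<phi> ` {w, par w} \<in> internal_edges T'" using w I I' by blast
      then show "x \<in> tree_simplex n T'"
        using type[OF w(1,2) T''] T'' w(3) unfolding tree_simplex_def by blast
    qed
  qed
qed

lemma contracts_nothing: "contracts n T {} T"
  unfolding contracts_def by (intro exI[of _ id]) auto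

lemma tree_simplex_eq: "tree_simplex n T = cluster_vertex n ` clusters"
  using tree_simplex_contraction[OF _ contracts_nothing] by (simp add: clusters_def)

end

section \<open>The complex of trees as a complex of clusters\<close>

text \<open>
  A face of the complex of trees consists of some of the clusters of a binary tree, and every choice is
  possible: contract the edges above the others.
\<close>

lemma tree_complex_eq:
  assumes n: "2 \<le> n"
  shows "tree_complex n = (`) (cluster_vertex n) ` cluster_complex {1..n}"
proof
  show "tree_complex n \<subseteq> (`) (cluster_vertex n) ` cluster_complex {1..n}"
  proof
    fix s assume "s \<in> tree_complex n"
    then obtain T T' F where T: "binary_tree n T" "F \<subseteq> internal_edges T" "contracts n T F T'"
      and s: "s = tree_simplex n T'"
      by (auto simp: tree_complex_def)
    obtain par dep where "parent_binary_tree T par dep n" using binary_tree_parent[OF T(1)] by blast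
    then interpret parent_binary_tree T par dep n .
    let ?F = "labs ` {v \<in> internals. {v, par v} \<notin> F}"
    have "?F \<subseteq> clusters" by (auto simp: clusters_def)
    then have "?F \<in> cluster_complex {1..n}"
      using binary_hierarchy clusters_eq by (auto simp: cluster_complex_def)
    then show "s \<in> (`) (cluster_vertex n) ` cluster_complex {1..n}"
      using s tree_simplex_contraction[OF T(2,3)] by blast
  qed
  show "(`) (cluster_vertex n) ` cluster_complex {1..n} \<subseteq> tree_complex n"
  proof
    fix s assume "s \<in> (`) (cluster_vertex n) ` cluster_complex {1..n}"
    then obtain G H where H: "binary_hierarchy {1..n} H" "G \<subseteq> H - trivial_clusters {1..n}"
      and s: "s = cluster_vertex n ` G"
      by (auto simp: cluster_complex_def)
    interpret H: hierarchy "{1..n}" H using H(1) by unfold_locales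
    obtain T par dep where T: "parent_binary_tree T par dep n"
      and labs: "parent_labelled_tree.labs T par dep n ` verts T = H"
      using H.realised[OF refl n] by blast
    interpret parent_binary_tree T par dep n by (rule T)
    define F where "F = (\<lambda>v. {v, par v}) ` {v \<in> internals. labs v \<notin> G}"
    have F: "F \<subseteq> internal_edges T" by (auto simp: F_def internal_edges_eq)
    have "{v, par v} \<notin> F \<longleftrightarrow> labs v \<in> G" if v: "v \<in> internals" for v
    proof -
      have "v = u" if "u \<in> internals" "{v, par v} = {u, par u}" for u
        using inj_onD[OF parent_edge_inj that(2)] that(1) v by (auto simp: internals_def)
      then show ?thesis using v unfolding F_def by blast
    qed
    then have "labs ` {v \<in> internals. {v, par v} \<notin> F} = clusters \<inter> G"
      by (auto simp: clusters_def)
    also have "\<dots> = G" using H(2) labs clusters_eq by blast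
    finally have "labs ` {v \<in> internals. {v, par v} \<notin> F} = G" .
    moreover obtain T' where T': "contracts n T F T'" using contraction_exists by blast
    ultimately have "s = tree_simplex n T'" using tree_simplex_contraction[OF F T'] s by simp
    then show "s \<in> tree_complex n"
      unfolding tree_complex_def using binary_tree F T' by blast
  qed
qed

lemma admissible_simplices_eq:
  assumes n: "2 \<le> n"
  shows "admissible_simplices n = (`) (cluster_vertex n) ` admissible_families {1..n}"
proof
  have n1: "1 \<le> n" using n by simp
  show "admissible_simplices n \<subseteq> (`) (cluster_vertex n) ` admissible_families {1..n}"
  proof
    fix s assume "s \<in> admissible_simplices n"
    then obtain T where T: "admissible n T" "s = tree_simplex n T"
      by (auto simp: admissible_simplices_def)
    then have "binary_tree n T" by (simp add: admissible_def)
    then obtain par dep where "parent_binary_tree T par dep n" using binary_tree_parent by blast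
    then interpret parent_binary_tree T par dep n .
    have "clusters \<in> admissible_families {1..n}"
      unfolding admissible_families_def clusters_eq
      using binary_hierarchy admissible_iff[OF n1] T(1) by blast
    then show "s \<in> (`) (cluster_vertex n) ` admissible_families {1..n}"
      using T(2) tree_simplex_eq by blast
  qed
  show "(`) (cluster_vertex n) ` admissible_families {1..n} \<subseteq> admissible_simplices n"
  proof
    fix s assume "s \<in> (`) (cluster_vertex n) ` admissible_families {1..n}"
    then obtain H where H: "binary_hierarchy {1..n} H" "\<forall>Z\<in>H. \<not> bad H Z"
      and s: "s = cluster_vertex n ` (H - trivial_clusters {1..n})"
      by (auto simp: admissible_families_def)
    interpret H: hierarchy "{1..n}" H using H(1) by unfold_locales
    obtain T par dep where T: "parent_binary_tree T par dep n"
      and labs: "parent_labelled_tree.labs T par dep n ` verts T = H"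
      using H.realised[OF refl n] by blast
    interpret parent_binary_tree T par dep n by (rule T)
    have "admissible n T" using admissible_iff[OF n1] H(2) labs by simp
    moreover have "s = tree_simplex n T" using s tree_simplex_eq clusters_eq labs by simp
    ultimately show "s \<in> admissible_simplices n" by (auto simp: admissible_simplices_def)
  qed
qed

lemma cluster_complex_vertices:
  "\<Union> (cluster_complex {1..n}) \<subseteq> {A. A \<subseteq> {1..n} \<and> 2 \<le> card A \<and> card A < n}"
proof
  fix A assume "A \<in> \<Union> (cluster_complex {1..n})"
  then obtain H where H: "binary_hierarchy {1..n} H" "A \<in> H" "A \<notin> trivial_clusters {1..n}"
    by (auto simp: cluster_complex_def)
  interpret hierarchy "{1..n}" H using H(1) by unfold_locales
  have A: "A \<subseteq> {1..n}" "A \<noteq> {}" "A \<noteq> {1..n}" "finite A"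
    using H cluster_sub cluster_nonempty cluster_finite by (auto simp: trivial_clusters_def)
  have "card A \<noteq> 1" using H(3) A(1) by (auto simp: trivial_clusters_def card_1_singleton_iff)
  moreover have "card A \<noteq> 0" using A by simp
  moreover have "card A < card {1..n}" using A by (intro psubset_card_mono) auto
  ultimately show "A \<in> {A. A \<subseteq> {1..n} \<and> 2 \<le> card A \<and> card A < n}" using A(1) by simp
qed

text \<open>An injective renaming of vertices transports the matching.\<close>

lemma matched_complex_image:
  assumes "matched_complex K C e \<rho> d" and inj: "inj_on f (\<Union> K)"
  shows "matched_complex ((`) f ` K) ((`) f ` C) (\<lambda>G. f (e (inv_into (\<Union> K) f ` G)))
           (\<lambda>G. \<rho> (inv_into (\<Union> K) f ` G)) d"
proof -
  interpret matched_complex K C e \<rho> d by (rule assms(1))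
  let ?g = "\<lambda>G. inv_into (\<Union> K) f ` G"
  have g: "?g (f ` F) = F" if "F \<subseteq> \<Union> K" for F
    using inv_into_image_cancel[OF inj that] .
  have gK: "?g (f ` F) = F" if "F \<in> K" for F using g that by blast
  have inj_image: "f ` F = f ` G \<longleftrightarrow> F = G" if "F \<subseteq> \<Union> K" "G \<subseteq> \<Union> K" for F G
    using inj_on_image_eq_iff[OF inj that] .
  have not_crit: "f ` F \<in> (`) f ` C \<longleftrightarrow> F \<in> C" if F: "F \<subseteq> \<Union> K" for F
  proof
    assume "f ` F \<in> (`) f ` C"
    then obtain G where G: "f ` F = f ` G" "G \<in> C" by (rule imageE)
    then have "G \<subseteq> \<Union> K" using crit_face[OF G(2)] by blast
    then have "F = G" using inj_image[OF F] G(1) by blast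
    then show "F \<in> C" using G(2) by simp
  qed (rule imageI)
  have minus: "f ` F - {f x} = f ` (F - {x})" if "F \<subseteq> \<Union> K" "x \<in> \<Union> K" for F x
    using inj_on_image_set_diff[OF inj, of F "{x}"] that by auto
  have e_vertex: "e F \<in> \<Union> K" if "F \<in> K - C" for F using insert_e[OF that] by blast
  have sub: "F \<subseteq> \<Union> K" if "F \<in> K" for F using that by blast
  have sub_image: "\<exists>F'. F' \<subseteq> F \<and> G = f ` F'" if "G \<subseteq> f ` F" for F G using that by (rule subset_imageE) blast
  show ?thesis
  proof
    show "finite ((`) f ` K)" using finite_K by simp
    show "finite G" "card G \<le> d" if "G \<in> (`) f ` K" for G
      using that finite_face card_face card_image_le le_trans by (blast, blast)
    show "G \<in> (`) f ` K" if FG: "F \<in> (`) f ` K" "G \<subseteq> F" for F G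
    proof -
      obtain F0 where F0: "F = f ` F0" "F0 \<in> K" using FG(1) by (rule imageE)
      obtain G0 where "G0 \<subseteq> F0" "G = f ` G0" using sub_image[of G F0] FG(2) F0(1) by auto
      then show ?thesis using face_closed[OF F0(2)] by simp
    qed
    show "F \<in> (`) f ` K" "card F = d" if "F \<in> (`) f ` C" for F
    proof -
      obtain F0 where F0: "F = f ` F0" "F0 \<in> C" using \<open>F \<in> _\<close> by (rule imageE)
      then show "F \<in> (`) f ` K" using crit_face by simp
      have "inj_on f F0" using inj sub[OF crit_face[OF F0(2)]] by (rule inj_on_subset)
      then show "card F = d" using card_crit[OF F0(2)] F0(1) by (simp add: card_image)
    qed
    fix F' assume F': "F' \<in> (`) f ` K"
    then obtain F where F: "F \<in> K" "F' = f ` F" by blast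
    show "\<rho> (?g G') \<le> \<rho> (?g F')" if G': "G' \<subseteq> F'" for G'
    proof -
      obtain G where G: "G \<subseteq> F" "G' = f ` G" using sub_image[of G' F] G' F(2) by auto
      have "?g G' = G" "?g F' = F"
        unfolding G(2) F(2) using g[of G] gK[OF F(1)] sub[OF F(1)] G(1) by auto
      then show ?thesis using \<rho>_mono[OF F(1) G(1)] by simp
    qed
  next
    fix F' assume "F' \<in> (`) f ` K - (`) f ` C"
    then obtain F where F: "F \<in> K - C" "F' = f ` F" by blast
    then have FK: "F \<in> K" by blast
    have gF: "?g F' = F" using gK[OF FK] F(2) by simp
    have ins: "insert (f (e F)) F' = f ` insert (e F) F" using F(2) by simp
    have insK: "insert (e F) F \<in> K - C" using insert_e[OF F(1)] .
    then have gins: "?g (insert (f (e F)) F') = insert (e F) F" unfolding ins by (intro gK) simp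
    have del: "F' - {f (e F)} = f ` (F - {e F})"
      unfolding F(2) using minus[OF sub[OF FK] e_vertex[OF F(1)]] .
    have delK: "F - {e F} \<in> K" using face_closed[OF FK] by blast
    then have gdel: "?g (F' - {f (e F)}) = F - {e F}" unfolding del by (rule gK)
    show "insert (f (e (?g F'))) F' \<in> (`) f ` K - (`) f ` C"
      unfolding gF ins using insK not_crit[OF sub, of "insert (e F) F"]
      by (simp del: image_insert)
    show "f (e (?g (insert (f (e (?g F'))) F'))) = f (e (?g F'))"
      unfolding gF gins using e_insert[OF F(1)] by simp
    show "\<rho> (?g (insert (f (e (?g F'))) F')) = \<rho> (?g F')"
      unfolding gF gins using \<rho>_insert[OF F(1)] by simp
    show "F' - {f (e (?g F'))} \<notin> (`) f ` C"
      unfolding gF del using remove_e[OF F(1)] not_crit[OF sub[OF delK]] by simp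
    show "f (e (?g (F' - {f (e (?g F'))}))) = f (e (?g F'))"
      unfolding gF gdel using e_remove[OF F(1)] by simp
    show "f (e (?g G')) = f (e (?g F'))"
      if G': "G' \<subseteq> F'" "G' \<notin> (`) f ` C" "\<rho> (?g G') = \<rho> (?g F')" for G'
    proof -
      obtain G where G: "G \<subseteq> F" "G' = f ` G" using sub_image[of G' F] G'(1) F(2) by auto
      have GK: "G \<subseteq> \<Union> K" using G(1) sub[OF FK] by blast
      have gG: "?g G' = G" unfolding G(2) by (rule g[OF GK])
      have "G \<notin> C" using G'(2) not_crit[OF GK] G(2) by simp
      then have "e G = e F" using e_eq[OF F(1) G(1)] G'(3) unfolding gG gF by simp
      then show ?thesis unfolding gG gF by simp
    qed
  qed
qed

theorem proposition4p5:
  fixes n :: nat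
    and orient :: "ltree set set \<Rightarrow> ltree set list"
  assumes "n \<ge> 3"
    and "\<And>\<sigma>. \<sigma> \<in> admissible_simplices n \<Longrightarrow> distinct (orient \<sigma>) \<and> set (orient \<sigma>) = \<sigma>"
  shows "is_Z_basis (reduced_cohomology (tree_complex n) (int n - 3))
           (admissible_simplices n)
           (\<lambda>\<sigma>. cohomology_class (tree_complex n) (int n - 3) (characteristic_cochain (orient \<sigma>)))
       \<and> (\<forall>p. p \<noteq> int n - 3 \<longrightarrow> trivial_group (reduced_cohomology (tree_complex n) p))"
proof -
  have n: "2 \<le> n" using assms(1) by simp
  have "matched_complex (cluster_complex {1..n}) (admissible_families {1..n})
      (chosen_bad {1..n}) (lightness {1..n}) (n - 2)"
    using matched_cluster_complex[of "{1..n}"] n by simp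
  from matched_complex_image[OF this inj_on_subset[OF cluster_vertex_inj cluster_complex_vertices]]
  obtain e \<rho> where "matched_complex (tree_complex n) (admissible_simplices n) e \<rho> (n - 2)"
    unfolding tree_complex_eq[OF n] admissible_simplices_eq[OF n] by blast
  then interpret matched_complex "tree_complex n" "admissible_simplices n" e \<rho> "n - 2" .
  have d: "int (n - 2) - 1 = int n - 3" using assms(1) by simp
  show ?thesis
    using critical_classes_basis[OF assms(2)] reduced_cohomology_trivial unfolding d by blast
qed

end
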